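(* There is an attack, operating in time polynomial in the size of the public key, to which all matching cryptosystems with zero limited noise from the family $\mathcal{F}$ described in the context are vulnerable. That is, there is a single algorithm which, for every system from $\mathcal{F}$ with zero limited noise and every message of that system, receives as input only the public key $(G,p,k,W)$ and the ciphertext $$A=W(e_{i_1})-W(e_{i_2})+\dots+(-1)^{d+1}W(e_{i_d})\in\mathbb{F}_p^k$$ of the message $(e_{i_1},\dots,e_{i_d})$ (and none of the private data: the secret vertex numbering, the secret weight function $\hat W$, the operator $M$), and recovers the message, i.e. the edges of the path or cycle, in time polynomial in the size of the public key.
   Context: **Alternating weighted path problem.** Given a graph $G=(V,E)$, a prime $p$, a positive integer $k$, a weight function $W:E\to\mathbb{F}_p^k$ and a vector $(a_1,\dots,a_k)\in\mathbb{F}_p^k$, determine whether there is a sequence of edges $(e_{i_1},\dots,e_{i_d})$ forming a simple path of arbitrary length or a simple cycle of even length such that $W(e_{i_1})-W(e_{i_2})+\dots+(-1)^{d+1}W(e_{i_d})=(a_1,\dots,a_k)$. **Matching cryptosystem.** The public key consists of a graph $G=(V,E)$, a prime $p$, a positive integer $k$, and a weight function $W:E\to\mathbb{F}_p^k$. The private key consists of a weight function $\hat W:E\to\mathbb{F}_p^k$ for which the corresponding alternating weighted path problem can be solved in polynomial time, and an invertible linear operator $M:\mathbb{F}_p^k\to\mathbb{F}_p^k$ with $\hat W(e)=M(W(e))$ for all $e\in E$, together with any additional objects used to construct $\hat W$. Messages are the simple paths and the simple cycles of even length in $G$. A message with consecutive edges $(e_{i_1},\dots,e_{i_d})$ is encrypted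 as $W(e_{i_1})-W(e_{i_2})+\dots+(-1)^{d+1}W(e_{i_d})$. **The family $\mathcal{F}$.** It consists of the matching cryptosystems of the following form. - $G=K_m$ is the complete graph on $m$ vertices, the dimension of the space of weights is $k=m$, and $p$ is a big enough prime, $p>2\cdot 3^{m-2}$. - A numbering $V=\{v_1,\dots,v_m\}$ of the vertices is fixed; it is part of the private key and is not connected to any labelling used in the public key. For $i<j$ write $\hat W(v_iv_j)=(\hat w_{i,j,1},\dots,\hat w_{i,j,k})$. - For each $1\le i\le m-1$ the sequence $(\hat w_{i,i+1,i},\hat w_{i,i+2,i},\dots,\hat w_{i,m,i})$ is a rapidly growing sequence: its terms, read as integer representatives in $\{0,\dots,p-1\}$, are positive and satisfy $3\,\hat w_{i,j,i}\le\hat w_{i,j+1,i}$ for $i<j<m$. - All other elements $\hat w_{i,j,t}$ (those with $t\ne i$) are used as noise: those with $i<t$ are called arbitrary noise, and those with $i>t$ are called limited noise. **Zero limited noise.** A system from $\mathcal{F}$ has zero limited noise if $\hat w_{i,j,t}=0$ for all $1\le t<i<j\le m$.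
   Formalization: Messages with different edges can share a ciphertext (m=3, p=7), so the attack is shown to return the edges of some message with the given ciphertext, and of the message itself whenever the ciphertext determines its edges or all rapidly growing terms are below p/2. *)

theory Defs
  imports
    Complex_Main
    "HOL-Library.FuncSet"
    "HOL-Library.Log_Nat"
    "HOL-Computational_Algebra.Primes"
    "HOL-Computational_Algebra.Polynomial"
begin

section \<open>Vectors over the prime field\<close>

text \<open>
  The prime varies inside the statement, so \<open>F_p\<close> is represented by the residues
  \<open>{0..<p}\<close> and \<open>F_p^k\<close> by the functions from \<open>{1..k}\<close> into it (undefined elsewhere).
\<close>

definition fp_space :: "nat \<Rightarrow> nat \<Rightarrow> (nat \<Rightarrow> int) set" where
  "fp_space p k = {1..k} \<rightarrow>\<^sub>E {0..<int p}"

definition fp_add :: "nat \<Rightarrow> nat \<Rightarrow> (nat \<Rightarrow> int) \<Rightarrow> (nat \<Rightarrow> int) \<Rightarrow> nat \<Rightarrow> int" where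
  "fp_add p k x y = (\<lambda>t\<in>{1..k}. (x t + y t) mod int p)"

definition fp_scale :: "nat \<Rightarrow> nat \<Rightarrow> int \<Rightarrow> (nat \<Rightarrow> int) \<Rightarrow> nat \<Rightarrow> int" where
  "fp_scale p k c x = (\<lambda>t\<in>{1..k}. (c * x t) mod int p)"

definition fp_linear :: "nat \<Rightarrow> nat \<Rightarrow> ((nat \<Rightarrow> int) \<Rightarrow> nat \<Rightarrow> int) \<Rightarrow> bool" where
  "fp_linear p k M \<longleftrightarrow>
     M \<in> fp_space p k \<rightarrow> fp_space p k \<and>
     (\<forall>x\<in>fp_space p k. \<forall>y\<in>fp_space p k. M (fp_add p k x y) = fp_add p k (M x) (M y)) \<and>
     (\<forall>c\<in>{0..<int p}. \<forall>x\<in>fp_space p k. M (fp_scale p k c x) = fp_scale p k c (M x))"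

definition fp_invertible_linear :: "nat \<Rightarrow> nat \<Rightarrow> ((nat \<Rightarrow> int) \<Rightarrow> nat \<Rightarrow> int) \<Rightarrow> bool" where
  "fp_invertible_linear p k M \<longleftrightarrow>
     fp_linear p k M \<and> bij_betw M (fp_space p k) (fp_space p k)"


section \<open>Matching cryptosystems\<close>

definition complete_edges :: "nat \<Rightarrow> nat set set" where
  "complete_edges n = {{u, v} |u v. u < v \<and> v < n}"

text \<open>A nonempty sequence of edges is a simple path or cycle if it is read off a vertex
  sequence without repetitions.\<close>

definition simple_path :: "nat set set \<Rightarrow> nat set list \<Rightarrow> bool" where
  "simple_path E es \<longleftrightarrow> es \<noteq> [] \<and> set es \<subseteq> E \<and>
     (\<exists>vs. distinct vs \<and> length vs = Suc (length es) \<and>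
           (\<forall>i<length es. es ! i = {vs ! i, vs ! Suc i}))"

definition simple_cycle :: "nat set set \<Rightarrow> nat set list \<Rightarrow> bool" where
  "simple_cycle E es \<longleftrightarrow> length es \<ge> 3 \<and> set es \<subseteq> E \<and>
     (\<exists>vs. distinct vs \<and> length vs = length es \<and>
           (\<forall>i<length es. es ! i = {vs ! i, vs ! (Suc i mod length es)}))"

definition message :: "nat set set \<Rightarrow> nat set list \<Rightarrow> bool" where
  "message E es \<longleftrightarrow> simple_path E es \<or> (simple_cycle E es \<and> even (length es))"

text \<open>The vertices of the public graph are \<open>{..<nverts}\<close>.\<close>

record public_key =
  nverts :: nat
  edges :: "nat set set"
  modulus :: nat
  wdim :: nat
  weight :: "nat set \<Rightarrow> nat \<Rightarrow> int"

definition encrypt :: "public_key \<Rightarrow> nat set list \<Rightarrow> nat \<Rightarrow> int" where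
  "encrypt pk es =
     (\<lambda>t\<in>{1..wdim pk}. (\<Sum>i<length es. (-1) ^ i * weight pk (es ! i) t) mod int (modulus pk))"

definition matching_cryptosystem ::
    "public_key \<Rightarrow> (nat set \<Rightarrow> nat \<Rightarrow> int) \<Rightarrow> ((nat \<Rightarrow> int) \<Rightarrow> nat \<Rightarrow> int) \<Rightarrow> bool" where
  "matching_cryptosystem pk What M \<longleftrightarrow>
     edges pk \<subseteq> complete_edges (nverts pk) \<and> prime (modulus pk) \<and> wdim pk \<ge> 1 \<and>
     (\<forall>e\<in>edges pk. weight pk e \<in> fp_space (modulus pk) (wdim pk)) \<and>
     fp_invertible_linear (modulus pk) (wdim pk) M \<and>
     (\<forall>e\<in>edges pk. What e = M (weight pk e))"

text \<open>The secret numbering sends \<open>i\<close> to the vertex \<open>v_i\<close>, and \<open>What {v_i, v_j} t\<close>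
  is the entry with index \<open>(i, j, t)\<close>.\<close>

definition in_family ::
    "public_key \<Rightarrow> (nat set \<Rightarrow> nat \<Rightarrow> int) \<Rightarrow> ((nat \<Rightarrow> int) \<Rightarrow> nat \<Rightarrow> int) \<Rightarrow> (nat \<Rightarrow> nat) \<Rightarrow> bool" where
  "in_family pk What M v \<longleftrightarrow>
     matching_cryptosystem pk What M \<and>
     edges pk = complete_edges (nverts pk) \<and>
     wdim pk = nverts pk \<and>
     real (modulus pk) > 2 * 3 powi (int (nverts pk) - 2) \<and>
     bij_betw v {1..nverts pk} {..<nverts pk} \<and>
     (\<forall>i j. 1 \<le> i \<and> i < j \<and> j \<le> nverts pk \<longrightarrow> 0 < What {v i, v j} i) \<and>
     (\<forall>i j. 1 \<le> i \<and> i < j \<and> j < nverts pk \<longrightarrow>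
        3 * What {v i, v j} i \<le> What {v i, v (Suc j)} i)"

definition zero_limited_noise ::
    "nat \<Rightarrow> (nat set \<Rightarrow> nat \<Rightarrow> int) \<Rightarrow> (nat \<Rightarrow> nat) \<Rightarrow> bool" where
  "zero_limited_noise m What v \<longleftrightarrow>
     (\<forall>t i j. 1 \<le> t \<and> t < i \<and> i < j \<and> j \<le> m \<longrightarrow> What {v i, v j} t = 0)"

text \<open>
  The terms of the rapidly growing sequences stay below \<open>p/2\<close>, so that such a term, or a
  difference of two of them, cannot coincide modulo \<open>p\<close> with the negative of another one.
  This is not part of \<open>in_family\<close>; without it, encryption need not be injective,
  see \<open>ciphertext_ambiguous\<close> below.
\<close>

definition no_wraparound ::
    "public_key \<Rightarrow> (nat set \<Rightarrow> nat \<Rightarrow> int) \<Rightarrow> (nat \<Rightarrow> nat) \<Rightarrow> bool" where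
  "no_wraparound pk What v \<longleftrightarrow>
     (\<forall>i j. 1 \<le> i \<and> i < j \<and> j \<le> nverts pk \<longrightarrow> 2 * What {v i, v j} i < int (modulus pk))"


section \<open>Algorithms\<close>

text \<open>
  Structured programs for a random access machine with logarithmic cost. The memory is a
  finite number (in each program) of named unbounded arrays of natural numbers. An access is
  charged for the length of the address and of the value, a binary operation for the product
  of the lengths of its operands, so that time is polynomially related to Turing machine time.
\<close>

type_synonym mem = "string \<Rightarrow> nat \<Rightarrow> nat"

datatype binop = Add | Sub | Mul | Div | Mod | Less | Equal

datatype exp = Const nat | Read string exp | Bin binop exp exp

datatype com =
    Skip
  | Write string exp exp
  | Seq com com
  | If exp com com
  | While exp com

fun bin_val :: "binop \<Rightarrow> nat \<Rightarrow> nat \<Rightarrow> nat" where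
  "bin_val Add x y = x + y"
| "bin_val Sub x y = x - y"
| "bin_val Mul x y = x * y"
| "bin_val Div x y = x div y"
| "bin_val Mod x y = x mod y"
| "bin_val Less x y = (if x < y then 1 else 0)"
| "bin_val Equal x y = (if x = y then 1 else 0)"

fun val :: "exp \<Rightarrow> mem \<Rightarrow> nat" where
  "val (Const n) s = n"
| "val (Read a e) s = s a (val e s)"
| "val (Bin f e1 e2) s = bin_val f (val e1 s) (val e2 s)"

text \<open>The number of binary digits of a word, plus one for a delimiter.\<close>

definition len :: "nat \<Rightarrow> nat" where
  "len n = Suc (floorlog 2 n)"

fun cost :: "exp \<Rightarrow> mem \<Rightarrow> nat" where
  "cost (Const n) s = len n"
| "cost (Read a e) s = cost e s + len (val e s) + len (s a (val e s))"
| "cost (Bin f e1 e2) s = cost e1 s + cost e2 s + len (val e1 s) * len (val e2 s)"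

definition mem_update :: "mem \<Rightarrow> string \<Rightarrow> nat \<Rightarrow> nat \<Rightarrow> mem" where
  "mem_update s a i x = s(a := (s a)(i := x))"

text \<open>\<open>exec c s n s'\<close>: started in \<open>s\<close>, the program \<open>c\<close> halts in \<open>s'\<close> after time \<open>n\<close>.\<close>

inductive exec :: "com \<Rightarrow> mem \<Rightarrow> nat \<Rightarrow> mem \<Rightarrow> bool" where
  Skip: "exec Skip s 1 s"
| Write: "exec (Write a e1 e2) s
     (cost e1 s + cost e2 s + len (val e1 s) + len (val e2 s))
     (mem_update s a (val e1 s) (val e2 s))"
| Seq: "exec c1 s n1 s1 \<Longrightarrow> exec c2 s1 n2 s2 \<Longrightarrow> exec (Seq c1 c2) s (n1 + n2) s2"
| IfTrue: "val e s \<noteq> 0 \<Longrightarrow> exec c1 s n s' \<Longrightarrow> exec (If e c1 c2) s (cost e s + n) s'"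
| IfFalse: "val e s = 0 \<Longrightarrow> exec c2 s n s' \<Longrightarrow> exec (If e c1 c2) s (cost e s + n) s'"
| WhileFalse: "val e s = 0 \<Longrightarrow> exec (While e c) s (cost e s) s"
| WhileTrue: "val e s \<noteq> 0 \<Longrightarrow> exec c s n1 s1 \<Longrightarrow> exec (While e c) s1 n2 s2 \<Longrightarrow>
     exec (While e c) s (cost e s + n1 + n2) s2"

inductive_cases exec_SkipE: "exec Skip s n s'"
inductive_cases exec_WriteE: "exec (Write a e1 e2) s n s'"
inductive_cases exec_SeqE: "exec (Seq c1 c2) s n s'"
inductive_cases exec_IfE: "exec (If e c1 c2) s n s'"
inductive_cases exec_WhileE: "exec (While e c) s n s'"

lemma exec_deterministic:
  "exec c s n s' \<Longrightarrow> exec c s n' s'' \<Longrightarrow> n = n' \<and> s' = s''"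
proof (induction arbitrary: n' s'' rule: exec.induct)
  case (Skip s)
  from Skip.prems show ?case by (elim exec_SkipE) simp_all
next
  case (Write a e1 e2 s)
  from Write.prems show ?case by (elim exec_WriteE) simp_all
next
  case (Seq c1 s n1 s1 c2 n2 s2)
  from Seq.prems obtain m1 t1 m2 where "exec c1 s m1 t1" "exec c2 t1 m2 s''" "n' = m1 + m2"
    by (rule exec_SeqE)
  with Seq.IH(1)[of m1 t1] Seq.IH(2)[of m2 s''] show ?case by simp
next
  case (IfTrue e s c1 n s' c2)
  from IfTrue.prems IfTrue.hyps obtain m where "exec c1 s m s''" "n' = cost e s + m"
    by (elim exec_IfE) simp_all
  with IfTrue.IH[of m s''] show ?case by simp
next
  case (IfFalse e s c2 n s' c1)
  from IfFalse.prems IfFalse.hyps obtain m where "exec c2 s m s''" "n' = cost e s + m"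
    by (elim exec_IfE) simp_all
  with IfFalse.IH[of m s''] show ?case by simp
next
  case (WhileFalse e s c)
  from WhileFalse.prems show ?case
    by (rule exec_WhileE) (use WhileFalse.hyps in simp_all)
next
  case (WhileTrue e s c n1 s1 n2 s2)
  from WhileTrue.prems obtain m1 t1 m2
    where "exec c s m1 t1" "exec (While e c) t1 m2 s''" "n' = cost e s + m1 + m2"
    by (rule exec_WhileE) (use WhileTrue.hyps(1) in simp_all)
  with WhileTrue.IH(1)[of m1 t1] WhileTrue.IH(2)[of m2 s''] show ?case by simp
qed


section \<open>Input and output\<close>

text \<open>The edges are listed in a fixed order, each with its end points and its weight.\<close>

definition encode_vector :: "nat \<Rightarrow> (nat \<Rightarrow> int) \<Rightarrow> nat list" where
  "encode_vector k x = map (\<lambda>t. nat (x t)) [1..<Suc k]"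

definition edge_list :: "public_key \<Rightarrow> (nat \<times> nat) list" where
  "edge_list pk = [(u, v). v \<leftarrow> [0..<nverts pk], u \<leftarrow> [0..<v], {u, v} \<in> edges pk]"

definition encode_key :: "public_key \<Rightarrow> nat list" where
  "encode_key pk =
     [nverts pk, length (edge_list pk), modulus pk, wdim pk] @
     concat (map (\<lambda>(u, v). u # v # encode_vector (wdim pk) (weight pk {u, v})) (edge_list pk))"

definition key_size :: "public_key \<Rightarrow> nat" where
  "key_size pk = (\<Sum>x\<leftarrow>encode_key pk. len x)"

definition attack_input :: "public_key \<Rightarrow> (nat \<Rightarrow> int) \<Rightarrow> nat list" where
  "attack_input pk A = encode_key pk @ encode_vector (wdim pk) A"

definition initial_mem :: "nat list \<Rightarrow> mem" where
  "initial_mem xs = (\<lambda>a i. if a = ''in'' \<and> i < length xs then xs ! i else 0)"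

text \<open>The output is the number of edges followed by the end points of the edges.\<close>

definition output_edges :: "mem \<Rightarrow> nat set set" where
  "output_edges s = {{s ''out'' (2 * i + 1), s ''out'' (2 * i + 2)} |i. i < s ''out'' 0}"


section \<open>Ambiguous ciphertexts\<close>

text \<open>
  A system with zero limited noise and two messages with different edges but the same
  ciphertext: no algorithm can recover the message from the ciphertext in general.
\<close>

lemma ciphertext_ambiguous:
  "\<exists>pk What M v P Q. in_family pk What M v \<and> zero_limited_noise (nverts pk) What v \<and>
     message (edges pk) P \<and> message (edges pk) Q \<and>
     encrypt pk P = encrypt pk Q \<and> set P \<noteq> set Q"
proof -
  define W :: "nat set \<Rightarrow> nat \<Rightarrow> int" where
    "W = (\<lambda>e. if e = {0, 1} then (\<lambda>t\<in>{1..3}. if t \<le> 2 then 1 else 0)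
            else if e = {0, 2} then (\<lambda>t\<in>{1..3}. if t = 1 then 6 else 0)
            else (\<lambda>t\<in>{1..3}. if t = 2 then 1 else 0))"
  define pk where
    "pk = \<lparr>nverts = 3, edges = complete_edges 3, modulus = 7, wdim = 3, weight = W\<rparr>"
  define v :: "nat \<Rightarrow> nat" where "v = (\<lambda>i. i - 1)"
  have ne: "{0, 1} \<noteq> {0, 2::nat}" "{0, 1} \<noteq> {1, 2::nat}" "{0, 2} \<noteq> {1, 2::nat}"
    by (simp_all add: doubleton_eq_iff)
  have W: "W {0, Suc 0} = (\<lambda>t\<in>{1..3}. if t \<le> 2 then 1 else 0)"
          "W {0, 2} = (\<lambda>t\<in>{1..3}. if t = 1 then 6 else 0)"
          "W {Suc 0, 2} = (\<lambda>t\<in>{1..3}. if t = 2 then 1 else 0)"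
    by (simp_all add: W_def doubleton_eq_iff)
  have E: "complete_edges 3 = {{0, 1}, {0, 2}, {1, 2}}"
  proof (intro subset_antisym subsetI)
    fix e assume "e \<in> complete_edges 3"
    then obtain a b where e: "e = {a, b}" and ab: "a < b" "b < (3 :: nat)"
      unfolding complete_edges_def by blast
    from ab consider "a = 0" "b = 1" | "a = 0" "b = 2" | "a = 1" "b = 2" by linarith
    then show "e \<in> {{0, 1}, {0, 2}, {1, 2}}" by cases (simp_all add: e)
  next
    fix e assume "e \<in> {{0, 1}, {0, 2}, {1, 2 :: nat}}"
    then consider "e = {0, 1}" | "e = {0, 2}" | "e = {1, 2}" by blast
    then show "e \<in> complete_edges 3"
    proof cases
      case 1
      have "0 < (1 :: nat) \<and> 1 < (3 :: nat)" by simp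
      with 1 show ?thesis unfolding complete_edges_def by blast
    next
      case 2
      have "0 < (2 :: nat) \<and> 2 < (3 :: nat)" by simp
      with 2 show ?thesis unfolding complete_edges_def by blast
    next
      case 3
      have "1 < (2 :: nat) \<and> 2 < (3 :: nat)" by simp
      with 3 show ?thesis unfolding complete_edges_def by blast
    qed
  qed
  have WV: "W e \<in> fp_space 7 3" for e
    by (auto simp: W_def fp_space_def)
  have M: "fp_invertible_linear 7 3 id"
    by (simp add: fp_invertible_linear_def fp_linear_def)
  have "prime (7 :: nat)" by simp
  moreover have "bij_betw v {1..3} {..<3}"
    by (rule bij_betwI[where g = Suc]) (auto simp: v_def)
  moreover have "0 < W {v i, v j} i" if "1 \<le> i" "i < j" "j \<le> 3" for i j
  proof -
    from that consider "i = 1" "j = 2" | "i = 1" "j = 3" | "i = 2" "j = 3" by linarith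
    then show ?thesis by cases (simp_all add: W v_def)
  qed
  moreover have "3 * W {v i, v j} i \<le> W {v i, v (Suc j)} i" if "1 \<le> i" "i < j" "j < 3" for i j
  proof -
    from that have "i = 1" "j = 2" by linarith+
    then show ?thesis by (simp add: W v_def)
  qed
  ultimately have fam: "in_family pk W id v"
    using WV M by (auto simp: in_family_def matching_cryptosystem_def pk_def)
  have noise: "zero_limited_noise (nverts pk) W v"
    unfolding zero_limited_noise_def
  proof (intro allI impI)
    fix t i j :: nat
    assume "1 \<le> t \<and> t < i \<and> i < j \<and> j \<le> nverts pk"
    then have "t = 1" "i = 2" "j = 3" by (simp_all add: pk_def)
    then show "W {v i, v j} t = 0" by (simp add: W v_def)
  qed
  have P: "message (edges pk) [{0, 1}]"
    unfolding message_def simple_path_def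
    by (intro disjI1 conjI exI[of _ "[0, 1]"]) (auto simp: pk_def E)
  have Q: "message (edges pk) [{1, 2}, {0, 2}]"
    unfolding message_def simple_path_def
    by (intro disjI1 conjI exI[of _ "[1, 2, 0]"]) (auto simp: pk_def E less_Suc_eq)
  have "encrypt pk [{0, 1}] = encrypt pk [{1, 2}, {0, 2}]"
  proof
    fix t :: nat
    have "t = 1 \<or> t = 2 \<or> t = 3 \<or> t \<notin> {1..3}"
      unfolding atLeastAtMost_iff by linarith
    then show "encrypt pk [{0, 1}] t = encrypt pk [{1, 2}, {0, 2}] t"
      using W by (auto simp: encrypt_def pk_def)
  qed
  moreover have "set [{0, 1}] \<noteq> set [{1, 2}, {0, 2::nat}]"
    by (simp add: doubleton_eq_iff)
  ultimately show ?thesis using fam noise P Q by blast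
qed

end

theory Submission
  imports Defs "HOL-Number_Theory.Cong"
begin

text \<open>
  In secret coordinates the edges inside \<open>{v_i, \<dots>, v_m}\<close> vanish before coordinate \<open>i\<close>, and
  the coordinate \<open>i\<close> of the edges at \<open>v_i\<close> grows rapidly, so the differences of two such values
  are distinct modulo \<open>p\<close>, except for wrap-around caused by edges at \<open>v_m\<close>. A message has at
  each vertex at most one edge with positive and one with negative sign. The attack guesses
  \<open>v_m\<close> and its two partners and subtracts their edges from the ciphertext. It then looks for a
  vertex \<open>u\<close> such that exactly one choice of partners of \<open>u\<close> moves the residual into the span of
  the edges avoiding \<open>u\<close>. The correct choice always does this, so a unique choice is
  the correct one, and the first remaining \<open>v_i\<close> is always such a vertex. Span
  membership does not depend on the secret basis. Once all partners are known the message is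
  read off by walking along them with alternating signs; wrong guesses are discarded by encrypting the
  resulting walk.
\<close>

section \<open>Programs with loops of fixed length\<close>

text \<open>The attacker knows neither the numbering nor \<open>M\<close>, so the triangular shape
  of the secret weights is available to the proof but never to the program. The link between the two
  is the notion \<open>functional\<close>: a secret coordinate and a row computed by elimination are
  both linear forms modulo \<open>p\<close> on public vectors. A candidate killed by all computed
  rows is also annihilated by the secret coordinate that vanishes on the remaining edges; no basis
  or dimension has to be discussed.

  The last vertex needs a guess because its entries may exceed \<open>p / 2\<close>, and then a
  negated large entry passes for a small one, as \<open>- 6\<close> does for \<open>1\<close> modulo
  \<open>7\<close> in \<open>ciphertext_ambiguous\<close>. One vertex with two partners costs only a
  factor \<open>m ^ 3\<close>. Since every output is checked by encryption, the decoding invariants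
  are needed for the one correct guess, while safety holds for all guesses.\<close>

text \<open>
  All loops and sums run over \<open>{..<n}\<close> with \<open>n\<close> the first input cell, and \<open>Var k\<close> is the variable
  bound by the \<open>k\<close>-th enclosing binder, counted from the outside. Every stored value is
  reduced modulo \<open>cap\<close>, so the memory stays bounded without any semantic
  argument and the running time is polynomial for syntactic reasons.
\<close>

datatype expr = Num nat | Var nat | At string expr | Op binop expr expr | SumE expr

datatype prog = Put string expr expr | Then prog prog (infixr \<open>;;\<close> 60) | When expr prog | For prog

fun ev :: "expr \<Rightarrow> nat list \<Rightarrow> mem \<Rightarrow> nat" where
  "ev (Num n) r s = n"
| "ev (Var k) r s = r ! k"
| "ev (At a e) r s = s a (ev e r s)"
| "ev (Op f e1 e2) r s = bin_val f (ev e1 r s) (ev e2 r s)"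
| "ev (SumE e) r s = (\<Sum>i<s ''in'' 0. ev e (r @ [i]) s)"

text \<open>Exceeds both \<open>p\<close> and \<open>n\<close>, so on a correct input the reduction
  changes no residue, vertex or edge count that the attack relies on. The summand 1 keeps the
  modulus positive for every memory; reduction modulo 0 would be the identity.\<close>

definition cap :: "mem \<Rightarrow> nat" where
  "cap s = s ''in'' 2 + s ''in'' 0 + 1"

fun run :: "prog \<Rightarrow> nat list \<Rightarrow> mem \<Rightarrow> mem" where
  "run (Put a e1 e2) r s = mem_update s a (ev e1 r s) (ev e2 r s mod cap s)"
| "run (c1 ;; c2) r s = run c2 r (run c1 r s)"
| "run (When e c) r s = (if ev e r s \<noteq> 0 then run c r s else s)"
| "run (For c) r s = fold (\<lambda>i. run c (r @ [i])) [0..<s ''in'' 0] s"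

text \<open>The arrays \<open>''v''\<close> and \<open>''acc''\<close> are scratch space of the
  compiled code. Source and compiled memory differ there, so no source expression may look at
  them.\<close>

fun wf_expr :: "nat \<Rightarrow> expr \<Rightarrow> bool" where
  "wf_expr d (Num n) = True"
| "wf_expr d (Var k) = (k < d)"
| "wf_expr d (At a e) = (a \<noteq> ''v'' \<and> a \<noteq> ''acc'' \<and> wf_expr d e)"
| "wf_expr d (Op f e1 e2) = (wf_expr d e1 \<and> wf_expr d e2)"
| "wf_expr d (SumE e) = wf_expr (Suc d) e"

text \<open>Writes to \<open>''in''\<close> are excluded because loop lengths and \<open>cap\<close>
  are read from it and must stay constant.\<close>

fun wf_prog :: "nat \<Rightarrow> prog \<Rightarrow> bool" where
  "wf_prog d (Put a e1 e2) = (a \<noteq> ''v'' \<and> a \<noteq> ''acc'' \<and> a \<noteq> ''in'' \<and> wf_expr d e1 \<and> wf_expr d e2)"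
| "wf_prog d (c1 ;; c2) = (wf_prog d c1 \<and> wf_prog d c2)"
| "wf_prog d (When e c) = (wf_expr d e \<and> wf_prog d c)"
| "wf_prog d (For c) = wf_prog (Suc d) c"

definition acc :: "nat \<Rightarrow> exp" where "acc n = Read ''acc'' (Const n)"

definition loop :: "nat \<Rightarrow> com \<Rightarrow> com" where
  "loop d c = Seq (Write ''v'' (Const d) (Const 0))
     (While (Bin Less (Read ''v'' (Const d)) (Read ''in'' (Const 0)))
       (Seq c (Write ''v'' (Const d) (Bin Add (Read ''v'' (Const d)) (Const 1)))))"

text \<open>\<open>''acc''\<close> serves as an evaluation stack of height \<open>n\<close>: pending
  operands lie below cell \<open>n\<close>, and the result goes to cell \<open>n\<close>. The depth
  \<open>d\<close> is the number of loop variables in use, so a new loop takes cell \<open>d\<close>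
  of \<open>''v''\<close>.\<close>

fun compile_expr :: "nat \<Rightarrow> nat \<Rightarrow> expr \<Rightarrow> com" where
  "compile_expr d n (Num c) = Write ''acc'' (Const n) (Const c)"
| "compile_expr d n (Var k) = Write ''acc'' (Const n) (Read ''v'' (Const k))"
| "compile_expr d n (At a e) =
     Seq (compile_expr d n e) (Write ''acc'' (Const n) (Read a (acc n)))"
| "compile_expr d n (Op f e1 e2) =
     Seq (compile_expr d n e1) (Seq (compile_expr d (Suc n) e2)
       (Write ''acc'' (Const n) (Bin f (acc n) (acc (Suc n)))))"
| "compile_expr d n (SumE e) =
     Seq (Write ''acc'' (Const n) (Const 0))
       (loop d (Seq (compile_expr (Suc d) (Suc n) e)
         (Write ''acc'' (Const n) (Bin Add (acc n) (acc (Suc n))))))"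

fun compile :: "nat \<Rightarrow> prog \<Rightarrow> com" where
  "compile d (Put a e1 e2) =
     Seq (compile_expr d 0 e1) (Seq (compile_expr d 1 e2)
       (Write a (acc 0) (Bin Mod (acc 1)
         (Bin Add (Bin Add (Read ''in'' (Const 2)) (Read ''in'' (Const 0))) (Const 1)))))"
| "compile d (c1 ;; c2) = Seq (compile d c1) (compile d c2)"
| "compile d (When e c) = Seq (compile_expr d 0 e) (If (acc 0) (compile d c) Skip)"
| "compile d (For c) = loop d (compile (Suc d) c)"

text \<open>The compiled program keeps loop variables in \<open>''v''\<close> and intermediate results in \<open>''acc''\<close>.\<close>

definition agrees :: "nat list \<Rightarrow> mem \<Rightarrow> mem \<Rightarrow> bool" where
  "agrees r s t \<longleftrightarrow> (\<forall>k<length r. t ''v'' k = r ! k) \<and> (\<forall>a. a \<noteq> ''v'' \<and> a \<noteq> ''acc'' \<longrightarrow> t a = s a)"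

text \<open>One parameter \<open>N\<close> controls word lengths, loop lengths and loop indices at
  once. All time bounds are polynomials in it, and \<open>key_size\<close> is a legitimate value for
  the initial memory.\<close>

definition bounded :: "nat \<Rightarrow> nat list \<Rightarrow> mem \<Rightarrow> bool" where
  "bounded N r s \<longleftrightarrow> (\<forall>a i. s a i \<le> 2 ^ N) \<and> s ''in'' 0 \<le> N \<and> cap s \<le> 2 ^ N \<and> (\<forall>i\<in>set r. i \<le> N)"

section \<open>Bit lengths of intermediate values\<close>

lemma len_le_Suc: "len n \<le> Suc n"
  unfolding len_def
  by (simp add: floorlog_le_iff)

lemma len_le: "x \<le> 2 ^ k \<Longrightarrow> len x \<le> k + 2"
proof -
  assume "x \<le> 2 ^ k"
  then have "x < 2 ^ Suc k" by (simp add: le_less_trans)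
  then have "floorlog 2 x \<le> Suc k" by (simp add: floorlog_le_iff)
  then show ?thesis by (simp add: len_def)
qed

lemma less_two_power_len: "x < 2 ^ (len x - 1)"
proof (cases "x = 0")
  case False
  then show ?thesis using floorlog_bounds[of x 2] by (simp add: len_def)
qed (simp add: len_def)

lemma mem_update_simps [simp]:
  "mem_update s a i x a j = (if j = i then x else s a j)"
  "a \<noteq> b \<Longrightarrow> mem_update s a i x b = s b"
  by (auto simp: mem_update_def)

text \<open>Intermediate values are not reduced and could grow, but only by an amount fixed by the
  syntax: every operator satisfies \<open>bin_val f x y \<le> (x + 1) * (y + 1)\<close>, so bit
  lengths essentially add, and a sum contributes one factor \<open>n\<close>. Using
  \<open>Suc N\<close> instead of \<open>N\<close> leaves room for constants when
  \<open>N = 0\<close>.\<close>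

lemma ev_le: "wf_expr d e \<Longrightarrow>
  \<exists>c. \<forall>N r s. length r = d \<longrightarrow> bounded N r s \<longrightarrow> ev e r s \<le> 2 ^ (c * Suc N)"
proof (induction e arbitrary: d)
  case (Num n)
  show ?case
  proof (rule exI[of _ n], intro allI impI)
    fix N r s
    have "n \<le> 2 ^ n" by (simp add: less_imp_le)
    also have "(2::nat) ^ n \<le> 2 ^ (n * Suc N)" by (rule power_increasing) auto
    finally show "ev (Num n) r s \<le> 2 ^ (n * Suc N)" by simp
  qed
next
  case (Var k)
  show ?case
  proof (rule exI[of _ 1], intro allI impI)
    fix N :: nat and r s assume "length r = d" "bounded N r s"
    with Var have "r ! k \<le> N" by (simp add: bounded_def)
    also have "N \<le> 2 ^ Suc N" using less_exp[of "Suc N"] by linarith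
    finally show "ev (Var k) r s \<le> 2 ^ (1 * Suc N)" by simp
  qed
next
  case (At a e)
  show ?case
  proof (rule exI[of _ 1], intro allI impI)
    fix N r s assume "length r = d" "bounded N r s"
    then have "s a (ev e r s) \<le> 2 ^ N" by (simp add: bounded_def)
    also have "(2::nat) ^ N \<le> 2 ^ Suc N" by simp
    finally show "ev (At a e) r s \<le> 2 ^ (1 * Suc N)" by simp
  qed
next
  case (Op f e1 e2)
  from Op.IH(1)[of d] Op.prems obtain c1 where
    c1: "\<And>N r s. length r = d \<Longrightarrow> bounded N r s \<Longrightarrow> ev e1 r s \<le> 2 ^ (c1 * Suc N)" by auto
  from Op.IH(2)[of d] Op.prems obtain c2 where
    c2: "\<And>N r s. length r = d \<Longrightarrow> bounded N r s \<Longrightarrow> ev e2 r s \<le> 2 ^ (c2 * Suc N)" by auto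
  show ?case
  proof (rule exI[of _ "c1 + c2 + 2"], intro allI impI)
    fix N r s assume r: "length r = d" "bounded N r s"
    define x y where "x = ev e1 r s" and "y = ev e2 r s"
    have "x + 1 \<le> 2 ^ (c1 * Suc N) + 2 ^ (c1 * Suc N)"
      using c1[OF r] unfolding x_def by (intro add_mono) auto
    then have x: "x + 1 \<le> 2 ^ (c1 * Suc N + 1)" by simp
    have "y + 1 \<le> 2 ^ (c2 * Suc N) + 2 ^ (c2 * Suc N)"
      using c2[OF r] unfolding y_def by (intro add_mono) auto
    then have y: "y + 1 \<le> 2 ^ (c2 * Suc N + 1)" by simp
    have "bin_val f x y \<le> (x + 1) * (y + 1)"
      by (cases f) (auto simp: algebra_simps intro: le_trans[OF div_le_dividend] le_trans[OF mod_less_eq_dividend])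
    also have "\<dots> \<le> 2 ^ (c1 * Suc N + 1) * 2 ^ (c2 * Suc N + 1)"
      by (rule mult_le_mono[OF x y])
    also have "\<dots> = 2 ^ (c1 * Suc N + 1 + (c2 * Suc N + 1))" by (simp only: power_add)
    also have "\<dots> \<le> 2 ^ ((c1 + c2 + 2) * Suc N)"
      by (rule power_increasing) (simp_all add: algebra_simps)
    finally show "ev (Op f e1 e2) r s \<le> 2 ^ ((c1 + c2 + 2) * Suc N)" by (simp add: x_def y_def)
  qed
next
  case (SumE e)
  from SumE.IH[of "Suc d"] SumE.prems obtain c where
    c: "\<And>N r s. length r = Suc d \<Longrightarrow> bounded N r s \<Longrightarrow> ev e r s \<le> 2 ^ (c * Suc N)" by auto
  show ?case
  proof (rule exI[of _ "c + 1"], intro allI impI)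
    fix N r s assume r: "length r = d" "bounded N r s"
    have "ev (SumE e) r s \<le> (\<Sum>i<s ''in'' 0. 2 ^ (c * Suc N))"
      unfolding ev.simps
    proof (rule sum_mono)
      fix i assume "i \<in> {..<s ''in'' 0}"
      with r have "bounded N (r @ [i]) s" by (auto simp: bounded_def)
      with r show "ev e (r @ [i]) s \<le> 2 ^ (c * Suc N)" by (intro c) auto
    qed
    also have "\<dots> = s ''in'' 0 * 2 ^ (c * Suc N)" by simp
    also have "\<dots> \<le> 2 ^ Suc N * 2 ^ (c * Suc N)"
      using r less_exp[of "Suc N"] by (intro mult_le_mono) (auto simp: bounded_def)
    also have "\<dots> = 2 ^ ((c + 1) * Suc N)" by (simp add: power_add)
    finally show "ev (SumE e) r s \<le> 2 ^ ((c + 1) * Suc N)" .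
  qed
qed

text \<open>Test and increment cost at most a constant times a product of two lengths, and each
  length is at most \<open>m + d + 2\<close> by the crude bound \<open>len_le_Suc\<close>. This is
  affordable because loop lengths are at most \<open>N\<close>. By \<open>upd\<close> the invariant
  ignores the counter cell, which the loop itself overwrites.\<close>

lemma exec_loop:
  assumes body: "\<And>i t. i < m \<Longrightarrow> I i t \<Longrightarrow> t ''v'' d = i \<Longrightarrow>
      \<exists>k t'. exec c t k t' \<and> k \<le> T \<and> I (Suc i) t' \<and> t' ''v'' d = i"
    and upd: "\<And>i t x. I i t \<Longrightarrow> I i (mem_update t ''v'' d x)"
    and m: "\<And>i t. I i t \<Longrightarrow> t ''in'' 0 = m"
    and I0: "I 0 t"
  shows "\<exists>k t'. exec (loop d c) t k t' \<and> k \<le> Suc m * (T + 40 * (m + d + 2)\<^sup>2) \<and> I m t'"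
proof -
  define X where "X = m + d + 2"
  let ?b = "Bin Less (Read ''v'' (Const d)) (Read ''in'' (Const 0))"
  let ?inc = "Write ''v'' (Const d) (Bin Add (Read ''v'' (Const d)) (Const 1))"
  let ?w = "While ?b (Seq c ?inc)"
  have X2: "X \<le> X\<^sup>2" by (simp add: X_def power2_eq_square)
  have lX: "len x \<le> X" if "x \<le> m + 1 \<or> x \<le> d" for x
    using len_le_Suc[of x] that by (auto simp: X_def)
  have l0: "len 0 \<le> X" "len 1 \<le> X" "len d \<le> X" "len (Suc 0) \<le> X" by (rule lX; simp)+
  have l2: "len x * len y \<le> X\<^sup>2" if "x \<le> m + 1" "y \<le> m + 1" for x y
    unfolding power2_eq_square using that by (intro mult_le_mono lX) auto
  \<comment> \<open>Induction on the number \<open>j\<close> of iterations still to be done; the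
    counter then stands at \<open>m - j\<close>.\<close>
  have while: "\<exists>k t'. exec ?w t k t' \<and> k \<le> j * (T + 20 * X\<^sup>2) + 20 * X\<^sup>2 \<and> I m t'"
    if "I (m - j) t" "t ''v'' d = m - j" "j \<le> m" for j t
    using that
  proof (induction j arbitrary: t)
    case 0
    then have "exec ?w t (cost ?b t) t" using m[OF 0(1)] by (intro WhileFalse) simp
    moreover have "cost ?b t \<le> 20 * X\<^sup>2"
      using m[OF 0(1)] 0 l0 l2[of m m] lX[of m] X2 by simp
    ultimately show ?case using 0 by auto
  next
    case (Suc j)
    define i where "i = m - Suc j"
    have i: "i < m" "Suc i = m - j" using Suc.prems by (auto simp: i_def)
    from body[of i t] i Suc.prems obtain k t1 where
      t1: "exec c t k t1" "k \<le> T" "I (Suc i) t1" "t1 ''v'' d = i" unfolding i_def by blast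
    define t2 where "t2 = mem_update t1 ''v'' d (Suc i)"
    have "exec ?inc t1 (cost (Const d) t1 + cost (Bin Add (Read ''v'' (Const d)) (Const 1)) t1
        + len d + len (Suc i)) t2"
      using Write[of "''v''" "Const d" "Bin Add (Read ''v'' (Const d)) (Const 1)" t1] t1 
      by (simp add: t2_def)
    then obtain k2 where k2: "exec ?inc t1 k2 t2" "k2 \<le> 10 * X\<^sup>2"
    proof -
      assume *: "\<And>k2. exec ?inc t1 k2 t2 \<Longrightarrow> k2 \<le> 10 * X\<^sup>2 \<Longrightarrow> thesis"
      have "cost (Const d) t1 + cost (Bin Add (Read ''v'' (Const d)) (Const 1)) t1
        + len d + len (Suc i) \<le> 10 * X\<^sup>2"
        using t1 i l0 l2[of i 1] lX[of i] lX[of "Suc i"] X2 by simp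
      with * \<open>exec ?inc t1 _ t2\<close> show thesis by blast
    qed
    have "I (m - j) t2" "t2 ''v'' d = m - j"
      using t1 i upd[of "Suc i" t1 "Suc i"] by (simp_all add: t2_def)
    with Suc.IH[of t2] Suc.prems obtain k3 t3 where
      t3: "exec ?w t2 k3 t3" "k3 \<le> j * (T + 20 * X\<^sup>2) + 20 * X\<^sup>2" "I m t3" by auto
    have ti: "t ''v'' d = i" "t ''in'' 0 = m" using Suc.prems m by (auto simp: i_def)
    have "exec ?w t (cost ?b t + (k + k2) + k3) t3"
      using i t1 k2 t3 ti by (intro WhileTrue exec.Seq) auto
    moreover have "cost ?b t \<le> 10 * X\<^sup>2"
      using ti i l0 l2[of i m] lX[of i] lX[of m] X2 by simp
    ultimately show ?case using t1 t3 k2 by (intro exI[of _ "cost ?b t + (k + k2) + k3"] exI[of _ t3]) auto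
  qed
  define t0 where "t0 = mem_update t ''v'' d 0"
  have "I (m - m) t0" "t0 ''v'' d = m - m" using I0 upd by (simp_all add: t0_def)
  with while[of m t0] obtain k t' where
    k: "exec ?w t0 k t'" "k \<le> m * (T + 20 * X\<^sup>2) + 20 * X\<^sup>2" "I m t'" by auto
  have "exec (Write ''v'' (Const d) (Const 0)) t (len d + len 0 + len d + len 0) t0"
    using Write[of "''v''" "Const d" "Const 0" t] by (simp add: t0_def)
  with k have "exec (loop d c) t (len d + len 0 + len d + len 0 + k) t'"
    unfolding loop_def by (intro exec.Seq) auto
  moreover have "len d + len 0 + len d + len 0 + k \<le> Suc m * (T + 40 * X\<^sup>2)"
    using k l0 X2 by (simp add: algebra_simps)
  ultimately show ?thesis using k(3) unfolding X_def by blast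
qed

section \<open>Correctness and running time of compiled expressions\<close>

lemma exec_Write_acc:
  assumes "agrees r s t" "val e t = x"
  shows "exec (Write ''acc'' (Const n) e) t (len n + cost e t + len n + len x) (mem_update t ''acc'' n x)"
    and "agrees r s (mem_update t ''acc'' n x)"
  using Write[of "''acc''" "Const n" e t] assms by (auto simp: agrees_def mem_update_def)

text \<open>The linear polynomial with value \<open>c * (N + 1) + 2\<close> at \<open>N\<close>; the
  summand 2 is that of \<open>len_le\<close>.\<close>

definition poly_len :: "nat \<Rightarrow> nat poly" where "poly_len c = [:c + 2, c:]"

lemma len_le_poly: "x \<le> 2 ^ (c * Suc N) \<Longrightarrow> len x \<le> poly (poly_len c) N"
  using len_le[of x "c * Suc N"] by (simp add: poly_len_def algebra_simps)

lemma poly_const_simp: "poly [:a:] x = a" for a x :: nat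
  by simp

lemma agrees_loop_var: "agrees r s t \<Longrightarrow> agrees r s (mem_update t ''v'' (length r) x)"
  by (auto simp: agrees_def mem_update_def)

text \<open>The polynomial is fixed before the memory and thus depends on the syntax only. The last
  conjunct protects the operands waiting below cell \<open>n\<close> while a second operand is
  evaluated.\<close>

definition computes :: "com \<Rightarrow> nat \<Rightarrow> nat \<Rightarrow> expr \<Rightarrow> nat poly \<Rightarrow> bool" where
  "computes c d n e q \<longleftrightarrow> (\<forall>N r s t. length r = d \<longrightarrow> bounded N r s \<longrightarrow> agrees r s t \<longrightarrow>
     (\<exists>k t'. exec c t k t' \<and> k \<le> poly q N \<and> agrees r s t' \<and>
        t' ''acc'' n = ev e r s \<and> (\<forall>j<n. t' ''acc'' j = t ''acc'' j)))"

lemma computesI: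
  assumes "\<And>N r s t. length r = d \<Longrightarrow> bounded N r s \<Longrightarrow> agrees r s t \<Longrightarrow>
     \<exists>k t'. exec c t k t' \<and> k \<le> poly q N \<and> agrees r s t' \<and>
        t' ''acc'' n = ev e r s \<and> (\<forall>j<n. t' ''acc'' j = t ''acc'' j)"
  shows "computes c d n e q"
  unfolding computes_def using assms by (intro allI impI)

lemma computesE:
  assumes "computes c d n e q" "length r = d" "bounded N r s" "agrees r s t"
  obtains k t' where "exec c t k t'" "k \<le> poly q N" "agrees r s t'"
    "t' ''acc'' n = ev e r s" "\<forall>j<n. t' ''acc'' j = t ''acc'' j"
  using assms(1)[unfolded computes_def, rule_format, OF assms(2-)] by auto

lemma compile_expr_correct: "wf_expr d e \<Longrightarrow> \<exists>q. computes (compile_expr d n e) d n e q"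
proof (induction e arbitrary: d n)
  case (Num c)
  show ?case
  proof (rule exI[of _ "[:2 * len n + 2 * len c:]"], rule computesI, goal_cases)
    case (1 N r s t)
    from exec_Write_acc[OF 1(3), of "Const c" c n]
    show ?case
      by (intro exI[of _ "len n + cost (Const c) t + len n + len c"]
        exI[of _ "mem_update t ''acc'' n c"]) auto
  qed
next
  case (Var i)
  from ev_le[OF Var.prems] obtain c where
    c: "\<And>N r s. length r = d \<Longrightarrow> bounded N r s \<Longrightarrow> ev (Var i) r s \<le> 2 ^ (c * Suc N)" by blast
  show ?case
  proof (rule exI[of _ "[:2 * len n + 2 * len i:] + 2 * poly_len c"], rule computesI, goal_cases)
    case (1 N r s t)
    note r = 1(1,2) and t = 1(3)
    have *: "t ''v'' i = r ! i" using t r Var by (simp add: agrees_def)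
    from exec_Write_acc[OF t, of "Read ''v'' (Const i)" "r ! i" n] * len_le_poly[OF c[OF r]]
    show ?case
      by (intro exI[of _ "len n + cost (Read ''v'' (Const i)) t + len n + len (r ! i)"]
        exI[of _ "mem_update t ''acc'' n (r ! i)"]) auto
  qed
next
  case (At a e)
  then have wf: "wf_expr d e" "a \<noteq> ''v''" "a \<noteq> ''acc''" by auto
  from ev_le[OF At.prems] obtain c where
    c: "\<And>N r s. length r = d \<Longrightarrow> bounded N r s \<Longrightarrow> ev (At a e) r s \<le> 2 ^ (c * Suc N)" by blast
  from ev_le[OF wf(1)] obtain c1 where
    c1: "\<And>N r s. length r = d \<Longrightarrow> bounded N r s \<Longrightarrow> ev e r s \<le> 2 ^ (c1 * Suc N)" by blast
  from At.IH[OF wf(1), of n] obtain q where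
    q: "computes (compile_expr d n e) d n e q" ..
  show ?case
  proof (rule exI[of _ "q + [:4 * len n:] + 2 * poly_len c1 + 2 * poly_len c"], rule computesI, goal_cases)
    case (1 N r s t)
    note r = 1(1,2) and t = 1(3)
    from computesE[OF q r t] obtain k t1 where t1: "exec (compile_expr d n e) t k t1" "k \<le> poly q N"
      "agrees r s t1" "t1 ''acc'' n = ev e r s" "\<forall>j<n. t1 ''acc'' j = t ''acc'' j" .
    have *: "t1 a i = s a i" for i using t1 wf by (simp add: agrees_def)
    let ?x = "ev (At a e) r s"
    let ?k = "len n + cost (Read a (acc n)) t1 + len n + len ?x"
    have "?k \<le> poly ([:4 * len n:] + 2 * poly_len c1 + 2 * poly_len c) N"
      using len_le_poly[OF c[OF r]] len_le_poly[OF c1[OF r]] t1 * by (simp add: acc_def)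
    with t1(2) have "k + ?k \<le> poly (q + [:4 * len n:] + 2 * poly_len c1 + 2 * poly_len c) N"
      by simp
    moreover have v: "val (Read a (acc n)) t1 = ?x" using t1(4) * by (simp add: acc_def)
    have "exec (compile_expr d n (At a e)) t (k + ?k) (mem_update t1 ''acc'' n ?x)"
      unfolding compile_expr.simps by (rule exec.Seq[OF t1(1) exec_Write_acc(1)[OF t1(3) v]])
    moreover have "\<forall>j<n. mem_update t1 ''acc'' n ?x ''acc'' j = t ''acc'' j" using t1(5) by simp
    ultimately show ?case
      using exec_Write_acc(2)[OF t1(3) v, of n]
      by (intro exI[of _ "k + ?k"] exI[of _ "mem_update t1 ''acc'' n ?x"] conjI) (assumption | simp)+
  qed
next
  case (Op f e1 e2)
  then have wf: "wf_expr d e1" "wf_expr d e2" by auto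
  from ev_le[OF Op.prems] obtain c where
    c: "\<And>N r s. length r = d \<Longrightarrow> bounded N r s \<Longrightarrow> ev (Op f e1 e2) r s \<le> 2 ^ (c * Suc N)" by blast
  from ev_le[OF wf(1)] obtain c1 where
    c1: "\<And>N r s. length r = d \<Longrightarrow> bounded N r s \<Longrightarrow> ev e1 r s \<le> 2 ^ (c1 * Suc N)" by blast
  from ev_le[OF wf(2)] obtain c2 where
    c2: "\<And>N r s. length r = d \<Longrightarrow> bounded N r s \<Longrightarrow> ev e2 r s \<le> 2 ^ (c2 * Suc N)" by blast
  from Op.IH(1)[OF wf(1), of n] obtain q1 where
    q1: "computes (compile_expr d n e1) d n e1 q1" ..
  from Op.IH(2)[OF wf(2), of "Suc n"] obtain q2 where
    q2: "computes (compile_expr d (Suc n) e2) d (Suc n) e2 q2" ..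
  let ?Q = "[:4 * len n + 2 * len (Suc n):] + poly_len c1 + poly_len c2 + poly_len c1 * poly_len c2 + poly_len c"
  show ?case
  proof (rule exI[of _ "q1 + q2 + ?Q"], rule computesI, goal_cases)
    case (1 N r s t)
    note r = 1(1,2) and t = 1(3)
    from computesE[OF q1 r t] obtain k1 t1 where t1: "exec (compile_expr d n e1) t k1 t1" "k1 \<le> poly q1 N"
      "agrees r s t1" "t1 ''acc'' n = ev e1 r s" "\<forall>j<n. t1 ''acc'' j = t ''acc'' j" .
    from computesE[OF q2 r t1(3)] obtain k2 t2 where t2: "exec (compile_expr d (Suc n) e2) t1 k2 t2"
      "k2 \<le> poly q2 N" "agrees r s t2" "t2 ''acc'' (Suc n) = ev e2 r s"
      "\<forall>j<Suc n. t2 ''acc'' j = t1 ''acc'' j" .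
    let ?x = "ev (Op f e1 e2) r s" and ?e = "Bin f (acc n) (acc (Suc n))"
    let ?k = "len n + cost ?e t2 + len n + len ?x"
    have "len (ev e1 r s) * len (ev e2 r s) \<le> poly (poly_len c1 * poly_len c2) N"
      unfolding poly_mult by (intro mult_le_mono len_le_poly c1 c2 r)
    then have "?k \<le> poly ?Q N"
      using len_le_poly[OF c[OF r]] len_le_poly[OF c1[OF r]] len_le_poly[OF c2[OF r]] t1 t2
      by (simp add: acc_def)
    with t1(2) t2(2) have "k1 + (k2 + ?k) \<le> poly (q1 + q2 + ?Q) N"
      unfolding poly_add[of "q1 + q2"] poly_add[of q1] by linarith
    moreover have v: "val ?e t2 = ?x" using t1(4) t2(4,5) by (simp add: acc_def)
    have "exec (compile_expr d n (Op f e1 e2)) t (k1 + (k2 + ?k)) (mem_update t2 ''acc'' n ?x)"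
      unfolding compile_expr.simps
      by (rule exec.Seq[OF t1(1) exec.Seq[OF t2(1) exec_Write_acc(1)[OF t2(3) v]]])
    moreover have "\<forall>j<n. mem_update t2 ''acc'' n ?x ''acc'' j = t ''acc'' j" using t1(5) t2(5) by simp
    ultimately show ?case
      using exec_Write_acc(2)[OF t2(3) v, of n]
      by (intro exI[of _ "k1 + (k2 + ?k)"] exI[of _ "mem_update t2 ''acc'' n ?x"] conjI) simp_all
  qed
next
  case (SumE e)
  then have wf: "wf_expr (Suc d) e" by auto
  from ev_le[OF SumE.prems] obtain c where
    c: "\<And>N r s. length r = d \<Longrightarrow> bounded N r s \<Longrightarrow> ev (SumE e) r s \<le> 2 ^ (c * Suc N)" by blast
  from ev_le[OF wf] obtain c1 where
    c1: "\<And>N r s. length r = Suc d \<Longrightarrow> bounded N r s \<Longrightarrow> ev e r s \<le> 2 ^ (c1 * Suc N)" by blast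
  from SumE.IH[OF wf, of "Suc n"] obtain q where
    q: "computes (compile_expr (Suc d) (Suc n) e) (Suc d) (Suc n) e q" ..
  let ?B = "q + ([:4 * len n + 2 * len (Suc n):] + poly_len c + poly_len c1 + poly_len c * poly_len c1 + poly_len c)"
  \<comment> \<open>The factor \<open>[:1, 1:]\<close> has the value \<open>N + 1\<close> and pays
    for the iterations; \<open>[:d + 2, 1:]\<close> has the value \<open>N + d + 2\<close> and pays
    for the loop control of \<open>exec_loop\<close>.\<close>
  let ?Q = "[:2 * len n + 2 * len 0:] + [:1, 1:] * (?B + [:40:] * ([:d + 2, 1:]\<^sup>2))"
  show ?case
  proof (rule exI[of _ ?Q], rule computesI, goal_cases)
    case (1 N r s t)
    note r = 1(1,2) and t = 1(3)
    define m where "m = s ''in'' 0"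
    define psum where "psum i = (\<Sum>j<i. ev e (r @ [j]) s)" for i
    \<comment> \<open>The terms are natural numbers, so partial sums stay below the full sum, and
      \<open>ev_le\<close> for \<open>SumE e\<close> bounds the accumulator throughout.\<close>
    have psum_le: "psum i \<le> ev (SumE e) r s" if "i \<le> m" for i
      unfolding psum_def ev.simps using that by (intro sum_mono2) (auto simp: m_def)
    let ?body = "Seq (compile_expr (Suc d) (Suc n) e)
         (Write ''acc'' (Const n) (Bin Add (acc n) (acc (Suc n))))"
    define t0 where "t0 = mem_update t ''acc'' n 0"
    define I where "I i t' \<longleftrightarrow> agrees r s t' \<and> t' ''acc'' n = psum i \<and> (\<forall>j<n. t' ''acc'' j = t ''acc'' j)"
      for i t'
    have t0: "exec (Write ''acc'' (Const n) (Const 0)) t (len n + len 0 + len n + len 0) t0" "agrees r s t0"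
      using exec_Write_acc[OF t, of "Const 0" 0 n] by (simp_all add: t0_def)
    have body: "\<exists>k t2. exec ?body t1 k t2 \<and> k \<le> poly ?B N \<and> I (Suc i) t2 \<and> t2 ''v'' d = i"
      if "i < m" "I i t1" "t1 ''v'' d = i" for i t1
    proof -
      have r': "length (r @ [i]) = Suc d" "bounded N (r @ [i]) s"
        using r that by (auto simp: bounded_def m_def)
      have "agrees (r @ [i]) s t1"
        using that r by (auto simp: agrees_def I_def nth_append less_Suc_eq)
      from computesE[OF q r' this] obtain k t2 where t2: "exec (compile_expr (Suc d) (Suc n) e) t1 k t2"
        "k \<le> poly q N" "agrees (r @ [i]) s t2" "t2 ''acc'' (Suc n) = ev e (r @ [i]) s"
        "\<forall>j<Suc n. t2 ''acc'' j = t1 ''acc'' j" .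
      let ?e = "Bin Add (acc n) (acc (Suc n))" and ?x = "psum (Suc i)"
      have v: "val ?e t2 = ?x" using that t2 by (simp add: acc_def I_def psum_def)
      have v1: "t2 ''acc'' n = psum i" using that t2 by (simp add: I_def)
      let ?k = "len n + cost ?e t2 + len n + len ?x"
      have l: "len (psum j) \<le> poly (poly_len c) N" if "j \<le> m" for j
        using psum_le[OF that] c[OF r] by (intro len_le_poly) (rule le_trans)
      have l1: "len (ev e (r @ [i]) s) \<le> poly (poly_len c1) N" by (intro len_le_poly c1 r')
      have "len (psum i) * len (ev e (r @ [i]) s) \<le> poly (poly_len c * poly_len c1) N"
        unfolding poly_mult using that l l1 by (intro mult_le_mono) auto
      then have k: "k + ?k \<le> poly ?B N"
        using l[of i] l[of "Suc i"] l1 that t2 by (simp add: acc_def v1)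
      have ag: "agrees r s t2" using t2(3) by (auto simp: agrees_def nth_append less_Suc_eq)
      have "t2 ''v'' d = i" using t2(3) r by (auto simp: agrees_def nth_append)
      then have "mem_update t2 ''acc'' n ?x ''v'' d = i" by simp
      moreover have "I (Suc i) (mem_update t2 ''acc'' n ?x)"
        using exec_Write_acc(2)[OF ag v] that(2) t2(5) by (simp add: I_def)
      moreover have "exec ?body t1 (k + ?k) (mem_update t2 ''acc'' n ?x)"
        by (rule exec.Seq[OF t2(1) exec_Write_acc(1)[OF ag v]])
      ultimately show ?thesis using k
        by (intro exI[of _ "k + ?k"] exI[of _ "mem_update t2 ''acc'' n ?x"] conjI)
    qed
    have "\<exists>k t'. exec (loop d ?body) t0 k t' \<and> k \<le> Suc m * (poly ?B N + 40 * (m + d + 2)\<^sup>2) \<and> I m t'"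
    proof (rule exec_loop[where I = I])
      show "\<And>i t x. I i t \<Longrightarrow> I i (mem_update t ''v'' d x)" unfolding I_def using agrees_loop_var[of r s _ _, unfolded r(1)] by simp
      show "\<And>i t. I i t \<Longrightarrow> t ''in'' 0 = m" by (auto simp: I_def agrees_def m_def)
      show "I 0 t0" using t0(2) by (auto simp: I_def t0_def psum_def)
    qed (rule body)
    then obtain k t' where k: "exec (loop d ?body) t0 k t'"
      "k \<le> Suc m * (poly ?B N + 40 * (m + d + 2)\<^sup>2)" "I m t'" by blast
    have m: "m \<le> N" using r by (simp add: bounded_def m_def)
    have "Suc m * (poly ?B N + 40 * (m + d + 2)\<^sup>2) \<le> Suc N * (poly ?B N + 40 * (N + d + 2)\<^sup>2)"
      using m by (intro mult_le_mono add_le_mono power_mono) auto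
    also have "\<dots> = poly ([:1, 1:] * (?B + [:40:] * ([:d + 2, 1:]\<^sup>2))) N"
      unfolding poly_mult poly_add poly_power by (simp add: add.commute)
    finally have "len n + len 0 + len n + len 0 + k \<le> poly ?Q N"
      unfolding poly_add[of "[:2 * len n + 2 * len 0:]"] using k(2) by (simp add: poly_const_simp del: poly_pCons poly_mult poly_add)
    moreover have "exec (compile_expr d n (SumE e)) t (len n + len 0 + len n + len 0 + k) t'"
      unfolding compile_expr.simps by (rule exec.Seq[OF t0(1) k(1)])
    moreover have "agrees r s t' \<and> t' ''acc'' n = ev (SumE e) r s \<and> (\<forall>j<n. t' ''acc'' j = t ''acc'' j)"
      using k(3) by (simp add: I_def psum_def m_def)
    ultimately show ?case
      by (intro exI[of _ "len n + len 0 + len n + len 0 + k"] exI[of _ t'] conjI) (assumption | simp)+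
  qed
qed

section \<open>Frame property, boundedness and compilation of programs\<close>

fun writes :: "prog \<Rightarrow> string set" where
  "writes (Put a e1 e2) = {a}"
| "writes (c1 ;; c2) = writes c1 \<union> writes c2"
| "writes (When e c) = writes c"
| "writes (For c) = writes c"

lemma fold_inv:
  assumes "I 0 s" and "\<And>i s. i < m \<Longrightarrow> I i s \<Longrightarrow> I (Suc i) (f i s)"
  shows "I m (fold f [0..<m] s)"
proof -
  have "I j (fold f [0..<j] s)" if "j \<le> m" for j
    using that by (induction j) (auto simp: assms)
  then show ?thesis by simp
qed

lemma run_frame: "a \<notin> writes c \<Longrightarrow> run c r s a = s a"
proof (induction c arbitrary: r s)
  case (For c)
  then show ?case
    using fold_inv[where I = "\<lambda>_ s'. s' a = s a" and f = "\<lambda>i. run c (r @ [i])"] by simp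
qed auto

lemma in_notin_writes: "wf_prog d c \<Longrightarrow> ''in'' \<notin> writes c"
  by (induction c arbitrary: d) auto

lemma bounded_run: "bounded N r s \<Longrightarrow> wf_prog d c \<Longrightarrow> bounded N r (run c r s)"
proof (induction c arbitrary: d r s)
  case (Put a e1 e2)
  have "x mod cap s \<le> 2 ^ N" for x
  proof -
    have "x mod cap s < cap s" by (rule mod_less_divisor) (simp add: cap_def)
    with Put(1) show ?thesis by (simp add: bounded_def)
  qed
  with Put show ?case by (auto simp: bounded_def cap_def mem_update_def)
next
  case (For c)
  have "bounded N r (fold (\<lambda>i. run c (r @ [i])) [0..<s ''in'' 0] s) \<and>
    fold (\<lambda>i. run c (r @ [i])) [0..<s ''in'' 0] s ''in'' = s ''in''"
  proof (rule fold_inv[where I = "\<lambda>_ s'. bounded N r s' \<and> s' ''in'' = s ''in''"])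
    fix i s' assume i: "i < s ''in'' 0" and I: "bounded N r s' \<and> s' ''in'' = s ''in''"
    then have "bounded N (r @ [i]) s'" by (auto simp: bounded_def)
    with For.IH[of "r @ [i]" s' "Suc d"] For.prems have "bounded N (r @ [i]) (run c (r @ [i]) s')" by simp
    then have "bounded N r (run c (r @ [i]) s')" by (auto simp: bounded_def)
    with I For.prems show "bounded N r (run c (r @ [i]) s') \<and> run c (r @ [i]) s' ''in'' = s ''in''"
      by (simp add: run_frame in_notin_writes[of "Suc d"])
  qed (use For in simp)
  then show ?case by simp
next
  case (Then c1 c2)
  from Then.IH(1)[of r s d] Then.prems have "bounded N r (run c1 r s)" by simp
  with Then.IH(2)[of r "run c1 r s" d] Then.prems show ?case by simp
next
  case (When e c)
  then show ?case by auto
qed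

definition implements :: "com \<Rightarrow> nat \<Rightarrow> prog \<Rightarrow> nat poly \<Rightarrow> bool" where
  "implements k d c q \<longleftrightarrow> (\<forall>N r s t. length r = d \<longrightarrow> bounded N r s \<longrightarrow> agrees r s t \<longrightarrow>
     (\<exists>n t'. exec k t n t' \<and> n \<le> poly q N \<and> agrees r (run c r s) t'))"

lemma implementsI:
  assumes "\<And>N r s t. length r = d \<Longrightarrow> bounded N r s \<Longrightarrow> agrees r s t \<Longrightarrow>
     \<exists>n t'. exec k t n t' \<and> n \<le> poly q N \<and> agrees r (run c r s) t'"
  shows "implements k d c q"
  unfolding implements_def using assms by (intro allI impI)

lemma implementsE:
  assumes "implements k d c q" "length r = d" "bounded N r s" "agrees r s t"
  obtains n t' where "exec k t n t'" "n \<le> poly q N" "agrees r (run c r s) t'"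
  using assms(1)[unfolded implements_def, rule_format, OF assms(2-)] by auto

lemma compile_correct: "wf_prog d c \<Longrightarrow> \<exists>q. implements (compile d c) d c q"
proof (induction c arbitrary: d)
  case (Put a e1 e2)
  then have wf: "wf_expr d e1" "wf_expr d e2" "a \<noteq> ''v''" "a \<noteq> ''acc''" "a \<noteq> ''in''" by auto
  from ev_le[OF wf(1)] obtain c1 where
    c1: "\<And>N r s. length r = d \<Longrightarrow> bounded N r s \<Longrightarrow> ev e1 r s \<le> 2 ^ (c1 * Suc N)" by blast
  from ev_le[OF wf(2)] obtain c2 where
    c2: "\<And>N r s. length r = d \<Longrightarrow> bounded N r s \<Longrightarrow> ev e2 r s \<le> 2 ^ (c2 * Suc N)" by blast
  from compile_expr_correct[OF wf(1), of 0] obtain q1 where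
    q1: "computes (compile_expr d 0 e1) d 0 e1 q1" ..
  from compile_expr_correct[OF wf(2), of 1] obtain q2 where
    q2: "computes (compile_expr d 1 e2) d 1 e2 q2" ..
  \<comment> \<open>The header cells that are read and the value that is stored are at most
    \<open>cap s\<close>, hence at most \<open>2 ^ N\<close>, and \<open>?L\<close> bounds their
    lengths. The constants 100 and 20 are generous.\<close>
  let ?L = "poly_len 1"
  let ?Q = "[:100:] + 2 * poly_len c1 + poly_len c2 + poly_len c2 * ?L + 20 * ?L + 20 * ?L * ?L"
  show ?case
  proof (rule exI[of _ "q1 + q2 + ?Q"], rule implementsI, goal_cases)
    case (1 N r s t)
    note r = 1(1,2) and t = 1(3)
    from computesE[OF q1 r t] obtain k1 t1 where t1: "exec (compile_expr d 0 e1) t k1 t1"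
      "k1 \<le> poly q1 N" "agrees r s t1" "t1 ''acc'' 0 = ev e1 r s" by auto
    from computesE[OF q2 r t1(3)] obtain k2 t2 where t2: "exec (compile_expr d 1 e2) t1 k2 t2"
      "k2 \<le> poly q2 N" "agrees r s t2" "t2 ''acc'' 1 = ev e2 r s"
      "\<forall>j<1. t2 ''acc'' j = t1 ''acc'' j" by auto
    let ?cap = "Bin Add (Bin Add (Read ''in'' (Const 2)) (Read ''in'' (Const 0))) (Const 1)"
    let ?e = "Bin Mod (acc 1) ?cap"
    define x y where "x = ev e1 r s" and "y = ev e2 r s"
    have inp: "t2 ''in'' = s ''in''" using t2(3) by (simp add: agrees_def)
    have v: "val (acc 0) t2 = x" "val (acc 1) t2 = y" "val ?cap t2 = cap s"
      using t1 t2 inp by (simp_all add: acc_def cap_def x_def y_def)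
    let ?k = "cost (acc 0) t2 + cost ?e t2 + len x + len (y mod cap s)"
    have small: "len z \<le> poly ?L N" if "z \<le> cap s" for z
    proof (rule len_le_poly)
      have "(2::nat) ^ N \<le> 2 ^ (1 * Suc N)" by simp
      with r that show "z \<le> 2 ^ (1 * Suc N)" unfolding bounded_def by linarith
    qed
    have sm: "len (s ''in'' 2) \<le> poly ?L N" "len (s ''in'' 0) \<le> poly ?L N"
      "len (s ''in'' 2 + s ''in'' 0) \<le> poly ?L N" "len (cap s) \<le> poly ?L N"
      "len (Suc 0) \<le> poly ?L N" "len (y mod cap s) \<le> poly ?L N"
      by (rule small; simp add: cap_def le_mod_geq less_imp_le[OF mod_less_divisor])+
    have x: "len x \<le> poly (poly_len c1) N" unfolding x_def by (intro len_le_poly c1 r)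
    have y: "len y \<le> poly (poly_len c2) N" unfolding y_def by (intro len_le_poly c2 r)
    have pr: "len (s ''in'' 2) * len (s ''in'' 0) \<le> poly (?L * ?L) N"
      "len (s ''in'' 2 + s ''in'' 0) * len (Suc 0) \<le> poly (?L * ?L) N"
      "len y * len (cap s) \<le> poly (poly_len c2 * ?L) N"
      unfolding poly_mult using x y sm by (auto intro!: mult_le_mono)
    have l: "len 0 \<le> 3" "len (Suc 0) \<le> 3" "len 2 \<le> 3"
      using len_le_Suc[of 0] len_le_Suc[of 1] len_le_Suc[of 2] by auto
    have "cost (acc 0) t2 \<le> 3 + 3 + len x" using v(1) l by (simp add: acc_def)
    moreover have "cost (acc 1) t2 \<le> 3 + 3 + len y" using v(2) l by (simp add: acc_def)
    moreover have "cost ?cap t2 \<le> 3 + 3 + len (s ''in'' 2) + (3 + 3 + len (s ''in'' 0))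
        + len (s ''in'' 2) * len (s ''in'' 0) + 3 + len (s ''in'' 2 + s ''in'' 0) * len (Suc 0)"
      using l inp by simp
    moreover have "cost ?e t2 = cost (acc 1) t2 + cost ?cap t2 + len y * len (cap s)"
      using v by simp
    moreover have "poly ?Q N = 100 + 2 * poly (poly_len c1) N + poly (poly_len c2) N +
        poly (poly_len c2 * ?L) N + 20 * poly ?L N + 20 * poly (?L * ?L) N"
      by (simp add: mult.assoc)
    ultimately have "?k \<le> poly ?Q N" using x y sm pr by linarith
    with t1(2) t2(2) have k: "k1 + (k2 + ?k) \<le> poly (q1 + q2 + ?Q) N"
      unfolding poly_add[of "q1 + q2"] poly_add[of q1] by linarith
    let ?t = "mem_update t2 a x (y mod cap s)"
    have "val ?e t2 = y mod cap s" using v by simp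
    then have "exec (Write a (acc 0) ?e) t2 ?k ?t"
      using Write[of a "acc 0" ?e t2] unfolding v by simp
    then have "exec (compile d (Put a e1 e2)) t (k1 + (k2 + ?k)) ?t"
      unfolding compile.simps by (intro exec.Seq[OF t1(1)] exec.Seq[OF t2(1)])
    moreover have "agrees r (run (Put a e1 e2) r s) ?t"
      using t2(3) wf by (auto simp: agrees_def mem_update_def x_def y_def)
    ultimately show ?case
      using k by blast
  qed
next
  case (Then c1 c2)
  then obtain q1 q2 where q: "implements (compile d c1) d c1 q1" "implements (compile d c2) d c2 q2"
    by (metis wf_prog.simps(2))
  show ?case
  proof (rule exI[of _ "q1 + q2"], rule implementsI, goal_cases)
    case (1 N r s t)
    note r = 1(1,2) and t = 1(3)
    from implementsE[OF q(1) r t] obtain k1 t1 where t1: "exec (compile d c1) t k1 t1"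
      "k1 \<le> poly q1 N" "agrees r (run c1 r s) t1" by blast
    have "bounded N r (run c1 r s)" using bounded_run[of N r s d c1] r Then by simp
    from implementsE[OF q(2) r(1) this t1(3)] obtain k2 t2 where "exec (compile d c2) t1 k2 t2"
      "k2 \<le> poly q2 N" "agrees r (run c2 r (run c1 r s)) t2" by blast
    with t1 show ?case
      by (intro exI[of _ "k1 + k2"] exI[of _ t2]) (auto intro: exec.Seq)
  qed
next
  case (When e c)
  then have wf: "wf_expr d e" "wf_prog d c" by auto
  from ev_le[OF wf(1)] obtain c1 where
    c1: "\<And>N r s. length r = d \<Longrightarrow> bounded N r s \<Longrightarrow> ev e r s \<le> 2 ^ (c1 * Suc N)" by blast
  from compile_expr_correct[OF wf(1), of 0] obtain q1 where
    q1: "computes (compile_expr d 0 e) d 0 e q1" ..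
  from When.IH[OF wf(2)] obtain q2 where q2: "implements (compile d c) d c q2" ..
  let ?Q = "[:2 * len 0 + 1:] + poly_len c1"
  show ?case
  proof (rule exI[of _ "q1 + q2 + ?Q"], rule implementsI, goal_cases)
    case (1 N r s t)
    note r = 1(1,2) and t = 1(3)
    from computesE[OF q1 r t] obtain k1 t1 where t1: "exec (compile_expr d 0 e) t k1 t1"
      "k1 \<le> poly q1 N" "agrees r s t1" "t1 ''acc'' 0 = ev e r s" by auto
    have v: "val (acc 0) t1 = ev e r s" using t1(4) by (simp add: acc_def)
    have "cost (acc 0) t1 + 1 \<le> poly ?Q N"
      using len_le_poly[OF c1[OF r]] t1(4) by (simp add: acc_def)
    moreover have "\<exists>n t'. exec (If (acc 0) (compile d c) Skip) t1 n t' \<and> n \<le> cost (acc 0) t1 + 1 + poly q2 N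
       \<and> agrees r (run (When e c) r s) t'"
    proof (cases "ev e r s = 0")
      case True
      then show ?thesis using IfFalse[OF _ Skip, of "acc 0" t1 "compile d c"] v t1(3)
        by (intro exI[of _ "cost (acc 0) t1 + 1"] exI[of _ t1]) simp
    next
      case False
      from implementsE[OF q2 r t1(3)] obtain k2 t2 where "exec (compile d c) t1 k2 t2"
        "k2 \<le> poly q2 N" "agrees r (run c r s) t2" by blast
      with False show ?thesis using IfTrue[of "acc 0" t1 "compile d c" k2 t2 Skip] v
        by (intro exI[of _ "cost (acc 0) t1 + k2"] exI[of _ t2]) simp
    qed
    then obtain n t' where "exec (If (acc 0) (compile d c) Skip) t1 n t'" 
      "n \<le> cost (acc 0) t1 + 1 + poly q2 N" "agrees r (run (When e c) r s) t'" by blast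
    ultimately show ?case
      using t1(1,2) by (intro exI[of _ "k1 + n"] exI[of _ t']) (auto intro: exec.Seq simp del: run.simps)
  qed
next
  case (For c)
  then obtain q where q: "implements (compile (Suc d) c) (Suc d) c q" by auto
  let ?Q = "[:1, 1:] * (q + [:40:] * ([:d + 2, 1:]\<^sup>2))"
  show ?case
  proof (rule exI[of _ ?Q], rule implementsI, goal_cases)
    case (1 N r s t)
    note r = 1(1,2) and t = 1(3)
    define m where "m = s ''in'' 0"
    \<comment> \<open>The source state after \<open>i\<close> iterations. It is followed next to the
      machine state because \<open>bounded\<close> concerns the source memory.\<close>
    define S where "S i = fold (\<lambda>i. run c (r @ [i])) [0..<i] s" for i
    have S_Suc: "S (Suc i) = run c (r @ [i]) (S i)" for i by (simp add: S_def)
    have S: "bounded N r (S i) \<and> S i ''in'' = s ''in''" if "i \<le> m" for i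
      using that
    proof (induction i)
      case 0
      then show ?case using r by (simp add: S_def)
    next
      case (Suc i)
      then have "bounded N (r @ [i]) (S i)" using r by (auto simp: bounded_def m_def)
      with For.prems have "bounded N (r @ [i]) (S (Suc i))"
        unfolding S_Suc by (intro bounded_run[of _ _ _ "Suc d"]) auto
      with Suc For.prems show ?case
        by (auto simp: bounded_def S_Suc run_frame in_notin_writes[of "Suc d"])
    qed
    define I where "I i t' \<longleftrightarrow> agrees r (S i) t' \<and> S i ''in'' = s ''in''" for i t'
    have "\<exists>k t'. exec (loop d (compile (Suc d) c)) t k t' \<and>
        k \<le> Suc m * (poly q N + 40 * (m + d + 2)\<^sup>2) \<and> I m t'"
    proof (rule exec_loop[where I = I])
      fix i t1 assume i: "i < m" and I: "I i t1" "t1 ''v'' d = i"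
      have "bounded N (r @ [i]) (S i)" using S[of i] i r by (auto simp: bounded_def m_def)
      moreover have "agrees (r @ [i]) (S i) t1"
        using I r by (auto simp: agrees_def I_def nth_append less_Suc_eq)
      ultimately obtain k t2 where t2: "exec (compile (Suc d) c) t1 k t2" "k \<le> poly q N"
        "agrees (r @ [i]) (S (Suc i)) t2"
        using implementsE[OF q, of "r @ [i]" N "S i" t1] r unfolding S_Suc by auto
      have "t2 ''v'' d = i" using t2(3) r by (auto simp: agrees_def nth_append)
      moreover have "I (Suc i) t2"
        using t2(3) S[of "Suc i"] i by (auto simp: I_def agrees_def nth_append less_Suc_eq)
      ultimately show "\<exists>k t2. exec (compile (Suc d) c) t1 k t2 \<and> k \<le> poly q N \<and> I (Suc i) t2 \<and>
          t2 ''v'' d = i" using t2 by blast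
    next
      show "\<And>i t x. I i t \<Longrightarrow> I i (mem_update t ''v'' d x)"
        unfolding I_def using agrees_loop_var[of r _ _ _, unfolded r(1)] by simp
      show "\<And>i t. I i t \<Longrightarrow> t ''in'' 0 = m" by (auto simp: I_def agrees_def m_def)
      show "I 0 t" using t by (auto simp: I_def S_def)
    qed
    then obtain k t' where k: "exec (loop d (compile (Suc d) c)) t k t'"
      "k \<le> Suc m * (poly q N + 40 * (m + d + 2)\<^sup>2)" "I m t'" by blast
    have m: "m \<le> N" using r by (simp add: bounded_def m_def)
    have "Suc m * (poly q N + 40 * (m + d + 2)\<^sup>2) \<le> Suc N * (poly q N + 40 * (N + d + 2)\<^sup>2)"
      using m by (intro mult_le_mono add_le_mono power_mono) auto
    also have "\<dots> = poly ?Q N"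
      unfolding poly_mult poly_add poly_power by (simp add: add.commute)
    finally have "k \<le> poly ?Q N" using k(2) by simp
    with k show ?case
      by (intro exI[of _ k] exI[of _ t']) (simp add: I_def S_def m_def)
  qed
qed

section \<open>Messages as alternating walks\<close>

text \<open>A path, or an even cycle with \<open>q l = q 0\<close>.\<close>

definition walk :: "nat \<Rightarrow> (nat \<Rightarrow> nat) \<Rightarrow> nat \<Rightarrow> bool" where
  "walk m q l \<longleftrightarrow> 1 \<le> l \<and> (\<forall>i\<le>l. q i < m) \<and>
     (\<forall>i j. i < j \<and> j \<le> l \<longrightarrow> q i \<noteq> q j \<or> (i = 0 \<and> j = l \<and> even l \<and> 3 \<le> l))"

definition walk_edges :: "(nat \<Rightarrow> nat) \<Rightarrow> nat \<Rightarrow> nat set list" where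
  "walk_edges q l = map (\<lambda>i. {q i, q (Suc i)}) [0..<l]"

lemma length_walk_edges [simp]: "length (walk_edges q l) = l"
  by (simp add: walk_edges_def)

lemma nth_walk_edges [simp]: "i < l \<Longrightarrow> walk_edges q l ! i = {q i, q (Suc i)}"
  by (simp add: walk_edges_def)

lemma set_walk_edges: "set (walk_edges q l) = {{q i, q (Suc i)} |i. i < l}"
  by (auto simp: walk_edges_def)

lemma complete_edges_iff: "{u, v} \<in> complete_edges m \<longleftrightarrow> u \<noteq> v \<and> u < m \<and> v < m"
proof
  assume "{u, v} \<in> complete_edges m"
  then obtain a b where "{u, v} = {a, b}" "a < b" "b < m" by (auto simp: complete_edges_def)
  then show "u \<noteq> v \<and> u < m \<and> v < m" by (auto simp: doubleton_eq_iff)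
next
  assume "u \<noteq> v \<and> u < m \<and> v < m"
  then have "u < v \<and> v < m \<or> v < u \<and> u < m" by linarith
  then have "\<exists>a b. {u, v} = {a, b} \<and> a < b \<and> b < m"
    by (elim disjE) (intro exI[of _ u] exI[of _ v], simp, intro exI[of _ v] exI[of _ u], auto)
  then show "{u, v} \<in> complete_edges m" by (simp add: complete_edges_def)
qed

lemma complete_edgesE:
  assumes "e \<in> complete_edges m" "u \<in> e"
  obtains w where "e = {u, w}" "u \<noteq> w" "u < m" "w < m"
proof -
  from assms obtain a b where ab: "e = {a, b}" "a < b" "b < m" "u = a \<or> u = b"
    by (auto simp: complete_edges_def)
  show thesis
  proof (cases "u = a")
    case True
    with ab show thesis by (intro that[of b]) auto
  next
    case False
    with ab show thesis by (intro that[of a]) auto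
  qed
qed

lemma walkD:
  assumes "walk m q l" "i < j" "j \<le> l" "q i = q j"
  shows "i = 0" "j = l" "even l" "3 \<le> l"
  using assms unfolding walk_def by blast+

lemma walk_nth_neq: "walk m q l \<Longrightarrow> i < l \<Longrightarrow> q i \<noteq> q (Suc i)"
  using walkD(1,2,4)[of m q l i "Suc i"] by fastforce

lemma walk_edges_subset: "walk m q l \<Longrightarrow> set (walk_edges q l) \<subseteq> complete_edges m"
  using walk_nth_neq by (auto simp: set_walk_edges complete_edges_iff walk_def)

lemma walk_message:
  assumes w: "walk m q l"
  shows "message (complete_edges m) (walk_edges q l)"
proof (cases "q l = q 0")
  case False
  have "distinct (map q [0..<Suc l])"
    unfolding distinct_conv_nth
  proof (intro allI impI)
    fix i j assume "i < length (map q [0..<Suc l])" "j < length (map q [0..<Suc l])" "i \<noteq> j"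
    then have "i \<le> l" "j \<le> l" "i \<noteq> j" by auto
    then have "q i \<noteq> q j" using walkD(1,2)[OF w, of i j] walkD(1,2)[OF w, of j i] False
      by (metis nat_neq_iff)
    then show "map q [0..<Suc l] ! i \<noteq> map q [0..<Suc l] ! j"
      using \<open>i \<le> l\<close> \<open>j \<le> l\<close> by (simp del: upt_Suc)
  qed
  then have "simple_path (complete_edges m) (walk_edges q l)"
    unfolding simple_path_def
    using w walk_edges_subset[OF w]
    by (intro conjI exI[of _ "map q [0..<Suc l]"]) (auto simp: walk_edges_def walk_def simp del: upt_Suc)
  then show ?thesis by (simp add: message_def)
next
  case True
  have l: "even l" "3 \<le> l" using walkD(3,4)[OF w, of 0 l] w True by (auto simp: walk_def)
  have "distinct (map q [0..<l])"
    unfolding distinct_conv_nth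
  proof (intro allI impI)
    fix i j assume "i < length (map q [0..<l])" "j < length (map q [0..<l])" "i \<noteq> j"
    then have "i < l" "j < l" "i \<noteq> j" by auto
    then have "q i \<noteq> q j" using walkD(2)[OF w, of i j] walkD(2)[OF w, of j i]
      by (metis nat_neq_iff less_imp_le)
    then show "map q [0..<l] ! i \<noteq> map q [0..<l] ! j"
      using \<open>i < l\<close> \<open>j < l\<close> by simp
  qed
  moreover have "walk_edges q l ! i = {map q [0..<l] ! i, map q [0..<l] ! (Suc i mod l)}" if "i < l" for i
  proof (cases "Suc i = l")
    case True
    with that \<open>q l = q 0\<close> show ?thesis by auto
  qed (use that in auto)
  ultimately have "simple_cycle (complete_edges m) (walk_edges q l)"
    unfolding simple_cycle_def using l walk_edges_subset[OF w]
    by (intro conjI exI[of _ "map q [0..<l]"]) auto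
  then show ?thesis using l by (simp add: message_def)
qed

lemma message_walk:
  assumes "message (complete_edges m) P"
  obtains q where "walk m q (length P)" "P = walk_edges q (length P)"
proof -
  define l where "l = length P"
  from assms consider (path) "simple_path (complete_edges m) P"
    | (cycle) "simple_cycle (complete_edges m) P" "even (length P)" by (auto simp: message_def)
  then show ?thesis
  proof cases
    case path
    then obtain vs where vs: "distinct vs" "length vs = Suc l" "\<And>i. i < l \<Longrightarrow> P ! i = {vs ! i, vs ! Suc i}"
      and P: "P \<noteq> []" "set P \<subseteq> complete_edges m" unfolding simple_path_def l_def by auto
    have e: "{vs ! i, vs ! Suc i} \<in> complete_edges m" if "i < l" for i
      using vs(3)[OF that] P(2) that by (metis l_def nth_mem subsetD)
    have lt: "vs ! i < m" if "i \<le> l" for i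
    proof (cases "i = l")
      case True
      have "l \<noteq> 0" using P by (simp add: l_def)
      then show ?thesis using e[of "l - 1"] True by (simp add: complete_edges_iff)
    next
      case False
      then show ?thesis using e[of i] that by (simp add: complete_edges_iff)
    qed
    have "vs ! i \<noteq> vs ! j" if "i < j" "j \<le> l" for i j
      using vs(1,2) that by (simp add: nth_eq_iff_index_eq)
    moreover have "1 \<le> l" using P by (simp add: l_def Suc_le_eq)
    ultimately have "walk m ((!) vs) l" using lt unfolding walk_def by blast
    moreover have "P = walk_edges ((!) vs) l"
      using vs(3) by (intro nth_equalityI) (simp_all add: l_def)
    ultimately show ?thesis using that[of "(!) vs"] unfolding l_def by blast
  next
    case cycle
    then obtain vs where vs: "distinct vs" "length vs = l" "\<And>i. i < l \<Longrightarrow> P ! i = {vs ! i, vs ! (Suc i mod l)}"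
      and P: "3 \<le> l" "set P \<subseteq> complete_edges m" unfolding simple_cycle_def l_def by auto
    \<comment> \<open>Reading indices modulo \<open>l\<close> gives \<open>q l = q 0\<close>, so the
      closing edge of the cycle becomes an ordinary edge of the walk.\<close>
    define q where "q i = vs ! (i mod l)" for i
    have e: "{vs ! i, vs ! (Suc i mod l)} \<in> complete_edges m" if "i < l" for i
      using vs(3)[OF that] P(2) that by (metis l_def nth_mem subsetD)
    have "q i < m" for i
      using e[of "i mod l"] P by (simp add: q_def complete_edges_iff)
    moreover have "q i \<noteq> q j \<or> (i = 0 \<and> j = l)" if "i < j" "j \<le> l" for i j
    proof (cases "j = l")
      case True
      then show ?thesis using that vs P by (cases "i = 0") (auto simp: q_def nth_eq_iff_index_eq)
    next
      case False
      then show ?thesis using vs that by (simp add: q_def nth_eq_iff_index_eq)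
    qed
    ultimately have "walk m q l" using P(1) cycle(2) unfolding walk_def l_def[symmetric]
      by (metis le_trans one_le_numeral)
    moreover have "P = walk_edges q l"
      using vs(3) by (intro nth_equalityI) (simp_all add: l_def q_def)
    ultimately show ?thesis using that[of q] unfolding l_def by blast
  qed
qed

text \<open>All that decoding needs of a message: edges of equal sign are disjoint, so each sign
  class is a matching, and no edge occurs with both signs. Of the order of the edges only the parity
  matters; the order itself is recovered by the final trace.\<close>

definition alternating :: "nat \<Rightarrow> nat set list \<Rightarrow> bool" where
  "alternating m P \<longleftrightarrow> set P \<subseteq> complete_edges m \<and>
     (\<forall>i<length P. \<forall>j<length P. i \<noteq> j \<and> P ! i \<inter> P ! j \<noteq> {} \<longrightarrow> even i \<noteq> even j \<and> P ! i \<noteq> P ! j)"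

text \<open>Two edges of a walk meet only if they are consecutive or are the first and last edge of
  a cycle. In the latter case the parities differ because the length is even. The edges differ
  because a cycle has length at least 3.\<close>

lemma walk_alternating_aux:
  assumes w: "walk m q l" and ij: "i < j" "j < l" and ne: "{q i, q (Suc i)} \<inter> {q j, q (Suc j)} \<noteq> {}"
  shows "even i \<noteq> even j \<and> {q i, q (Suc i)} \<noteq> {q j, q (Suc j)}"
proof -
  have inj: "q a = q b \<Longrightarrow> a < b \<Longrightarrow> b \<le> l \<Longrightarrow> a = 0 \<and> b = l \<and> even l \<and> 3 \<le> l" for a b
    using walkD[OF w, of a b] by blast
  have d1: "q i \<noteq> q j" using inj[of i j] ij by auto
  have d2: "q (Suc i) \<noteq> q (Suc j)" using inj[of "Suc i" "Suc j"] ij by auto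
  have d3: "q i = q (Suc j) \<Longrightarrow> i = 0 \<and> Suc j = l \<and> even l \<and> 3 \<le> l" using inj[of i "Suc j"] ij by auto
  have d4: "q (Suc i) = q j \<Longrightarrow> j = Suc i" using inj[of "Suc i" j] ij by (cases "j = Suc i") auto
  from ne d1 d2 have "q i = q (Suc j) \<or> q (Suc i) = q j" by auto
  then show ?thesis using d1 d2 d3 d4 by (auto simp: doubleton_eq_iff)
qed

lemma walk_alternating:
  assumes w: "walk m q l" shows "alternating m (walk_edges q l)"
  unfolding alternating_def
proof (intro conjI allI impI)
  show "set (walk_edges q l) \<subseteq> complete_edges m" by (rule walk_edges_subset[OF w])
next
  fix i j
  assume "i < length (walk_edges q l)" "j < length (walk_edges q l)" and
    *: "i \<noteq> j \<and> walk_edges q l ! i \<inter> walk_edges q l ! j \<noteq> {}"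
  then have ij: "i < l" "j < l" by auto
  show "even i \<noteq> even j" "walk_edges q l ! i \<noteq> walk_edges q l ! j"
    using * ij walk_alternating_aux[OF w, of i j] walk_alternating_aux[OF w, of j i]
    by (cases "i < j"; auto)+
qed

lemma message_alternating: "message (complete_edges m) P \<Longrightarrow> alternating m P"
  using message_walk walk_alternating by metis

text \<open>\<open>b = True\<close> stands for the positive sign, carried by the edges at even
  positions.\<close>

definition joined :: "nat set list \<Rightarrow> bool \<Rightarrow> nat \<Rightarrow> nat \<Rightarrow> bool" where
  "joined P b u w \<longleftrightarrow> u \<noteq> w \<and> (\<exists>i<length P. even i = b \<and> P ! i = {u, w})"

text \<open>A vertex without an edge of the given sign is its own partner.\<close>

definition partner :: "nat set list \<Rightarrow> bool \<Rightarrow> nat \<Rightarrow> nat" where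
  "partner P b u = (if \<exists>w. joined P b u w then SOME w. joined P b u w else u)"

lemma joined_sym: "joined P b u w \<Longrightarrow> joined P b w u"
  by (auto simp: joined_def insert_commute)

lemma alternatingD:
  assumes "alternating m P" "i < length P" "j < length P" "x \<in> P ! i" "x \<in> P ! j"
  shows "even i = even j \<longleftrightarrow> i = j" "P ! i = P ! j \<longleftrightarrow> i = j"
  using assms unfolding alternating_def by blast+

lemma joined_unique:
  assumes "alternating m P" "joined P b u w" "joined P b u w'" shows "w = w'"
proof -
  from assms obtain i j where "i < length P" "even i = b" "P ! i = {u, w}"
    "j < length P" "even j = b" "P ! j = {u, w'}" "u \<noteq> w" "u \<noteq> w'" by (auto simp: joined_def)
  with alternatingD(1)[OF assms(1), of i j u] show ?thesis by (auto simp: doubleton_eq_iff)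
qed

lemma joined_partner:
  assumes "alternating m P" "joined P b u w" shows "partner P b u = w"
  using assms joined_unique[OF assms(1)] unfolding partner_def by (metis someI)

lemma partner_joined:
  assumes "partner P b u \<noteq> u" shows "joined P b u (partner P b u)"
  using assms unfolding partner_def by (auto intro: someI)

text \<open>An involution because the edges of one sign form a matching. This lets the program
  record an edge at both ends and lets \<open>linked_remove\<close> locate the entries affected by a
  removal.\<close>

lemma partner_partner:
  assumes "alternating m P" shows "partner P b (partner P b u) = u"
proof (cases "partner P b u = u")
  case False
  then show ?thesis using joined_partner[OF assms joined_sym[OF partner_joined]] by simp
qed simp

lemma joined_less: "alternating m P \<Longrightarrow> joined P b u w \<Longrightarrow> u < m \<and> w < m"
  unfolding alternating_def joined_def by (metis complete_edges_iff nth_mem subsetD)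

lemma partner_less: "alternating m P \<Longrightarrow> u < m \<Longrightarrow> partner P b u < m"
  using partner_joined joined_less by metis

text \<open>A common partner other than \<open>u\<close> would give an edge with both signs. This
  excludes the pairs \<open>(a, a)\<close> with \<open>a\<close> different from \<open>u\<close>,
  whose contributions cancel and which the ciphertext could not tell from the absence of
  edges.\<close>

lemma partner_opposite:
  assumes "alternating m P" "partner P True u = partner P False u" shows "partner P b u = u"
proof (rule ccontr)
  assume "partner P b u \<noteq> u"
  with assms(2) have ne: "partner P True u \<noteq> u" "partner P False u \<noteq> u" by (cases b; simp)+
  from partner_joined[OF ne(1)] partner_joined[OF ne(2)] assms(2) obtain i j where
    ij: "i < length P" "even i" "j < length P" "odd j" "P ! i = P ! j" "u \<in> P ! i"
    by (auto simp: joined_def)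
  with alternatingD(2)[OF assms(1), of i j u] show False by auto
qed

section \<open>Residual sums over a shrinking vertex set\<close>

definition restrict_partner :: "nat set \<Rightarrow> nat set list \<Rightarrow> bool \<Rightarrow> nat \<Rightarrow> nat" where
  "restrict_partner A P b u = (if partner P b u \<in> A then partner P b u else u)"

definition residual :: "(nat set \<Rightarrow> int) \<Rightarrow> nat set list \<Rightarrow> nat set \<Rightarrow> int" where
  "residual h P A = (\<Sum>i | i < length P \<and> P ! i \<subseteq> A. (-1) ^ i * h (P ! i))"

text \<open>The value 0 at \<open>u\<close> itself fits the convention that a vertex without an edge
  is its own partner.\<close>

definition star_val :: "(nat set \<Rightarrow> int) \<Rightarrow> nat \<Rightarrow> nat \<Rightarrow> int" where
  "star_val h u a = (if a = u then 0 else h {u, a})"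

text \<open>At most one index qualifies, since edges of equal sign never share a vertex.\<close>

lemma residual_at_vertex:
  assumes P: "alternating m P" and u: "u \<in> A"
  shows "(\<Sum>i | i < length P \<and> P ! i \<subseteq> A \<and> u \<in> P ! i \<and> even i = b. h (P ! i)) =
     star_val h u (restrict_partner A P b u)" (is "sum _ ?I = _")
proof (cases "\<exists>i. i \<in> ?I")
  case True
  then obtain i where i: "i \<in> ?I" by blast
  with P have "P ! i \<in> complete_edges m" "u \<in> P ! i" by (auto simp: alternating_def)
  then obtain w where w: "P ! i = {u, w}" "u \<noteq> w" by (elim complete_edgesE)
  have "?I = {i}" using alternatingD(1)[OF P, of i _ u] i by auto
  moreover have "joined P b u w" using i w by (auto simp: joined_def)
  moreover have "w \<in> A" using i w by auto
  ultimately show ?thesis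
    using w joined_partner[OF P] by (auto simp: star_val_def restrict_partner_def)
next
  case False
  have "restrict_partner A P b u = u"
  proof (rule ccontr)
    assume *: "restrict_partner A P b u \<noteq> u"
    then have "partner P b u \<noteq> u" "partner P b u \<in> A"
      by (auto simp: restrict_partner_def split: if_splits)
    with partner_joined[of P b u] u False show False by (auto simp: joined_def)
  qed
  moreover have "sum (\<lambda>i. h (P ! i)) ?I = 0" using False by (intro sum.neutral) blast
  ultimately show ?thesis by (simp add: star_val_def)
qed

text \<open>The basic step of decoding: the edges inside \<open>A\<close> split into those avoiding
  \<open>u\<close> and at most one of each sign at \<open>u\<close>. As an identity over the
  integers for arbitrary edge values it can be applied in every public coordinate.\<close>

lemma residual_peel:
  assumes P: "alternating m P" and u: "u \<in> A"
  shows "residual h P A = residual h P (A - {u}) +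
    star_val h u (restrict_partner A P True u) - star_val h u (restrict_partner A P False u)"
proof -
  let ?E = "\<lambda>b. {i. i < length P \<and> P ! i \<subseteq> A \<and> u \<in> P ! i \<and> even i = b}"
  let ?R = "{i. i < length P \<and> P ! i \<subseteq> A - {u}}"
  have "residual h P A = sum (\<lambda>i. (-1) ^ i * h (P ! i)) (?R \<union> (?E True \<union> ?E False))"
    unfolding residual_def by (rule sum.cong) auto
  also have "\<dots> = sum (\<lambda>i. (-1) ^ i * h (P ! i)) ?R +
      (sum (\<lambda>i. (-1) ^ i * h (P ! i)) (?E True) + sum (\<lambda>i. (-1) ^ i * h (P ! i)) (?E False))"
    by (subst sum.union_disjoint, simp, simp, blast, subst sum.union_disjoint) auto
  also have "sum (\<lambda>i. (-1) ^ i * h (P ! i)) (?E True) = sum (\<lambda>i. h (P ! i)) (?E True)"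
    by (rule sum.cong) auto
  also have "sum (\<lambda>i. (-1) ^ i * h (P ! i)) (?E False) = - sum (\<lambda>i. h (P ! i)) (?E False)"
    unfolding sum_negf[symmetric] by (rule sum.cong) auto
  finally show ?thesis
    unfolding residual_at_vertex[OF P u] by (simp add: residual_def)
qed

lemma residual_all:
  assumes "alternating m P"
  shows "residual h P {..<m} = (\<Sum>i<length P. (-1) ^ i * h (P ! i))"
proof -
  have "P ! i \<subseteq> {..<m}" if "i < length P" for i
    using assms nth_mem[OF that] by (fastforce simp: alternating_def complete_edges_def)
  then show ?thesis unfolding residual_def by (intro sum.cong) auto
qed

lemma residual_cong_dvd:
  assumes "\<And>i. i < length P \<Longrightarrow> P ! i \<subseteq> A \<Longrightarrow> (k :: int) dvd h (P ! i)"
  shows "k dvd residual h P A"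
  unfolding residual_def using assms by (intro dvd_sum) auto

text \<open>The bound \<open>k / 2\<close> makes the two congruent differences equal, so
  \<open>g a + g b' = g a' + g b\<close>. If \<open>a\<close> and \<open>a'\<close> differed, the
  largest of the four values would exceed the other side, whose two terms are at most a third of it
  each. A factor 2 would not do: \<open>2 - 1 = 1 - 0\<close>. Pairs \<open>(a, a)\<close> all have
  difference 0 and are normalised by the last hypotheses.\<close>

lemma spread_difference_unique:
  fixes g :: "'a \<Rightarrow> int"
  assumes bound: "\<And>x. x \<in> A \<Longrightarrow> 0 \<le> g x \<and> 2 * g x < k"
    and spread: "\<And>x y. x \<in> A \<Longrightarrow> y \<in> A \<Longrightarrow> x \<noteq> y \<Longrightarrow> g x \<noteq> g y \<and> (3 * g x \<le> g y \<or> 3 * g y \<le> g x)"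
    and A: "a \<in> A" "b \<in> A" "a' \<in> A" "b' \<in> A" and c: "[g a - g b = g a' - g b'] (mod k)"
    and u: "a = b \<Longrightarrow> a = u" "a' = b' \<Longrightarrow> a' = u"
  shows "a = a' \<and> b = b'"
proof -
  have "\<bar>(g a - g b) - (g a' - g b')\<bar> < k" using bound[OF A(1)] bound[OF A(2)] bound[OF A(3)] bound[OF A(4)] by linarith
  moreover have "k dvd (g a - g b) - (g a' - g b')" using c by (simp add: cong_iff_dvd_diff)
  ultimately have eq: "g a - g b = g a' - g b'"
    by (metis dvd_imp_le_int abs_of_nonneg eq_iff_diff_eq_0 linorder_not_le abs_ge_zero order_le_less_trans abs_of_pos)
  have s: "x = y \<or> (g x \<noteq> g y \<and> (3 * g x \<le> g y \<or> 3 * g y \<le> g x))" if "x \<in> A" "y \<in> A" for x y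
    using spread that by blast
  show ?thesis
  proof (cases "a = b")
    case True
    then have "a' = b'" using eq s[OF A(3,4)] by auto
    with True u show ?thesis by auto
  next
    case False
    have "a = a'"
      using eq False s[OF A(1,2)] s[OF A(3,4)] s[OF A(1,3)] s[OF A(2,4)]
        bound[OF A(1)] bound[OF A(2)] bound[OF A(3)] bound[OF A(4)] by smt
    then show ?thesis using eq s[OF A(2,4)] by auto
  qed
qed

section \<open>Elimination without division\<close>

text \<open>Linear forms modulo \<open>p\<close> on the first \<open>m\<close> coordinates, written
  with congruences between integers instead of a quotient. The instances are the computed rows
  (\<open>functional_dot\<close>) and the secret coordinates
  (\<open>functional_phi\<close>).\<close>

definition functional :: "int \<Rightarrow> nat \<Rightarrow> ((nat \<Rightarrow> int) \<Rightarrow> int) \<Rightarrow> bool" where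
  "functional p m f \<longleftrightarrow>
     (\<forall>a b x y. [f (\<lambda>s. a * x s + b * y s) = a * f x + b * f y] (mod p)) \<and>
     (\<forall>x y. (\<forall>s<m. [x s = y s] (mod p)) \<longrightarrow> [f x = f y] (mod p))"

lemma functional_lin: "functional p m f \<Longrightarrow> [f (\<lambda>s. a * x s + b * y s) = a * f x + b * f y] (mod p)"
  by (simp add: functional_def)

lemma functional_cong: "functional p m f \<Longrightarrow> (\<And>s. s < m \<Longrightarrow> [x s = y s] (mod p)) \<Longrightarrow> [f x = f y] (mod p)"
  by (simp add: functional_def)

lemma functional_zero: "functional p m f \<Longrightarrow> p dvd f (\<lambda>s. 0)"
  using functional_lin[of p m f 0 "\<lambda>s. 0" 0 "\<lambda>s. 0"] by (simp add: cong_0_iff)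

lemma functional_sum:
  assumes f: "functional p m f" and "finite J"
  shows "[f (\<lambda>s. \<Sum>j\<in>J. c j * x j s) = (\<Sum>j\<in>J. c j * f (x j))] (mod p)"
  using assms(2)
proof (induction J rule: finite_induct)
  case empty
  then show ?case using functional_zero[OF f] by (simp add: cong_0_iff)
next
  case (insert j J)
  have "[f (\<lambda>s. c j * x j s + 1 * (\<Sum>j\<in>J. c j * x j s)) = c j * f (x j) + 1 * f (\<lambda>s. \<Sum>j\<in>J. c j * x j s)] (mod p)"
    by (rule functional_lin[OF f])
  also have "[c j * f (x j) + 1 * f (\<lambda>s. \<Sum>j\<in>J. c j * x j s) = c j * f (x j) + 1 * (\<Sum>j\<in>J. c j * f (x j))] (mod p)"
    by (intro cong_add cong_mult insert.IH) auto
  finally show ?case using insert by simp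
qed

lemma functional_residual:
  assumes "functional p m f"
  shows "[f (\<lambda>s. residual (\<lambda>e. w e s) P A) = residual (\<lambda>e. f (w e)) P A] (mod p)"
  unfolding residual_def by (rule functional_sum[OF assms]) simp

definition dot :: "nat \<Rightarrow> (nat \<Rightarrow> nat) \<Rightarrow> (nat \<Rightarrow> int) \<Rightarrow> int" where
  "dot m f x = (\<Sum>s<m. int (f s) * x s)"

lemma functional_dot: "functional p m (dot m f)"
  unfolding functional_def
proof (intro conjI allI impI)
  fix a b x y
  show "[dot m f (\<lambda>s. a * x s + b * y s) = a * dot m f x + b * dot m f y] (mod p)"
    by (simp add: dot_def sum.distrib sum_distrib_left algebra_simps)
next
  fix x y :: "nat \<Rightarrow> int" assume "\<forall>s<m. [x s = y s] (mod p)"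
  then show "[dot m f x = dot m f y] (mod p)"
    unfolding dot_def by (intro cong_sum cong_mult) auto
qed

definition killed :: "int \<Rightarrow> nat \<Rightarrow> (nat \<Rightarrow> nat \<Rightarrow> nat) \<Rightarrow> (nat \<Rightarrow> int) \<Rightarrow> bool" where
  "killed p m F x \<longleftrightarrow> (\<forall>t<m. p dvd dot m (F t) x)"

text \<open>The common kernel of the rows of \<open>F\<close> contains \<open>G\<close> and lies in the span of \<open>G'\<close>. The upper
  bound is stated through functionals vanishing on \<open>G'\<close>, which is all that decoding needs.\<close>

definition between :: "int \<Rightarrow> nat \<Rightarrow> (nat \<Rightarrow> int) set \<Rightarrow> (nat \<Rightarrow> int) set \<Rightarrow> (nat \<Rightarrow> nat \<Rightarrow> nat) \<Rightarrow> bool" where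
  "between p m G G' F \<longleftrightarrow> (\<forall>g\<in>G. killed p m F g) \<and>
     (\<forall>f x. functional p m f \<and> (\<forall>g\<in>G'. p dvd f g) \<and> killed p m F x \<longrightarrow> p dvd f x)"

lemma betweenI:
  assumes "\<And>g. g \<in> G \<Longrightarrow> killed p m F g"
    and "\<And>f x. functional p m f \<Longrightarrow> (\<And>g. g \<in> G' \<Longrightarrow> p dvd f g) \<Longrightarrow> killed p m F x \<Longrightarrow> p dvd f x"
  shows "between p m G G' F"
  using assms unfolding between_def by simp

lemma betweenD:
  assumes "between p m G G' F"
  shows "g \<in> G \<Longrightarrow> killed p m F g"
    and "functional p m f \<Longrightarrow> (\<And>g. g \<in> G' \<Longrightarrow> p dvd f g) \<Longrightarrow> killed p m F x \<Longrightarrow> p dvd f x"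
  using assms unfolding between_def by simp_all

text \<open>The identity matrix has zero kernel: a vector killed by it is congruent to 0, where
  every functional vanishes.\<close>

lemma between_identity: "between p m {} {} (\<lambda>t s. if t = s then 1 else 0)"
  unfolding between_def
proof (intro conjI allI impI ballI)
  fix f and x :: "nat \<Rightarrow> int"
  assume *: "functional p m f \<and> (\<forall>g\<in>{}. p dvd f g) \<and> killed p m (\<lambda>t s. if t = s then 1 else 0) x"
  have "dot m (\<lambda>s. if t = s then 1 else 0) x = x t" if "t < m" for t
  proof -
    have "dot m (\<lambda>s. if t = s then 1 else 0) x = (\<Sum>s<m. if t = s then x s else 0)"
      unfolding dot_def by (rule sum.cong) auto
    then show ?thesis using that by simp
  qed
  with * have x: "[x s = 0] (mod p)" if "s < m" for s
    using that by (simp add: killed_def cong_0_iff)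
  have f: "functional p m f" using * by simp
  have "[f x = f (\<lambda>s. 0)] (mod p)" by (rule functional_cong[OF f x])
  then show "p dvd f x" using functional_zero[OF f] by (simp add: cong_dvd_iff)
qed simp

text \<open>Row \<open>t\<close> becomes \<open>F t0 (g) * F t - F t (g) * F t0\<close>, with
  \<open>p - 1\<close> in place of \<open>- 1\<close>. Multiplying crosswise avoids modular
  inverses. Row \<open>t0\<close> itself becomes zero, which enlarges the kernel.\<close>

definition eliminate :: "nat \<Rightarrow> nat \<Rightarrow> (nat \<Rightarrow> int) \<Rightarrow> nat \<Rightarrow> (nat \<Rightarrow> nat \<Rightarrow> nat) \<Rightarrow> nat \<Rightarrow> nat \<Rightarrow> nat" where
  "eliminate p m g t0 F = (\<lambda>t s. (nat (dot m (F t0) g mod int p) * F t s +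
     (p - 1) * nat (dot m (F t) g mod int p) * F t0 s) mod p)"

lemma dot_eliminate:
  assumes p: "0 < p"
  shows "[dot m (eliminate p m g t0 F t) x = dot m (F t0) g * dot m (F t) x - dot m (F t) g * dot m (F t0) x] (mod int p)"
proof -
  have "[int (eliminate p m g t0 F t s) = dot m (F t0) g * int (F t s) - dot m (F t) g * int (F t0 s)] (mod int p)" for s
  proof -
    have "int (eliminate p m g t0 F t s) = ((dot m (F t0) g mod int p) * int (F t s) +
        (int p - 1) * (dot m (F t) g mod int p) * int (F t0 s)) mod int p"
      using p by (simp add: eliminate_def zmod_int of_nat_diff)
    also have "[\<dots> = dot m (F t0) g * int (F t s) + (0 - 1) * dot m (F t) g * int (F t0 s)] (mod int p)"
      unfolding cong_mod_left by (intro cong_add cong_mult cong_diff) (auto simp: cong_0_iff)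
    finally show ?thesis by simp
  qed
  then have "[dot m (eliminate p m g t0 F t) x =
      (\<Sum>s<m. (dot m (F t0) g * int (F t s) - dot m (F t) g * int (F t0 s)) * x s)] (mod int p)"
    unfolding dot_def[of m "eliminate p m g t0 F t"] by (intro cong_sum cong_mult) auto
  also have "(\<Sum>s<m. (dot m (F t0) g * int (F t s) - dot m (F t) g * int (F t0 s)) * x s) =
      dot m (F t0) g * dot m (F t) x - dot m (F t) g * dot m (F t0) x"
    unfolding dot_def[of m "F t" x] dot_def[of m "F t0" x]
    by (simp add: left_diff_distrib sum_subtractf sum_distrib_left mult.assoc)
  finally show ?thesis .
qed

lemma eliminate_killed: "0 < p \<Longrightarrow> killed (int p) m (eliminate p m g t0 F) g"
  unfolding killed_def using dot_eliminate[of p m g t0 F _ g] by (auto simp: cong_0_iff mult.commute)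

text \<open>The kernel grows only in the direction \<open>g\<close>, which already belongs to
  \<open>G'\<close>, so the upper bound survives. Primality of \<open>p\<close> enters when the
  pivot value is cancelled.\<close>

lemma between_eliminate:
  assumes p: "prime p" and b: "between (int p) m G G' F" and g: "g \<in> G'" and t0: "t0 < m"
    and nz: "\<not> int p dvd dot m (F t0) g"
  shows "between (int p) m G G' (eliminate p m g t0 F)"
  unfolding between_def
proof (intro conjI allI impI ballI)
  have p0: "0 < p" using p by (simp add: prime_gt_0_nat)
  show "killed (int p) m (eliminate p m g t0 F) x" if "x \<in> G" for x
    unfolding killed_def
  proof (intro allI impI)
    fix t assume "t < m"
    have "killed (int p) m F x" using b that unfolding between_def by (elim conjE) (erule bspec)
    with t0 \<open>t < m\<close> have "int p dvd dot m (F t) x" "int p dvd dot m (F t0) x"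
      unfolding killed_def by blast+
    then show "int p dvd dot m (eliminate p m g t0 F t) x"
      using dot_eliminate[OF p0, of m g t0 F t x] by (simp add: cong_dvd_iff)
  qed
  fix f x
  assume *: "functional (int p) m f \<and> (\<forall>g\<in>G'. int p dvd f g) \<and> killed (int p) m (eliminate p m g t0 F) x"
  \<comment> \<open>This combination takes in every old row the value that the eliminated row takes
    at \<open>x\<close>, so it is killed by \<open>F\<close>; and a functional vanishing at
    \<open>g\<close> sees in it only a multiple of \<open>x\<close>.\<close>
  define y where "y = (\<lambda>s. dot m (F t0) g * x s + (- dot m (F t0) x) * g s)"
  have "killed (int p) m F y"
    unfolding killed_def
  proof (intro allI impI)
    fix t assume t: "t < m"
    have "[dot m (F t) y = dot m (F t0) g * dot m (F t) x + (- dot m (F t0) x) * dot m (F t) g] (mod int p)"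
      unfolding y_def by (rule functional_lin[OF functional_dot])
    moreover have "[dot m (eliminate p m g t0 F t) x = dot m (F t0) g * dot m (F t) x + (- dot m (F t0) x) * dot m (F t) g] (mod int p)"
      using dot_eliminate[OF p0, of m g t0 F t x] by (simp add: mult.commute)
    moreover have "int p dvd dot m (eliminate p m g t0 F t) x" using * t by (simp add: killed_def)
    ultimately show "int p dvd dot m (F t) y" by (simp add: cong_dvd_iff)
  qed
  with b * have "int p dvd f y" unfolding between_def by blast
  moreover have "[f y = dot m (F t0) g * f x + (- dot m (F t0) x) * f g] (mod int p)"
    unfolding y_def using * by (intro functional_lin) auto
  moreover have "int p dvd f g" using * g by blast
  ultimately have "int p dvd dot m (F t0) g * f x"
    by (metis cong_dvd_iff dvd_add_left_iff dvd_mult)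
  then show "int p dvd f x" using nz p by (simp add: prime_dvd_mult_iff)
qed

lemma between_insert:
  assumes b: "between p m G G' F" and g: "killed p m F g"
  shows "between p m (insert g G) G' F"
proof (rule betweenI)
  show "killed p m F x" if "x \<in> insert g G" for x
    using that betweenD(1)[OF b, of x] g by (cases "x = g") simp_all
qed (rule betweenD(2)[OF b])

lemma between_mono:
  assumes b: "between p m G G' F" and sub: "G' \<subseteq> G''"
  shows "between p m G G'' F"
proof (rule betweenI)
  show "p dvd f x"
    if "functional p m f" and "\<And>g. g \<in> G'' \<Longrightarrow> p dvd f g" and "killed p m F x" for f x
    by (rule betweenD(2)[OF b that(1) that(2)[OF subsetD[OF sub]] that(3)])
qed (rule betweenD(1)[OF b])

section \<open>Systems with zero limited noise\<close>

locale zero_noise_key =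
  fixes pk :: public_key and What M v
  assumes family: "in_family pk What M v" and zero_noise: "zero_limited_noise (nverts pk) What v"
begin

abbreviation "m \<equiv> nverts pk"
abbreviation "p \<equiv> modulus pk"

text \<open>Coordinates are counted from 0 here, as in the program, and from 1 in the key.\<close>

definition wt :: "nat set \<Rightarrow> nat \<Rightarrow> int" where
  "wt e s = weight pk e (Suc s)"

definition reduce :: "(nat \<Rightarrow> int) \<Rightarrow> nat \<Rightarrow> int" where
  "reduce x = (\<lambda>t\<in>{1..m}. x (t - 1) mod int p)"

text \<open>The secret coordinate \<open>i\<close> as a functional of public vectors. The vector is
  reduced first because \<open>M\<close> is specified on \<open>fp_space\<close> only.\<close>

definition phi :: "nat \<Rightarrow> (nat \<Rightarrow> int) \<Rightarrow> int" where
  "phi i x = M (reduce x) i"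

lemma prime_p: "prime p" and dim: "wdim pk = m" and edges: "edges pk = complete_edges m"
  and weights: "e \<in> complete_edges m \<Longrightarrow> weight pk e \<in> fp_space p m"
  and linear: "fp_linear p m M" and What: "e \<in> complete_edges m \<Longrightarrow> What e = M (weight pk e)"
  and numbering: "bij_betw v {1..m} {..<m}"
  and positive: "1 \<le> i \<Longrightarrow> i < j \<Longrightarrow> j \<le> m \<Longrightarrow> 0 < What {v i, v j} i"
  and rapid: "1 \<le> i \<Longrightarrow> i < j \<Longrightarrow> j < m \<Longrightarrow> 3 * What {v i, v j} i \<le> What {v i, v (Suc j)} i"
  using family by (auto simp: in_family_def matching_cryptosystem_def fp_invertible_linear_def)

lemma p_pos: "0 < p"
  using prime_p by (simp add: prime_gt_0_nat)

lemma reduce_in: "reduce x \<in> fp_space p m"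
  using p_pos by (auto simp: reduce_def fp_space_def)

lemma M_in: "x \<in> fp_space p m \<Longrightarrow> M x \<in> fp_space p m"
  using linear by (auto simp: fp_linear_def)

lemma fp_spaceD: "x \<in> fp_space p m \<Longrightarrow> t \<in> {1..m} \<Longrightarrow> 0 \<le> x t \<and> x t < int p"
  by (auto simp: fp_space_def PiE_iff)

lemma reduce_lin:
  "reduce (\<lambda>s. a * x s + b * y s) =
    fp_add p m (fp_scale p m (a mod int p) (reduce x)) (fp_scale p m (b mod int p) (reduce y))"
  by (auto simp: reduce_def fp_add_def fp_scale_def mod_simps)

lemma functional_phi:
  assumes i: "i \<in> {1..m}" shows "functional (int p) m (phi i)"
  unfolding functional_def
proof (intro conjI allI impI)
  fix a b x y
  have ab: "a mod int p \<in> {0..<int p}" "b mod int p \<in> {0..<int p}" using p_pos by auto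
  have sc: "fp_scale p m c z \<in> fp_space p m" for c z
    using p_pos by (auto simp: fp_scale_def fp_space_def)
  have "M (reduce (\<lambda>s. a * x s + b * y s)) =
    fp_add p m (fp_scale p m (a mod int p) (M (reduce x))) (fp_scale p m (b mod int p) (M (reduce y)))"
    unfolding reduce_lin using linear ab sc reduce_in by (simp add: fp_linear_def)
  then show "[phi i (\<lambda>s. a * x s + b * y s) = a * phi i x + b * phi i y] (mod int p)"
    using i by (simp add: phi_def fp_add_def fp_scale_def cong_def mod_simps)
next
  fix x y :: "nat \<Rightarrow> int" assume xy: "\<forall>s<m. [x s = y s] (mod int p)"
  have "reduce x = reduce y"
  proof
    fix t show "reduce x t = reduce y t"
      using xy[rule_format, of "t - 1"] by (auto simp: reduce_def cong_def)
  qed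
  then show "[phi i x = phi i y] (mod int p)" by (simp add: phi_def)
qed

lemma phi_wt: "e \<in> complete_edges m \<Longrightarrow> phi i (wt e) = What e i"
proof -
  assume e: "e \<in> complete_edges m"
  have "reduce (wt e) = weight pk e"
  proof
    fix t show "reduce (wt e) t = weight pk e t"
    proof (cases "t \<in> {1..m}")
      case True
      with fp_spaceD[OF weights[OF e], of t] show ?thesis by (simp add: reduce_def wt_def)
    next
      case False
      with weights[OF e] have "weight pk e t = undefined" unfolding fp_space_def by (rule PiE_arb)
      with False show ?thesis by (auto simp: reduce_def)
    qed
  qed
  then show ?thesis by (simp add: phi_def What e)
qed

section \<open>Secret weights along the secret numbering\<close>

lemma What_bounds: "e \<in> complete_edges m \<Longrightarrow> i \<in> {1..m} \<Longrightarrow> 0 \<le> What e i \<and> What e i < int p"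
  using What[of e] fp_spaceD[OF M_in[OF weights, of e], of i] by simp

lemma v_less: "i \<in> {1..m} \<Longrightarrow> v i < m"
  using bij_betw_apply[OF numbering, of i] by simp

lemma v_inj: "i \<in> {1..m} \<Longrightarrow> j \<in> {1..m} \<Longrightarrow> v i = v j \<longleftrightarrow> i = j"
  by (rule inj_on_eq_iff[OF bij_betw_imp_inj_on[OF numbering]])

lemma v_edge: "i \<in> {1..m} \<Longrightarrow> j \<in> {1..m} \<Longrightarrow> i \<noteq> j \<Longrightarrow> {v i, v j} \<in> complete_edges m"
  by (simp add: complete_edges_iff v_less v_inj)

lemma rapid_less:
  assumes "1 \<le> i" "i < j" "j < j'" "j' \<le> m"
  shows "3 * What {v i, v j} i \<le> What {v i, v j'} i"
proof -
  have "3 * What {v i, v j} i \<le> What {v i, v (j + Suc k)} i" if "j + Suc k \<le> m" for k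
    using that
  proof (induction k)
    case 0
    then show ?case using rapid assms by simp
  next
    case (Suc k)
    then have "3 * What {v i, v j} i \<le> What {v i, v (j + Suc k)} i" by simp
    moreover have "3 * What {v i, v (j + Suc k)} i \<le> What {v i, v (j + Suc (Suc k))} i"
      using rapid[of i "j + Suc k"] assms Suc.prems by simp
    moreover have "0 < What {v i, v (j + Suc k)} i" using positive[of i "j + Suc k"] assms Suc.prems by simp
    ultimately show ?case by linarith
  qed
  from this[of "j' - j - 1"] assms show ?thesis by simp
qed

text \<open>Rapid growth leaves room for one factor of three below \<open>p\<close>, so only the edges at \<open>v_m\<close> can wrap around.\<close>

lemma no_wrap_before_last:
  assumes "1 \<le> i" "i < j" "j < m" shows "2 * What {v i, v j} i < int p"
proof -
  have "3 * What {v i, v j} i \<le> What {v i, v m} i" using rapid_less[of i j m] assms by simp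
  moreover have "What {v i, v m} i < int p" using What_bounds[OF v_edge, of i m i] assms by simp
  moreover have "0 < What {v i, v j} i" using positive assms by simp
  ultimately show ?thesis by linarith
qed

lemma later_zero: "1 \<le> t \<Longrightarrow> t < i \<Longrightarrow> i < j \<Longrightarrow> j \<le> m \<Longrightarrow> What {v i, v j} t = 0"
  using zero_noise by (simp add: zero_limited_noise_def)

text \<open>Zero limited noise enters here: among the edges between vertices of index at least
  \<open>i\<close>, coordinate \<open>i\<close> sees only those at \<open>v i\<close>. This makes
  decoding triangular.\<close>

lemma What_later:
  assumes i: "i \<in> {1..m}" and A: "A \<subseteq> v ` {i..m}" and e: "e \<in> complete_edges m" "e \<subseteq> A - {v i}"
  shows "What e i = 0"
proof -
  from e obtain a b where ab: "e = {a, b}" "a \<noteq> b" by (auto simp: complete_edges_def)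
  with e A have "a \<in> v ` {i..m}" "b \<in> v ` {i..m}" by auto
  then obtain j k where jk: "a = v j" "j \<in> {i..m}" "b = v k" "k \<in> {i..m}" by (elim imageE)
  have "j \<noteq> i" "k \<noteq> i" "j \<noteq> k" using e(2) ab jk(1,3) by auto
  then consider "i < j" "j < k" | "i < k" "k < j" using jk by fastforce
  then show ?thesis
  proof cases
    case 1
    with later_zero[of i j k] jk i show ?thesis by (simp add: ab)
  next
    case 2
    with later_zero[of i k j] jk i show ?thesis by (simp add: ab insert_commute)
  qed
qed

abbreviation "leading i \<equiv> star_val (\<lambda>e. What e i) (v i)"

text \<open>Absence of wrap-around is required only for vertices in \<open>A\<close>. So the lemma
  serves the attack, where \<open>v m\<close> has been removed, as well as uniqueness under
  \<open>no_wraparound\<close>, where it has not.\<close>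

lemma leading_difference_unique:
  assumes i: "i \<in> {1..m}" and A: "A \<subseteq> v ` {i..m}"
    and wrap: "\<And>j. v j \<in> A \<Longrightarrow> i < j \<Longrightarrow> j \<le> m \<Longrightarrow> 2 * What {v i, v j} i < int p"
    and mem: "a \<in> A" "b \<in> A" "a' \<in> A" "b' \<in> A"
    and u: "a = b \<Longrightarrow> a = v i" "a' = b' \<Longrightarrow> a' = v i"
    and c: "[leading i a - leading i b =
      leading i a' - leading i b'] (mod int p)"
  shows "a = a' \<and> b = b'"
proof (rule spread_difference_unique[OF _ _ mem c u])
  have star: "leading i (v j) = (if j = i then 0 else What {v i, v j} i)" if "j \<in> {i..m}" for j
    using that i v_inj[of j i] by (auto simp: star_val_def)
  fix x assume x: "x \<in> A"
  then obtain j where j: "x = v j" "j \<in> {i..m}" using A by blast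
  show "0 \<le> leading i x \<and> 2 * leading i x < int p"
    using star[OF j(2)] j x positive[of i j] wrap[of j] i p_pos by auto
  fix y assume y: "y \<in> A" "x \<noteq> y"
  then obtain k where k: "y = v k" "k \<in> {i..m}" using A by blast
  have "j \<noteq> k" using j k y by auto
  have *: "g \<noteq> h \<and> (3 * g \<le> h \<or> 3 * h \<le> g)" if "0 < g" "3 * g \<le> h \<or> 3 * h \<le> g" "0 < h" for g h :: int
    using that by auto
  consider "j = i" "i < k" | "k = i" "i < j" | "i < j" "j < k" | "i < k" "k < j"
    using j k \<open>j \<noteq> k\<close> by fastforce
  then show "leading i x \<noteq> leading i y \<and>
    (3 * leading i x \<le> leading i y \<or>
     3 * leading i y \<le> leading i x)"
  proof cases
    case 1
    with positive[of i k] i k show ?thesis unfolding j(1) k(1) star[OF j(2)] star[OF k(2)] by auto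
  next
    case 2
    with positive[of i j] i j show ?thesis unfolding j(1) k(1) star[OF j(2)] star[OF k(2)] by auto
  next
    case 3
    with positive[of i j] positive[of i k] rapid_less[of i j k] i j k show ?thesis
      unfolding j(1) k(1) star[OF j(2)] star[OF k(2)] by auto
  next
    case 4
    with positive[of i j] positive[of i k] rapid_less[of i k j] i j k show ?thesis
      unfolding j(1) k(1) star[OF j(2)] star[OF k(2)] by auto
  qed
qed

definition star_vec :: "nat \<Rightarrow> nat \<Rightarrow> nat \<Rightarrow> int" where
  "star_vec u a s = star_val (\<lambda>e. wt e s) u a"

lemma phi_star_vec:
  assumes i: "i \<in> {1..m}" and "u < m" "a < m"
  shows "[phi i (star_vec u a) = star_val (\<lambda>e. What e i) u a] (mod int p)"
proof (cases "a = u")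
  case True
  then have "star_vec u a = (\<lambda>s. 0)" by (auto simp: star_vec_def star_val_def)
  with True functional_zero[OF functional_phi[OF i]] show ?thesis by (simp add: star_val_def cong_0_iff)
next
  case False
  then have "star_vec u a = wt {u, a}" by (auto simp: star_vec_def star_val_def)
  with False phi_wt[of "{u, a}" i] assms show ?thesis by (simp add: star_val_def complete_edges_iff)
qed

definition res :: "nat set list \<Rightarrow> nat set \<Rightarrow> nat \<Rightarrow> int" where
  "res P A s = residual (\<lambda>e. wt e s) P A"

lemma res_peel:
  assumes "alternating m P" "u \<in> A"
  shows "res P A s = res P (A - {u}) s + star_vec u (restrict_partner A P True u) s -
    star_vec u (restrict_partner A P False u) s"
  unfolding res_def star_vec_def by (rule residual_peel[OF assms])

text \<open>A residual is a signed sum of weights of edges inside \<open>A\<close>. The lemma is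
  applied to the computed rows and to the secret coordinates.\<close>

lemma functional_dvd_res:
  assumes f: "functional (int p) m f" and P: "alternating m P"
    and "\<And>e. e \<in> complete_edges m \<Longrightarrow> e \<subseteq> A \<Longrightarrow> int p dvd f (wt e)"
  shows "int p dvd f (res P A)"
proof -
  have "[f (res P A) = residual (\<lambda>e. f (wt e)) P A] (mod int p)"
    using functional_residual[OF f, of wt P A] by (simp add: res_def[abs_def])
  moreover have "int p dvd residual (\<lambda>e. f (wt e)) P A"
  proof (rule residual_cong_dvd)
    fix i assume "i < length P" "P ! i \<subseteq> A"
    moreover have "P ! i \<in> complete_edges m"
      using P nth_mem[OF \<open>i < length P\<close>] unfolding alternating_def by blast
    ultimately show "int p dvd f (wt (P ! i))" by (intro assms(3))
  qed
  ultimately show ?thesis by (simp add: cong_dvd_iff)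
qed

lemma phi_dvd_res:
  assumes i: "i \<in> {1..m}" and A: "A \<subseteq> v ` {i..m}" and P: "alternating m P"
  shows "int p dvd phi i (res P (A - {v i}))"
  using What_later[OF i A] by (intro functional_dvd_res[OF functional_phi[OF i] P]) (simp add: phi_wt)

lemma encrypt_eq: 
  assumes "alternating m P"
  shows "encrypt pk P = (\<lambda>t\<in>{1..m}. res P {..<m} (t - 1) mod int p)"
  unfolding encrypt_def dim res_def residual_all[OF assms]
  by (auto simp: wt_def intro!: restrict_ext)

lemma restrict_partner_mem: "u \<in> A \<Longrightarrow> restrict_partner A P b u \<in> A"
  by (simp add: restrict_partner_def)

lemma restrict_partner_opposite:
  assumes "alternating m P" "u \<in> A" "restrict_partner A P True u = restrict_partner A P False u"
  shows "restrict_partner A P True u = u"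
  using assms(2,3) partner_opposite[OF assms(1), of u True] partner_opposite[OF assms(1), of u False]
  by (auto simp: restrict_partner_def split: if_splits)

lemma phi_lin3:
  assumes i: "i \<in> {1..m}"
  shows "[phi i (\<lambda>s. x s - y s + z s) = phi i x - phi i y + phi i z] (mod int p)"
proof -
  note f = functional_phi[OF i]
  have "[phi i (\<lambda>s. 1 * (1 * x s + (- 1) * y s) + 1 * z s) =
      1 * phi i (\<lambda>s. 1 * x s + (- 1) * y s) + 1 * phi i z] (mod int p)"
    by (rule functional_lin[OF f])
  also have "[1 * phi i (\<lambda>s. 1 * x s + (- 1) * y s) + 1 * phi i z =
      1 * (1 * phi i x + (- 1) * phi i y) + 1 * phi i z] (mod int p)"
    by (intro cong_add cong_mult functional_lin[OF f]) auto
  finally show ?thesis by simp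
qed

text \<open>Decoding in the secret order, with \<open>B i\<close> the vertices \<open>v_i, \<dots>, v_m\<close>.\<close>

lemma message_unique:
  assumes wrap: "no_wraparound pk What v"
    and P: "alternating m P" and Q: "alternating m Q" and enc: "encrypt pk P = encrypt pk Q"
  shows "set P = set Q"
proof -
  define B where "B i = v ` {i..m}" for i
  have B_Suc: "B i - {v i} = B (Suc i)" if "i \<in> {1..m}" for i
  proof -
    have "{i..m} = insert i {Suc i..m}" using that by auto
    moreover have "v i \<notin> v ` {Suc i..m}"
    proof
      assume "v i \<in> v ` {Suc i..m}"
      then obtain j where "v i = v j" "j \<in> {Suc i..m}" by (rule imageE)
      with v_inj[of i j] that show False by simp
    qed
    ultimately show ?thesis by (simp add: B_def)
  qed
  \<comment> \<open>In coordinate \<open>i\<close> the residual is a difference of two leading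
    entries, which determines both partners of \<open>v i\<close>; subtracting the same edges from
    both sides carries the congruence to the next set.\<close>
  have step: "(\<forall>b. restrict_partner (B i) P b (v i) = restrict_partner (B i) Q b (v i)) \<and>
      (\<forall>s<m. [res P (B (Suc i)) s = res Q (B (Suc i)) s] (mod int p))"
    if i: "i \<in> {1..m}" and r: "\<forall>s<m. [res P (B i) s = res Q (B i) s] (mod int p)" for i
  proof -
    have vi: "v i \<in> B i" using i by (auto simp: B_def)
    have lt: "restrict_partner (B i) R b (v i) < m" for R b
      using restrict_partner_mem[OF vi, of R b] v_less i by (force simp: B_def)
    define D where "D R = leading i (restrict_partner (B i) R True (v i)) -
      leading i (restrict_partner (B i) R False (v i))" for R
    have D: "[phi i (res R (B i)) = D R] (mod int p)" if R: "alternating m R" for R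
    proof -
      have "res R (B i) = (\<lambda>s. res R (B i - {v i}) s - star_vec (v i) (restrict_partner (B i) R False (v i)) s
          + star_vec (v i) (restrict_partner (B i) R True (v i)) s)"
        using res_peel[OF R vi] by auto
      then have "[phi i (res R (B i)) = phi i (res R (B i - {v i})) -
          phi i (star_vec (v i) (restrict_partner (B i) R False (v i))) +
          phi i (star_vec (v i) (restrict_partner (B i) R True (v i)))] (mod int p)"
        using phi_lin3[OF i] by presburger
      also have "[phi i (res R (B i - {v i})) -
          phi i (star_vec (v i) (restrict_partner (B i) R False (v i))) +
          phi i (star_vec (v i) (restrict_partner (B i) R True (v i))) = 0 - leading i (restrict_partner (B i) R False (v i)) +
          leading i (restrict_partner (B i) R True (v i))] (mod int p)"
        using phi_dvd_res[OF i _ R, of "B i"] v_less[OF i] lt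
        by (intro cong_add cong_diff phi_star_vec i) (auto simp: cong_0_iff B_def)
      finally show ?thesis by (simp add: D_def)
    qed
    have "[phi i (res P (B i)) = phi i (res Q (B i))] (mod int p)"
      using functional_cong[OF functional_phi[OF i]] r by blast
    then have c: "[D P = D Q] (mod int p)"
      using D[OF P] D[OF Q] by (metis cong_sym cong_trans)
    have "restrict_partner (B i) P True (v i) = restrict_partner (B i) Q True (v i) \<and>
        restrict_partner (B i) P False (v i) = restrict_partner (B i) Q False (v i)"
    proof (rule leading_difference_unique[OF i _ _ restrict_partner_mem[OF vi] restrict_partner_mem[OF vi]
          restrict_partner_mem[OF vi] restrict_partner_mem[OF vi]
          restrict_partner_opposite[OF P vi] restrict_partner_opposite[OF Q vi]])
      show "B i \<subseteq> v ` {i..m}" by (simp add: B_def)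
      show "2 * What {v i, v j} i < int p" if "i < j" "j \<le> m" for j
        using wrap i that by (simp add: no_wraparound_def)
    qed (assumption | rule c[unfolded D_def])+
    then have eq: "restrict_partner (B i) P b (v i) = restrict_partner (B i) Q b (v i)" for b
      by (cases b) auto
    moreover have "[res P (B (Suc i)) s = res Q (B (Suc i)) s] (mod int p)" if "s < m" for s
    proof -
      have "res R (B (Suc i)) s = res R (B i) s - star_vec (v i) (restrict_partner (B i) R True (v i)) s +
          star_vec (v i) (restrict_partner (B i) R False (v i)) s" if "alternating m R" for R
        using res_peel[OF that vi, of s] B_Suc[OF i] by simp
      with P Q eq r that show ?thesis by (auto intro!: cong_add cong_diff)
    qed
    ultimately show ?thesis by blast
  qed
  have B1: "B 1 = {..<m}" using numbering by (simp add: B_def bij_betw_def)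
  have r: "\<forall>s<m. [res P (B (Suc i)) s = res Q (B (Suc i)) s] (mod int p)" if "i \<le> m" for i
    using that
  proof (induction i)
    case 0
    have "res P {..<m} s mod int p = res Q {..<m} s mod int p" if "s < m" for s
      using fun_cong[OF enc, of "Suc s"] that unfolding encrypt_eq[OF P] encrypt_eq[OF Q] by simp
    then show ?case using B1 by (simp add: cong_def)
  next
    case (Suc i)
    then show ?case using step[of "Suc i"] by auto
  qed
  have eq: "restrict_partner (B i) P b (v i) = restrict_partner (B i) Q b (v i)" if "i \<in> {1..m}" for i b
    using step[OF that] r[of "i - 1"] that by auto
  \<comment> \<open>Each edge is found at its end of smaller index \<open>i\<close>, where the other
    end still lies in \<open>B i\<close> and is therefore seen by
    \<open>restrict_partner\<close>.\<close>
  have sub: "set R \<subseteq> set S" if R: "alternating m R"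
    and RS: "\<And>i b. i \<in> {1..m} \<Longrightarrow> restrict_partner (B i) R b (v i) = restrict_partner (B i) S b (v i)" for R S
  proof
    fix e assume "e \<in> set R"
    then obtain n where n: "n < length R" "R ! n = e" by (auto simp: in_set_conv_nth)
    have "e \<in> complete_edges m" using R \<open>e \<in> set R\<close> by (auto simp: alternating_def)
    then obtain a b where ab: "e = {a, b}" "a \<noteq> b" "a < m" "b < m" by (auto simp: complete_edges_def)
    moreover have "v ` {1..m} = {..<m}" using numbering by (simp add: bij_betw_def)
    ultimately obtain j k where jk: "j \<in> {1..m}" "k \<in> {1..m}" "a = v j" "b = v k"
      by (metis imageE lessThan_iff)
    then obtain i i' where ii: "e = {v i, v i'}" "i \<in> {1..m}" "i' \<in> {1..m}" "i < i'"
      using ab by (metis insert_commute linorder_neqE_nat)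
    have "joined R (even n) (v i) (v i')" using ii n v_inj by (auto simp: joined_def)
    then have "partner R (even n) (v i) = v i'" by (rule joined_partner[OF R])
    moreover have "v i' \<in> B i" using ii by (auto simp: B_def)
    ultimately have "restrict_partner (B i) S (even n) (v i) = v i'"
      using RS[OF ii(2), of "even n"] by (simp add: restrict_partner_def)
    moreover have "v i' \<noteq> v i" using ii v_inj by auto
    ultimately have "partner S (even n) (v i) = v i'" by (auto simp: restrict_partner_def split: if_splits)
    with partner_joined[of S "even n" "v i"] \<open>v i' \<noteq> v i\<close> have "joined S (even n) (v i) (v i')" by simp
    then show "e \<in> set S" unfolding joined_def ii(1) by (metis nth_mem)
  qed
  show ?thesis using sub[OF P] sub[OF Q] eq by (metis subset_antisym)
qed

section \<open>Recognising the correct partners without the secret basis\<close>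

definition generators :: "nat set \<Rightarrow> (nat \<Rightarrow> int) set" where
  "generators A = wt ` {e \<in> complete_edges m. e \<subseteq> A}"

definition candidate :: "(nat \<Rightarrow> int) \<Rightarrow> nat \<Rightarrow> nat \<Rightarrow> nat \<Rightarrow> nat \<Rightarrow> int" where
  "candidate r u a b s = r s - star_vec u a s + star_vec u b s"

text \<open>The true candidate is congruent to the residual on \<open>A - {u}\<close>, a combination
  of generators. This holds for every \<open>u\<close>, wherever it stands in the secret order, and
  is what makes acting on a unique candidate safe.\<close>

lemma true_candidate_killed:
  assumes P: "alternating m P" and u: "u \<in> A"
    and r: "\<And>s. s < m \<Longrightarrow> [r s = res P A s] (mod int p)"
    and F: "between (int p) m (generators (A - {u})) G F"
  shows "killed (int p) m F
    (candidate r u (restrict_partner A P True u) (restrict_partner A P False u))"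
  unfolding killed_def
proof (intro allI impI)
  fix t assume t: "t < m"
  let ?c = "candidate r u (restrict_partner A P True u) (restrict_partner A P False u)"
  have "[?c s = res P (A - {u}) s] (mod int p)" if "s < m" for s
  proof -
    have "[?c s = res P A s - star_vec u (restrict_partner A P True u) s
        + star_vec u (restrict_partner A P False u) s] (mod int p)"
      unfolding candidate_def using r[OF that] by (intro cong_add cong_diff) auto
    then show ?thesis using res_peel[OF P u, of s] by simp
  qed
  then have "[dot m (F t) ?c = dot m (F t) (res P (A - {u}))] (mod int p)"
    by (rule functional_cong[OF functional_dot])
  moreover have "int p dvd dot m (F t) (res P (A - {u}))"
  proof (rule functional_dvd_res[OF functional_dot P])
    fix e assume "e \<in> complete_edges m" "e \<subseteq> A - {u}"
    then have "wt e \<in> generators (A - {u})" by (auto simp: generators_def)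
    from betweenD(1)[OF F this] t show "int p dvd dot m (F t) (wt e)" by (simp add: killed_def)
  qed
  ultimately show "int p dvd dot m (F t) ?c" by (simp add: cong_dvd_iff)
qed

text \<open>Coordinate \<open>i\<close> vanishes on the edges avoiding \<open>v i\<close>, hence by
  the upper bound in \<open>between\<close> on every killed vector. So all killed candidates have
  the same difference of leading entries.\<close>

lemma killed_candidate_unique:
  assumes i: "i \<in> {1..m}" and A: "A \<subseteq> v ` {i..m}"
    and wrap: "\<And>j. v j \<in> A \<Longrightarrow> i < j \<Longrightarrow> j \<le> m \<Longrightarrow> 2 * What {v i, v j} i < int p"
    and F: "between (int p) m G (generators (A - {v i})) F"
    and mem: "a \<in> A" "b \<in> A" "a' \<in> A" "b' \<in> A" "v i \<in> A"
    and u: "a = b \<Longrightarrow> a = v i" "a' = b' \<Longrightarrow> a' = v i"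
    and k: "killed (int p) m F (candidate r (v i) a b)" "killed (int p) m F (candidate r (v i) a' b')"
  shows "a = a' \<and> b = b'"
proof (rule leading_difference_unique[OF i A wrap mem(1-4) u])
  have lt: "x < m" if "x \<in> A" for x using that A i v_less by fastforce
  have gen: "int p dvd phi i g" if "g \<in> generators (A - {v i})" for g
    using that What_later[OF i A] by (auto simp: generators_def phi_wt)
  have *: "[phi i r - leading i x + leading i y = 0] (mod int p)"
    if "killed (int p) m F (candidate r (v i) x y)" "x \<in> A" "y \<in> A" for x y
  proof -
    have "int p dvd phi i (candidate r (v i) x y)"
      by (rule betweenD(2)[OF F functional_phi[OF i] gen that(1)])
    then have "[phi i (candidate r (v i) x y) = 0] (mod int p)" by (simp add: cong_0_iff)
    then have "[0 = phi i (candidate r (v i) x y)] (mod int p)" by (rule cong_sym)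
    also have "[phi i (candidate r (v i) x y) =
        phi i r - phi i (star_vec (v i) x) + phi i (star_vec (v i) y)] (mod int p)"
      unfolding candidate_def[abs_def] by (rule phi_lin3[OF i])
    also have "[phi i r - phi i (star_vec (v i) x) + phi i (star_vec (v i) y) = phi i r - leading i x + leading i y] (mod int p)"
      using that mem lt by (intro cong_add cong_diff phi_star_vec i) auto
    finally show ?thesis by (rule cong_sym)
  qed
  have "[(phi i r - leading i a' + leading i b') -
     (phi i r - leading i a + leading i b) = 0 - 0] (mod int p)"
    using *[OF k(1)] *[OF k(2)] mem by (intro cong_diff) auto
  then show "[leading i a - leading i b =
      leading i a' - leading i b'] (mod int p)"
    by (simp add: cong_iff_dvd_diff algebra_simps)
qed

text \<open>The vertex of least secret index in \<open>A\<close> works: the others come later, and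
  \<open>no_wrap_before_last\<close> applies because \<open>v m\<close> is gone. The program cannot
  identify this vertex; its existence is enough.\<close>

lemma decodable_vertex:
  assumes A: "A \<subseteq> {..<m}" "A \<noteq> {}" "v m \<notin> A"
  obtains i where "i \<in> {1..m}" "v i \<in> A" "A \<subseteq> v ` {i..m}"
    "\<And>j. v j \<in> A \<Longrightarrow> i < j \<Longrightarrow> j \<le> m \<Longrightarrow> 2 * What {v i, v j} i < int p"
proof -
  define I where "I = {i \<in> {1..m}. v i \<in> A}"
  have im: "v ` {1..m} = {..<m}" using numbering by (simp add: bij_betw_def)
  have "A \<subseteq> v ` {1..m}" unfolding im by (rule A(1))
  then have AI: "A = v ` I" unfolding I_def by blast
  have ne: "I \<noteq> {}" "finite I" using AI A(2) by (auto simp: I_def)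
  define i where "i = Min I"
  have i: "i \<in> I" "\<And>j. j \<in> I \<Longrightarrow> i \<le> j" using ne by (auto simp: i_def)
  show ?thesis
  proof (rule that[of i])
    show "i \<in> {1..m}" "v i \<in> A" using i by (auto simp: I_def)
    show "A \<subseteq> v ` {i..m}" unfolding AI using i by (auto simp: I_def)
    show "2 * What {v i, v j} i < int p" if "v j \<in> A" "i < j" "j \<le> m" for j
    proof -
      have "j \<noteq> m" using that A by auto
      then show ?thesis using no_wrap_before_last[of i j] that i by (auto simp: I_def)
    qed
  qed
qed

end

section \<open>The attack\<close>

abbreviation add_expr (infixl \<open>+.\<close> 65) where "a +. b \<equiv> Op Add a b"
abbreviation sub_expr (infixl \<open>-.\<close> 65) where "a -. b \<equiv> Op Sub a b"
abbreviation mul_expr (infixl \<open>*.\<close> 70) where "a *. b \<equiv> Op Mul a b"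
abbreviation mod_expr (infixl \<open>%.\<close> 70) where "a %. b \<equiv> Op Mod a b"
abbreviation less_expr (infix \<open><.\<close> 50) where "a <. b \<equiv> Op Less a b"
abbreviation eq_expr (infix \<open>=.\<close> 50) where "a =. b \<equiv> Op Equal a b"
abbreviation not_expr (\<open>!. _\<close> [80] 80) where "!. a \<equiv> Op Equal a (Num 0)"

abbreviation "nE \<equiv> At ''in'' (Num 0)"
abbreviation "pE \<equiv> At ''in'' (Num 2)"

text \<open>The offset 6 counts 4 header words and the 2 end points that open a record; a record has
  \<open>m + 2\<close> words, and the edge with ends \<open>u < v\<close> is number
  \<open>v * (v - 1) div 2 + u\<close>.\<close>

definition entry_expr :: "expr \<Rightarrow> expr \<Rightarrow> expr \<Rightarrow> expr" where
  "entry_expr u v t =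
     At ''in'' (Num 6 +. (nE +. Num 2) *. (Op Div (v *. (v -. Num 1)) (Num 2) +. u) +. t)"

text \<open>Both orders of the end points are added, each multiplied by its comparison. At
  \<open>u = v\<close> the result is 0, in agreement with \<open>star_val\<close>. The entry read
  for the wrong order may be meaningless but is multiplied by 0.\<close>

definition weight_expr :: "expr \<Rightarrow> expr \<Rightarrow> expr \<Rightarrow> expr" where
  "weight_expr u v t = (u <. v) *. entry_expr u v t +. (v <. u) *. entry_expr v u t"

definition cipher_expr :: "expr \<Rightarrow> expr" where
  "cipher_expr t = At ''in'' (Num 4 +. (nE +. Num 2) *. At ''in'' (Num 1) +. t)"

text \<open>
  The vertex being peeled off and its two partners; equality with the vertex means no edge.
\<close>

abbreviation "selected \<equiv> At ''x'' (Num 0)"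
abbreviation "plus_choice \<equiv> At ''x'' (Num 1)"
abbreviation "minus_choice \<equiv> At ''x'' (Num 2)"

text \<open>An edge is recorded at both ends. A choice equal to the selected vertex means that no
  edge of this sign remains, and a partner recorded earlier must then be kept.\<close>

definition link :: "string \<Rightarrow> expr \<Rightarrow> prog" where
  "link a e = When (!. (e =. selected)) (Put a selected e ;; Put a e selected)"

text \<open>The factor \<open>p - 1\<close> plays the part of \<open>- 1\<close>, since machine
  numbers are natural. The argument is the loop depth: the code is used at depth 3 for the guess and
  at depth 5 for decoding.\<close>

definition peel :: "nat \<Rightarrow> prog" where
  "peel d =
     For (Put ''r'' (Var d) ((At ''r'' (Var d) +. (pE -. Num 1) *. weight_expr selected plus_choice (Var d)
       +. weight_expr selected minus_choice (Var d)) %. pE)) ;;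
     link ''plus'' plus_choice ;; link ''minus'' minus_choice ;; Put ''alive'' selected (Num 0)"

text \<open>If row \<open>Var 7\<close> does not vanish on the edge, eliminating with it makes all rows vanish on the edge,
  so the later pivots have no effect.\<close>

definition annihilate_pivot :: prog where
  "annihilate_pivot =
     For (Put ''b'' (Var 8) (SumE (At ''F'' (Var 8 *. nE +. Var 9) *.
       weight_expr (Var 5) (Var 6) (Var 9)) %. pE)) ;;
     When (At ''b'' (Var 7))
       (For (Put ''G'' (Var 8) (At ''F'' (Var 7 *. nE +. Var 8))) ;;
        For (For (Put ''F'' (Var 8 *. nE +. Var 9)
          ((At ''b'' (Var 7) *. At ''F'' (Var 8 *. nE +. Var 9) +.
            (pE -. Num 1) *. At ''b'' (Var 8) *. At ''G'' (Var 9)) %. pE))))"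

definition annihilate_edge :: prog where "annihilate_edge = For annihilate_pivot"

text \<open>The matrix is rebuilt from the identity for each selected vertex, because the span to be
  tested consists of the edges avoiding that vertex.\<close>

definition annihilate :: prog where
  "annihilate =
     For (For (Put ''F'' (Var 5 *. nE +. Var 6) (Var 5 =. Var 6))) ;;
     For (For (When (At ''alive'' (Var 5) *. At ''alive'' (Var 6) *. (Var 5 <. Var 6) *.
       !. (Var 5 =. selected) *. !. (Var 6 =. selected)) annihilate_edge))"

text \<open>The third factor rejects equal partners other than the selected vertex, whose
  contributions would cancel. Double negation turns each nonzero row value into 1, so the sum counts
  the rows that do not kill the candidate.\<close>

definition match_expr :: expr where
  "match_expr = At ''alive'' (Var 5) *. At ''alive'' (Var 6) *.
     !. ((Var 5 =. Var 6) *. !. (Var 5 =. selected)) *.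
     !. (SumE (!. (!. (SumE (At ''F'' (Var 7 *. nE +. Var 8) *.
       (At ''r'' (Var 8) +. (pE -. Num 1) *. weight_expr selected (Var 5) (Var 8)
         +. weight_expr selected (Var 6) (Var 8))) %. pE))))"

text \<open>If exactly one pair matches, the weighted sums over all pairs return its components. The
  second sum is still correct after cell 1 of \<open>''x''\<close> has changed, because the test
  reads only cell 0.\<close>

definition decode_vertex :: prog where
  "decode_vertex = When (At ''alive'' (Var 4))
     (Put ''x'' (Num 0) (Var 4) ;; annihilate ;;
      When (SumE (SumE match_expr) =. Num 1)
        (Put ''x'' (Num 1) (SumE (SumE (Var 5 *. match_expr))) ;;
         Put ''x'' (Num 2) (SumE (SumE (Var 6 *. match_expr))) ;; peel 5))"

text \<open>\<open>Var 0\<close>, \<open>Var 1\<close> and \<open>Var 2\<close> are the guesses for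
  \<open>v m\<close> and its two partners. The guessed edges are removed by the same code as decoded
  ones.\<close>

definition start :: prog where
  "start =
     For (Put ''r'' (Var 3) (cipher_expr (Var 3))) ;; For (Put ''alive'' (Var 3) (Num 1)) ;;
     For (Put ''plus'' (Var 3) (Var 3)) ;; For (Put ''minus'' (Var 3) (Var 3)) ;;
     Put ''x'' (Num 0) (Var 0) ;; Put ''x'' (Num 1) (Var 1) ;; Put ''x'' (Num 2) (Var 2) ;; peel 3"

text \<open>Positive edges are followed at even steps, negative ones at odd steps. The trace always
  runs \<open>n\<close> steps; what lies beyond the end of the message is harmless because every
  length is tried separately.\<close>

definition trace :: prog where
  "trace = Put ''w'' (Num 0) (Var 3) ;;
     For (Put ''w'' (Var 4 +. Num 1)
       (!. (Var 4 %. Num 2) *. At ''plus'' (At ''w'' (Var 4)) +. (Var 4 %. Num 2) *. At ''minus'' (At ''w'' (Var 4))))"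

text \<open>The candidate walk has \<open>Var 4 + 1\<close> edges.\<close>

definition valid_expr :: expr where
  "valid_expr =
     !. (SumE ((Var 5 <. Var 4 +. Num 1) *. !. (At ''w'' (Var 5 +. Num 1) <. nE))) *.
     !. (SumE (SumE ((Var 5 <. Var 6 +. Num 1) *. (Var 6 <. Var 4 +. Num 1) *.
       (At ''w'' (Var 5) =. At ''w'' (Var 6 +. Num 1)) *.
       !. (!. (Var 5) *. (Var 6 =. Var 4) *. (Var 4 %. Num 2) *. (Num 1 <. Var 4))))) *.
     !. (SumE (!. (SumE ((Var 6 <. Var 4 +. Num 1) *. (!. (Var 6 %. Num 2) +. (Var 6 %. Num 2) *. (pE -. Num 1)) *.
       weight_expr (At ''w'' (Var 6)) (At ''w'' (Var 6 +. Num 1)) (Var 5)) %. pE =. cipher_expr (Var 5))))"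

text \<open>The loop fills \<open>n\<close> edge slots. Those beyond the announced number of edges
  may hold meaningless values, which \<open>output_edges\<close> ignores.\<close>

definition write_output :: prog where
  "write_output = Put ''found'' (Num 0) (Num 1) ;; Put ''out'' (Num 0) (Var 4 +. Num 1) ;;
     For (Put ''out'' (Num 2 *. Var 5 +. Num 1) (At ''w'' (Var 5)) ;;
          Put ''out'' (Num 2 *. Var 5 +. Num 2) (At ''w'' (Var 5 +. Num 1)))"

text \<open>\<open>Var 3\<close> is the first vertex of the walk and \<open>Var 4\<close> its length
  minus one. Decoding runs \<open>n\<close> rounds over all vertices because a round is only
  guaranteed to remove one of them. The flag \<open>''found''\<close> protects a verified output
  from being overwritten.\<close>

definition attack_prog :: prog where
  "attack_prog = For (For (For (start ;; For (For decode_vertex) ;;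
     For (trace ;; For (When (!. (At ''found'' (Num 0)) *. valid_expr) write_output)))))"

section \<open>Scoping, and the effect of loops that fill an array\<close>

lemma wf_weight_expr: "wf_expr d u \<Longrightarrow> wf_expr d v \<Longrightarrow> wf_expr d t \<Longrightarrow> wf_expr d (weight_expr u v t)"
  by (simp add: weight_expr_def entry_expr_def)

lemma wf_attack_prog: "wf_prog 0 attack_prog"
proof -
  have "wf_prog 3 (peel 3)" "wf_prog 5 (peel 5)"
    by (simp_all add: peel_def link_def wf_weight_expr)
  moreover have "wf_prog 7 annihilate_edge" by (simp add: annihilate_edge_def annihilate_pivot_def wf_weight_expr)
  moreover have "wf_expr 7 match_expr" by (simp add: match_expr_def wf_weight_expr)
  moreover have "wf_expr 5 valid_expr" by (simp add: valid_expr_def wf_weight_expr cipher_expr_def)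
  ultimately show ?thesis
    by (simp add: attack_prog_def start_def decode_vertex_def trace_def write_output_def annihilate_def
      cipher_expr_def numeral_eq_Suc)
qed

text \<open>The loop acts like a simultaneous update: iteration \<open>i\<close> finds its own cell
  and all other arrays in their original state.\<close>

lemma run_For_Put:
  assumes h: "\<And>i s'. i < s ''in'' 0 \<Longrightarrow> (\<And>b. b \<noteq> a \<Longrightarrow> s' b = s b) \<Longrightarrow> s' a i = s a i \<Longrightarrow> ev e (r @ [i]) s' = h i"
    and a: "a \<noteq> ''in''" and d: "length r = d"
  shows "run (For (Put a (Var d) e)) r s = s(a := \<lambda>i. if i < s ''in'' 0 then h i mod cap s else s a i)"
proof -
  let ?S = "\<lambda>k. s(a := \<lambda>i. if i < k then h i mod cap s else s a i)"
  have "run (For (Put a (Var d) e)) r s = ?S (s ''in'' 0)"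
    unfolding run.simps(4)
  proof (rule fold_inv[where I = "\<lambda>k s'. s' = ?S k"])
    fix i s' assume i: "i < s ''in'' 0" and s': "s' = ?S i"
    have "ev e (r @ [i]) s' = h i" by (rule h[OF i]) (simp_all add: s')
    moreover have "cap s' = cap s" using a by (simp add: s' cap_def)
    ultimately have "run (Put a (Var d) e) (r @ [i]) s' = mem_update s' a i (h i mod cap s)"
      using d by (simp add: nth_append)
    also have "\<dots> = ?S (Suc i)" by (auto simp: s' mem_update_def fun_eq_iff less_Suc_eq)
    finally show "run (Put a (Var d) e) (r @ [i]) s' = ?S (Suc i)" .
  qed simp
  then show ?thesis .
qed

lemma run_For_For_Put:
  assumes h: "\<And>t j s'. t < s ''in'' 0 \<Longrightarrow> j < s ''in'' 0 \<Longrightarrow> (\<And>b. b \<noteq> a \<Longrightarrow> s' b = s b) \<Longrightarrow>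
      s' a (t * s ''in'' 0 + j) = s a (t * s ''in'' 0 + j) \<Longrightarrow> ev e (r @ [t, j]) s' = h t j"
    and a: "a \<noteq> ''in''" and d: "length r = d" and d': "d' = Suc d" and t: "t < s ''in'' 0" and j: "j < s ''in'' 0"
  shows "run (For (For (Put a (Var d *. nE +. Var d') e))) r s a (t * s ''in'' 0 + j) = h t j mod cap s"
proof -
  define n where "n = s ''in'' 0"
  \<comment> \<open>The matrix is filled in row-major order, so the rewritten cells always form an
    initial segment of the array; \<open>k\<close> is its length.\<close>
  let ?S = "\<lambda>k. s(a := \<lambda>i. if i < k then h (i div n) (i mod n) mod cap s else s a i)"
  let ?P = "Put a (Var d *. nE +. Var d') e"
  have "run (For (For ?P)) r s = ?S (n * n)"
    unfolding run.simps(4)[of "For ?P"] n_def[symmetric]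
  proof (rule fold_inv[where I = "\<lambda>k s'. s' = ?S (k * n)"])
    fix t s1 assume t: "t < n" and s1: "s1 = ?S (t * n)"
    have n1: "s1 ''in'' 0 = n" using a by (simp add: s1 n_def)
    have "run (For ?P) (r @ [t]) s1 = ?S (t * n + n)"
      unfolding run.simps(4) n1
    proof (rule fold_inv[where I = "\<lambda>k s'. s' = ?S (t * n + k)"])
      fix j s' assume j: "j < n" and s': "s' = ?S (t * n + j)"
      have "ev e (r @ [t, j]) s' = h t j"
        using t j by (intro h) (simp_all add: s' n_def)
      moreover have "cap s' = cap s" "s' ''in'' 0 = n" using a by (simp_all add: s' cap_def n_def)
      ultimately have "run ?P ((r @ [t]) @ [j]) s' = mem_update s' a (t * n + j) (h t j mod cap s)"
        using d d' by (simp add: nth_append)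
      also have "\<dots> = ?S (t * n + Suc j)"
        using j by (auto simp: s' mem_update_def fun_eq_iff less_Suc_eq)
      finally show "run ?P ((r @ [t]) @ [j]) s' = ?S (t * n + Suc j)" .
    qed (simp add: s1)
    then show "run (For ?P) (r @ [t]) s1 = ?S (Suc t * n)" by (simp add: add.commute)
  qed simp
  moreover have "t * n + j < n * n"
  proof -
    have "t * n + j < t * n + n" using j by (simp add: n_def)
    also have "\<dots> = Suc t * n" by simp
    also have "\<dots> \<le> n * n" using t unfolding n_def by (intro mult_le_mono1) simp
    finally show ?thesis .
  qed
  ultimately show ?thesis using j by (simp add: n_def)
qed

section \<open>Layout of the input\<close>

lemma nth_concat_same_length:
  assumes "\<And>x. x \<in> set xs \<Longrightarrow> length (f x) = c" "i < length xs" "j < c"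
  shows "concat (map f xs) ! (c * i + j) = f (xs ! i) ! j"
  using assms
proof (induction xs arbitrary: i)
  case (Cons x xs)
  show ?case
  proof (cases i)
    case 0
    with Cons.prems show ?thesis by (simp add: nth_append)
  next
    case (Suc k)
    have "c * i + j = length (f x) + (c * k + j)" using Cons.prems(1) Suc by simp
    then have "concat (map f (x # xs)) ! (c * i + j) = concat (map f xs) ! (c * k + j)"
      by (simp add: nth_append)
    also have "\<dots> = f (xs ! k) ! j" using Cons.prems Suc by (intro Cons.IH) auto
    finally show ?thesis using Suc by simp
  qed
qed simp

definition complete_edge_list :: "nat \<Rightarrow> (nat \<times> nat) list" where
  "complete_edge_list n = concat (map (\<lambda>v. map (\<lambda>u. (u, v)) [0..<v]) [0..<n])"

lemma complete_edge_list_Suc: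
  "complete_edge_list (Suc n) = complete_edge_list n @ map (\<lambda>u. (u, n)) [0..<n]"
  by (simp add: complete_edge_list_def)

lemma even_triangle: "even (n * (n - 1 :: nat))"
  by (cases n) auto

lemma triangle_Suc: "Suc n * (Suc n - 1) div 2 = n * (n - 1) div 2 + (n :: nat)"
proof -
  have "Suc n * (Suc n - 1) = n * (n - 1) + n * 2" by (cases n) (auto simp: algebra_simps)
  then show ?thesis using even_triangle[of n] by simp
qed

lemma length_complete_edge_list: "length (complete_edge_list n) = n * (n - 1) div 2"
proof (induction n)
  case (Suc n)
  then show ?case unfolding complete_edge_list_Suc triangle_Suc by simp
qed (simp add: complete_edge_list_def)

text \<open>Edges are listed by larger end point, and \<open>v * (v - 1) div 2\<close> of them have
  their larger end point below \<open>v\<close>.\<close>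

lemma nth_complete_edge_list:
  "u < v \<Longrightarrow> v < n \<Longrightarrow> complete_edge_list n ! (v * (v - 1) div 2 + u) = (u, v)"
proof (induction n)
  case (Suc n)
  show ?case
  proof (cases "v = n")
    case True
    with Suc.prems show ?thesis
      by (simp add: complete_edge_list_Suc nth_append length_complete_edge_list)
  next
    case False
    then have "v < n" using Suc.prems by simp
    have "v * (v - 1) div 2 + u < Suc v * (Suc v - 1) div 2" unfolding triangle_Suc using Suc.prems by simp
    also have "\<dots> \<le> n * (n - 1) div 2" using \<open>v < n\<close> by (intro div_le_mono mult_le_mono) auto
    finally show ?thesis using Suc \<open>v < n\<close>
      by (simp add: complete_edge_list_Suc nth_append length_complete_edge_list)
  qed
qed simp

lemma edge_list_complete:
  assumes "edges pk = complete_edges (nverts pk)"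
  shows "edge_list pk = complete_edge_list (nverts pk)"
proof -
  have "concat (map (\<lambda>u. if {u, v} \<in> edges pk then [(u, v)] else []) [0..<v]) = map (\<lambda>u. (u, v)) [0..<v]"
    if "v < nverts pk" for v
  proof -
    have *: "concat (map (\<lambda>u. if {u, v} \<in> edges pk then [(u, v)] else []) xs) = map (\<lambda>u. (u, v)) xs"
      if "set xs \<subseteq> {..<v}" for xs
      using that \<open>v < nverts pk\<close> by (induction xs) (auto simp: assms complete_edges_iff)
    have "set [0..<v] \<subseteq> {..<v}" by auto
    then show ?thesis by (rule *)
  qed
  then show ?thesis unfolding edge_list_def complete_edge_list_def
    by (intro arg_cong[where f = concat] map_cong) auto
qed

lemma nth_append_four: "([a, b, c, d] @ xs) ! (4 + k) = xs ! k"
  by (simp add: numeral_eq_Suc)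

locale attacked_message = zero_noise_key +
  fixes P :: "nat set list"
  assumes msg: "message (complete_edges m) P"
begin

lemma alt: "alternating m P"
  by (rule message_alternating[OF msg])

definition cipher :: "nat \<Rightarrow> nat" where
  "cipher t = nat (res P {..<m} t mod int p)"

text \<open>Speaks about the read-only array \<open>''in''\<close> alone, so it survives every stage
  of the attack.\<close>

definition loaded :: "mem \<Rightarrow> bool" where
  "loaded s \<longleftrightarrow> s ''in'' 0 = m \<and> s ''in'' 1 = m * (m - 1) div 2 \<and> s ''in'' 2 = p \<and>
     (\<forall>u v t. u < v \<and> v < m \<and> t < m \<longrightarrow>
        s ''in'' (6 + (m + 2) * (v * (v - 1) div 2 + u) + t) = nat (wt {u, v} t)) \<and>
     (\<forall>t<m. s ''in'' (4 + (m + 2) * (m * (m - 1) div 2) + t) = cipher t)"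

lemma m_ge_2: "2 \<le> m"
proof -
  from msg obtain q where q: "walk m q (length P)" by (rule message_walk)
  then have "1 \<le> length P" "\<forall>i\<le>length P. q i < m" unfolding walk_def by blast+
  moreover have "q 0 \<noteq> q (Suc 0)" using calculation(1) by (intro walk_nth_neq[OF q]) linarith
  ultimately have "q 0 \<noteq> q (Suc 0)" "q 0 < m" "q (Suc 0) < m" by auto
  then show ?thesis by linarith
qed

lemma loadedD:
  assumes "loaded s"
  shows "s ''in'' 0 = m" "s ''in'' (Suc 0) = m * (m - 1) div 2" "s ''in'' 2 = p" "cap s = p + m + 1"
  using assms by (simp_all add: loaded_def cap_def)

abbreviation "input \<equiv> attack_input pk (encrypt pk P)"

lemma length_encode_key: "length (encode_key pk) = 4 + (m + 2) * (m * (m - 1) div 2)"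
proof -
  have "sum_list (map (\<lambda>x. length (case x of (u, v) \<Rightarrow> u # v # encode_vector m (weight pk {u, v}))) xs) =
      (m + 2) * length xs" for xs :: "(nat \<times> nat) list"
    by (induction xs) (auto simp: encode_vector_def)
  then show ?thesis
    unfolding encode_key_def
    by (simp add: length_concat o_def dim edge_list_complete[OF edges] length_complete_edge_list)
qed

lemma encode_key_nth:
  assumes "x < y" "y < m" "t < m"
  shows "6 + (m + 2) * (y * (y - 1) div 2 + x) + t < length (encode_key pk)"
    and "encode_key pk ! (6 + (m + 2) * (y * (y - 1) div 2 + x) + t) = nat (wt {x, y} t)"
proof -
  let ?i = "y * (y - 1) div 2 + x"
  let ?f = "\<lambda>(x, y). x # y # encode_vector m (weight pk {x, y})"
  have "?i < Suc y * (Suc y - 1) div 2" unfolding triangle_Suc using assms by simp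
  also have "\<dots> \<le> m * (m - 1) div 2" using assms by (intro div_le_mono mult_le_mono) auto
  finally have i: "?i < m * (m - 1) div 2" .
  then have "(m + 2) * Suc ?i \<le> (m + 2) * (m * (m - 1) div 2)" by (intro mult_le_mono) auto
  then have "(m + 2) * ?i + (m + 2) \<le> (m + 2) * (m * (m - 1) div 2)" by (simp only: mult_Suc_right add.commute)
  then show "6 + (m + 2) * ?i + t < length (encode_key pk)"
    unfolding length_encode_key using assms by linarith
  \<comment> \<open>The header has 4 words, and a record opens with its two end points, hence
    \<open>t + 2\<close>.\<close>
  have *: "6 + (m + 2) * ?i + t = 4 + ((m + 2) * ?i + (t + 2))" by simp
  have "encode_key pk ! (6 + (m + 2) * ?i + t) =
      concat (map ?f (complete_edge_list m)) ! ((m + 2) * ?i + (t + 2))"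
    unfolding * encode_key_def dim edge_list_complete[OF edges] by (rule nth_append_four)
  also have "\<dots> = ?f (complete_edge_list m ! ?i) ! (t + 2)"
    using i assms by (intro nth_concat_same_length) (auto simp: encode_vector_def length_complete_edge_list)
  also have "\<dots> = nat (wt {x, y} t)"
    using assms unfolding nth_complete_edge_list[OF assms(1,2)]
    by (simp add: encode_vector_def wt_def nth_append del: upt_Suc)
  finally show "encode_key pk ! (6 + (m + 2) * ?i + t) = nat (wt {x, y} t)" .
qed

lemma loaded_initial: "loaded (initial_mem input)"
proof -
  let ?s = "initial_mem input"
  have k: "?s ''in'' i = encode_key pk ! i" if "i < length (encode_key pk)" for i
    using that by (simp add: initial_mem_def attack_input_def nth_append)
  have "?s ''in'' 0 = m" "?s ''in'' 1 = m * (m - 1) div 2" "?s ''in'' 2 = p"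
    by (simp_all add: k length_encode_key)
      (simp_all add: encode_key_def edge_list_complete[OF edges] length_complete_edge_list)
  moreover have "?s ''in'' (4 + (m + 2) * (m * (m - 1) div 2) + t) = cipher t" if "t < m" for t
  proof -
    have "?s ''in'' (length (encode_key pk) + t) = encode_vector m (encrypt pk P) ! t"
      using that by (simp add: initial_mem_def attack_input_def dim encode_vector_def)
    also have "\<dots> = nat (encrypt pk P (Suc t))"
      using that by (simp add: encode_vector_def del: upt_Suc)
    also have "\<dots> = cipher t" using that by (simp add: encrypt_eq[OF alt] cipher_def)
    finally show ?thesis by (simp add: length_encode_key)
  qed
  moreover have "?s ''in'' (6 + (m + 2) * (y * (y - 1) div 2 + x) + t) = nat (wt {x, y} t)"
    if "x < y" "y < m" "t < m" for x y t
    using k[OF encode_key_nth(1)[OF that]] encode_key_nth(2)[OF that] by simp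
  ultimately show ?thesis unfolding loaded_def by blast
qed

lemma wt_bounds:
  assumes "e \<in> complete_edges m" "t < m" shows "0 \<le> wt e t" "wt e t < int p"
  using fp_spaceD[OF weights[OF assms(1)], of "Suc t"] assms(2) by (simp_all add: wt_def)

lemma ev_entry:
  assumes l: "loaded s" and t: "ev t r s < m" and uv: "ev u r s < ev w r s" "ev w r s < m"
  shows "int (ev (entry_expr u w t) r s) = wt {ev u r s, ev w r s} (ev t r s)"
proof -
  have "ev (entry_expr u w t) r s = nat (wt {ev u r s, ev w r s} (ev t r s))"
    using l t uv unfolding loaded_def entry_expr_def by simp
  then show ?thesis
    using wt_bounds(1)[of "{ev u r s, ev w r s}" "ev t r s"] t uv by (simp add: complete_edges_iff)
qed

lemma ev_weight:
  assumes l: "loaded s" and b: "ev u r s < m" "ev w r s < m" "ev t r s < m"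
  shows "int (ev (weight_expr u w t) r s) = star_vec (ev u r s) (ev w r s) (ev t r s)"
proof -
  consider "ev u r s < ev w r s" | "ev w r s < ev u r s" | "ev u r s = ev w r s" by linarith
  then show ?thesis
    by cases (use ev_entry[OF l b(3), of u w] ev_entry[OF l b(3), of w u] b in
      \<open>auto simp: weight_expr_def star_vec_def star_val_def insert_commute\<close>)
qed

lemma ev_cipher:
  assumes "loaded s" "ev t r s < m" shows "ev (cipher_expr t) r s = cipher (ev t r s)"
  using assms by (simp add: loaded_def cipher_expr_def)

lemma cipher_less: "cipher t < p"
  using p_pos by (simp add: cipher_def nat_less_iff)

section \<open>State of the decoding\<close>

definition alive :: "mem \<Rightarrow> nat set" where
  "alive s = {i. i < m \<and> s ''alive'' i \<noteq> 0}"

text \<open>Contents of the partner arrays while the vertices in \<open>A\<close> remain: an edge is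
  known as soon as one of its ends has been removed, and until then each end is its own entry. For
  empty \<open>A\<close> this is \<open>partner\<close>.\<close>

definition linked :: "nat set \<Rightarrow> bool \<Rightarrow> nat \<Rightarrow> nat" where
  "linked A b x = (if x \<in> A \<and> partner P b x \<in> A then x else partner P b x)"

text \<open>All edges peeled so far are correct. Entries of \<open>''alive''\<close> are at most 1
  so that they can be multiplied as truth values.\<close>

definition decoded :: "mem \<Rightarrow> bool" where
  "decoded s \<longleftrightarrow> loaded s \<and> (\<forall>i<m. s ''alive'' i \<le> 1) \<and>
     (\<forall>t<m. s ''r'' t = nat (res P (alive s) t mod int p)) \<and>
     (\<forall>x<m. s ''plus'' x = linked (alive s) True x \<and> s ''minus'' x = linked (alive s) False x)"

text \<open>Since partners are mutual, removing \<open>u\<close> affects only the entries of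
  \<open>u\<close> and of its partner inside \<open>A\<close>; this is why \<open>link\<close>
  writes two cells.\<close>

lemma linked_remove:
  assumes u: "u \<in> A" and x: "x \<noteq> u" "x \<noteq> restrict_partner A P b u"
  shows "linked (A - {u}) b x = linked A b x"
proof (cases "partner P b x = u")
  case True
  then have "partner P b u = x" using partner_partner[OF alt, of b x] by simp
  then have "x \<notin> A" using x by (auto simp: restrict_partner_def)
  then show ?thesis by (simp add: linked_def)
next
  case False
  then show ?thesis using x by (auto simp: linked_def)
qed

lemma linked_remove_self:
  "u \<in> A \<Longrightarrow> linked (A - {u}) b u = (if restrict_partner A P b u = u then linked A b u else restrict_partner A P b u)"
  by (auto simp: linked_def restrict_partner_def)

lemma linked_remove_partner:
  assumes "u \<in> A" "restrict_partner A P b u \<noteq> u"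
  shows "linked (A - {u}) b (restrict_partner A P b u) = u"
  using assms partner_partner[OF alt, of b u] by (auto simp: linked_def restrict_partner_def split: if_splits)

lemma run_link:
  assumes l: "loaded s" and u: "s ''x'' 0 = u" "u \<in> A" "A \<subseteq> {..<m}"
    and e: "e = At ''x'' (Num k)" "s ''x'' k = restrict_partner A P b u" and a: "a \<noteq> ''x''" "a \<noteq> ''in''"
    and s: "\<forall>x<m. s a x = linked A b x"
  shows "x < m \<Longrightarrow> run (link a e) r s a x = linked (A - {u}) b x"
proof -
  assume x: "x < m"
  have um: "u < m" "restrict_partner A P b u < m" using u restrict_partner_mem[OF u(2), of P b] by auto
  define s1 where "s1 = run (Put a selected e) r s"
  have s1: "s1 = mem_update s a u (restrict_partner A P b u)"
    using e u(1) um loadedD[OF l] by (simp add: s1_def)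
  have "loaded s1" using l a(2) by (simp add: s1 loaded_def)
  then have s2: "run (Put a e selected) r s1 = mem_update s1 a (restrict_partner A P b u) u"
    using e u(1) um a(1) loadedD[of s1] by (simp add: s1)
  show ?thesis
  proof (cases "restrict_partner A P b u = u")
    case True
    then have "run (link a e) r s = s" using e u(1) by (simp add: link_def)
    then show ?thesis
      using True s x linked_remove[OF u(2), of x b] linked_remove_self[OF u(2), of b] by (cases "x = u") auto
  next
    case False
    then have "run (link a e) r s = run (Put a e selected) r s1"
      using e u(1) by (simp add: link_def s1_def)
    also have "\<dots> = mem_update s1 a (restrict_partner A P b u) u" by (rule s2)
    finally have r: "run (link a e) r s = mem_update s1 a (restrict_partner A P b u) u" .
    show ?thesis
      unfolding r s1 using False x s linked_remove[OF u(2), of x b] linked_remove_self[OF u(2), of b]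
        linked_remove_partner[OF u(2) False] by simp
  qed
qed

lemma run_frames:
  "a \<noteq> ''r'' \<Longrightarrow> a \<noteq> ''plus'' \<Longrightarrow> a \<noteq> ''minus'' \<Longrightarrow> a \<noteq> ''alive'' \<Longrightarrow> run (peel d) r s a = s a"
  "a \<noteq> b \<Longrightarrow> run (link b e) r s a = s a"
  "a \<notin> {''F'', ''b'', ''G''} \<Longrightarrow> run annihilate r s a = s a"
  by (rule run_frame; simp add: peel_def link_def annihilate_def annihilate_edge_def annihilate_pivot_def)+

lemma nat_residue_sub_add:
  fixes a b c :: nat and k :: int
  assumes "int a = x mod int p" "int b = y" "int c = z"
  shows "(a + (p - 1) * b + c) mod p = nat ((x - y + z) mod int p)"
proof -
  have "int ((a + (p - 1) * b + c) mod p) = (x mod int p + (int p - 1) * y + z) mod int p"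
    using assms p_pos by (simp add: zmod_int of_nat_diff)
  also have "[x mod int p + (int p - 1) * y + z = x + (0 - 1) * y + z] (mod int p)"
    by (intro cong_add cong_mult cong_diff) (auto simp: cong_0_iff)
  then have "(x mod int p + (int p - 1) * y + z) mod int p = (x - y + z) mod int p"
    by (simp add: cong_def)
  finally show ?thesis by simp
qed

lemma peel_correct:
  assumes d: "decoded s" and u: "s ''x'' 0 = u" "u \<in> alive s"
    and a: "s ''x'' (Suc 0) = restrict_partner (alive s) P True u"
    and b: "s ''x'' 2 = restrict_partner (alive s) P False u" and r: "length r = d"
  shows "decoded (run (peel d) r s)" "alive (run (peel d) r s) = alive s - {u}"
proof -
  let ?A = "alive s"
  have l: "loaded s" using d by (simp add: decoded_def)
  have A: "?A \<subseteq> {..<m}" by (auto simp: alive_def)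
  have lt: "u < m" "restrict_partner ?A P True u < m" "restrict_partner ?A P False u < m"
    using A u(2) restrict_partner_mem[OF u(2), of P] by auto
  define h where "h t = nat (res P (?A - {u}) t mod int p)" for t
  let ?e = "(At ''r'' (Var d) +. (pE -. Num 1) *. weight_expr selected plus_choice (Var d)
       +. weight_expr selected minus_choice (Var d)) %. pE"
  define s1 where "s1 = run (For (Put ''r'' (Var d) ?e)) r s"
  have s1: "s1 = s(''r'' := \<lambda>i. if i < s ''in'' 0 then h i mod cap s else s ''r'' i)"
    unfolding s1_def
  proof (rule run_For_Put)
    fix i s' assume i: "i < s ''in'' 0" and s': "\<And>b. b \<noteq> ''r'' \<Longrightarrow> s' b = s b" "s' ''r'' i = s ''r'' i"
    have im: "i < m" using i loadedD[OF l] by simp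
    have l': "loaded s'" using l s'(1)[of "''in''"] by (simp add: loaded_def)
    have v: "ev (Var d) (r @ [i]) s' = i" using r by (simp add: nth_append)
    have x: "ev selected (r @ [i]) s' = u" "ev plus_choice (r @ [i]) s' = restrict_partner ?A P True u"
      "ev minus_choice (r @ [i]) s' = restrict_partner ?A P False u"
      using s'(1)[of "''x''"] u a b by simp_all
    have p': "ev pE (r @ [i]) s' = p" using loadedD[OF l'] by simp
    have w1: "int (ev (weight_expr selected plus_choice (Var d)) (r @ [i]) s') =
        star_vec u (restrict_partner ?A P True u) i"
      using ev_weight[OF l', of selected "r @ [i]" plus_choice "Var d"] lt im unfolding v x by simp
    have w2: "int (ev (weight_expr selected minus_choice (Var d)) (r @ [i]) s') =
        star_vec u (restrict_partner ?A P False u) i"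
      using ev_weight[OF l', of selected "r @ [i]" minus_choice "Var d"] lt im unfolding v x by simp
    have "int (s' ''r'' i) = res P ?A i mod int p"
      using d im s'(2) p_pos by (simp add: decoded_def)
    from nat_residue_sub_add[OF this w1 w2] show "ev ?e (r @ [i]) s' = h i"
      unfolding ev.simps(4) bin_val.simps v p' ev.simps(1) ev.simps(3)[of "''r''"]
      using res_peel[OF alt u(2), of i] by (simp add: h_def)
  qed (use r in simp_all)
  have hc: "h i mod cap s = h i" for i
  proof -
    have "h i < p" using p_pos by (simp add: h_def nat_less_iff)
    then show ?thesis using loadedD(4)[OF l] by simp
  qed
  have l1: "loaded s1" using l by (simp add: s1 loaded_def)
  have al1: "alive s1 = ?A" by (simp add: s1 alive_def)
  define s2 where "s2 = run (link ''plus'' plus_choice) r s1"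
  define s3 where "s3 = run (link ''minus'' minus_choice) r s2"
  have fr2: "s2 a = s1 a" if "a \<noteq> ''plus''" for a unfolding s2_def using that by (rule run_frames)
  have fr3: "s3 a = s2 a" if "a \<noteq> ''minus''" for a unfolding s3_def using that by (rule run_frames)
  have l2: "loaded s2" "loaded s3" using l1 fr2 fr3 by (simp_all add: loaded_def)
  have pl: "s2 ''plus'' x = linked (?A - {u}) True x" if "x < m" for x
    unfolding s2_def
    by (rule run_link[OF l1 _ u(2) A refl, where b = True])
      (use that u a d in \<open>simp_all add: s1 decoded_def\<close>)
  have mi: "s3 ''minus'' x = linked (?A - {u}) False x" if "x < m" for x
    unfolding s3_def
    by (rule run_link[OF l2(1) _ u(2) A refl, where b = False])
      (use that u b d fr2 in \<open>simp_all add: s1 decoded_def\<close>)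
  have "s3 ''x'' 0 = u" using fr3 fr2 u(1) by (simp add: s1)
  then have run: "run (peel d) r s = mem_update s3 ''alive'' u 0"
    unfolding peel_def run.simps(2) s1_def[symmetric] s2_def[symmetric] s3_def[symmetric] by simp
  have s3: "s3 ''alive'' = s ''alive''" "s3 ''r'' = (\<lambda>i. if i < m then h i else s ''r'' i)"
    using fr2[of "''alive''"] fr3[of "''alive''"] fr2[of "''r''"] fr3[of "''r''"] loadedD(1)[OF l]
    by (simp_all add: s1 hc cong: if_cong)
  show al: "alive (run (peel d) r s) = ?A - {u}"
    unfolding run alive_def by (auto simp: s3(1))
  show "decoded (run (peel d) r s)"
    unfolding decoded_def al unfolding run
  proof (intro conjI allI impI)
    show "loaded (mem_update s3 ''alive'' u 0)" using l2(2) by (simp add: loaded_def)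
    show "mem_update s3 ''alive'' u 0 ''alive'' x \<le> 1" if "x < m" for x
      using d that by (simp add: decoded_def s3(1))
    show "mem_update s3 ''alive'' u 0 ''r'' t = nat (res P (?A - {u}) t mod int p)" if "t < m" for t
      using that by (simp add: s3(2) h_def)
    show "mem_update s3 ''alive'' u 0 ''plus'' x = linked (?A - {u}) True x" if "x < m" for x
      using pl[OF that] fr3[of "''plus''"] by simp
    show "mem_update s3 ''alive'' u 0 ''minus'' x = linked (?A - {u}) False x" if "x < m" for x
      using mi[OF that] by simp
  qed
qed

end

section \<open>Correctness of decoding\<close>

lemma dot_cong_less: "(\<And>s. s < m \<Longrightarrow> f s = g s) \<Longrightarrow> dot m f x = dot m g x"
  by (simp add: dot_def)

lemma killed_cong_less:
  assumes "\<And>t s. t < m \<Longrightarrow> s < m \<Longrightarrow> F t s = F' t s"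
  shows "killed p m F x \<longleftrightarrow> killed p m F' x"
proof -
  have "dot m (F t) x = dot m (F' t) x" if "t < m" for t
    by (rule dot_cong_less) (rule assms[OF that])
  then show ?thesis by (simp add: killed_def)
qed

lemma between_cong_less:
  assumes "between p m G G' F" and "\<And>t s. t < m \<Longrightarrow> s < m \<Longrightarrow> F t s = F' t s"
  shows "between p m G G' F'"
proof -
  have "killed p m F x \<longleftrightarrow> killed p m F' x" for x by (rule killed_cong_less[OF assms(2)])
  with assms(1) show ?thesis by (simp add: between_def)
qed

lemma sum_indicator_unique:
  fixes f :: "nat \<Rightarrow> nat \<Rightarrow> nat"
  assumes "a < n" "b < n" and "\<And>x y. x < n \<Longrightarrow> y < n \<Longrightarrow> Q x y \<longleftrightarrow> x = a \<and> y = b"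
  shows "(\<Sum>x<n. \<Sum>y<n. f x y * (if Q x y then 1 else 0)) = f a b"
proof -
  have "(\<Sum>x<n. \<Sum>y<n. f x y * (if Q x y then 1 else 0)) = (\<Sum>x<n. \<Sum>y<n. if y = b then (if x = a then f a b else 0) else 0)"
    using assms(3) by (intro sum.cong refl) auto
  also have "\<dots> = f a b" using assms(1,2) by simp
  finally show ?thesis .
qed

text \<open>The double sum is the number of pairs satisfying \<open>Q\<close>, and two different
  pairs would make it at least 2.\<close>

lemma sum_indicator_eq_1:
  fixes n :: nat
  assumes one: "(\<Sum>x<n. \<Sum>y<n. if Q x y then 1 else 0) = (1 :: nat)"
    and Q: "Q a b" "a < n" "b < n" "Q x y" "x < n" "y < n"
  shows "x = a \<and> y = b"
proof (rule ccontr)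
  assume ne: "\<not> (x = a \<and> y = b)"
  let ?S = "{z \<in> {..<n} \<times> {..<n}. Q (fst z) (snd z)}"
  have "(\<Sum>x<n. \<Sum>y<n. if Q x y then 1 else 0) = (\<Sum>z\<in>{..<n} \<times> {..<n}. if Q (fst z) (snd z) then 1 else (0::nat))"
    by (simp add: sum.cartesian_product case_prod_unfold)
  also have "\<dots> = card ?S" by (simp add: sum.If_cases Int_def)
  finally have "card ?S = 1" using one by simp
  moreover have "{(a, b), (x, y)} \<subseteq> ?S" using Q by auto
  then have "card {(a, b), (x, y)} \<le> card ?S" by (intro card_mono) auto
  moreover have "card {(a, b), (x, y)} = 2" using ne by auto
  ultimately show False by simp
qed

lemma nat_mod_int: "int x = y \<Longrightarrow> x mod k = nat (y mod int k)"
  by (auto simp flip: zmod_int)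

context attacked_message begin

section \<open>Elimination carried out in memory\<close>

definition functionals :: "mem \<Rightarrow> nat \<Rightarrow> nat \<Rightarrow> nat" where
  "functionals s t j = s ''F'' (t * m + j)"

text \<open>Entries below \<open>p\<close> pass unchanged through the reduction modulo
  \<open>cap\<close>, in particular when the pivot row is copied.\<close>

definition small :: "mem \<Rightarrow> bool" where
  "small s \<longleftrightarrow> (\<forall>t<m. \<forall>j<m. functionals s t j < p)"

lemma mod_cap: "loaded s \<Longrightarrow> x < p \<Longrightarrow> x mod cap s = x"
  by (simp add: loadedD)

lemma ev_weight_eq:
  assumes "loaded s" "ev e1 r s = a" "ev e2 r s = b" "ev e3 r s = c" "a < m" "b < m" "c < m"
  shows "int (ev (weight_expr e1 e2 e3) r s) = star_vec a b c"
  using ev_weight[of s e1 r e2 e3] assms by simp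

lemma star_vec_edge: "x \<noteq> y \<Longrightarrow> star_vec x y = wt {x, y}"
  by (auto simp: star_vec_def star_val_def)

text \<open>The edge enters the lower bound \<open>G\<close> only after all pivots have been tried;
  until then progress is measured by the number of leading rows that vanish on it. If row
  \<open>i\<close> vanishes already, the matrix stays as it is.\<close>

lemma annihilate_edge_step:
  assumes l: "loaded s" and sm: "small s" and i: "i < m" and xy: "x < y" "y < m"
    and b: "between (int p) m G G' (functionals s)" and g: "wt {x, y} \<in> G'"
    and before: "\<And>t. t < i \<Longrightarrow> int p dvd dot m (functionals s t) (wt {x, y})"
    and r: "r = [r0, r1, r2, r3, r4, x, y]"
  defines "s' \<equiv> run annihilate_pivot (r @ [i]) s"
  shows "loaded s' \<and> small s' \<and> between (int p) m G G' (functionals s') \<and>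
    (\<forall>t<Suc i. int p dvd dot m (functionals s' t) (wt {x, y}))"
proof -
  let ?g = "wt {x, y}" and ?F = "functionals s"
  let ?Pb = "For (Put ''b'' (Var 8) (SumE (At ''F'' (Var 8 *. nE +. Var 9) *.
         weight_expr (Var 5) (Var 6) (Var 9)) %. pE))"
  let ?PG = "For (Put ''G'' (Var 8) (At ''F'' (Var 7 *. nE +. Var 8)))"
  let ?PF = "For (For (Put ''F'' (Var 8 *. nE +. Var 9)
            ((At ''b'' (Var 7) *. At ''F'' (Var 8 *. nE +. Var 9) +.
              (pE -. Num 1) *. At ''b'' (Var 8) *. At ''G'' (Var 9)) %. pE)))"
  define h where "h t = nat (dot m (?F t) ?g mod int p)" for t
  have hp: "h t < p" for t using p_pos by (simp add: h_def nat_less_iff)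
  define s1 where "s1 = run ?Pb (r @ [i]) s"
  have "s1 = s(''b'' := \<lambda>t. if t < s ''in'' 0 then h t mod cap s else s ''b'' t)"
    unfolding s1_def
  proof (rule run_For_Put)
    fix t st assume t: "t < s ''in'' 0" and st: "\<And>a. a \<noteq> ''b'' \<Longrightarrow> st a = s a"
    have tm: "t < m" using t loadedD[OF l] by simp
    have lt: "loaded st" using l st[of "''in''"] by (simp add: loaded_def)
    have w: "int (ev (weight_expr (Var 5) (Var 6) (Var 9)) (r @ [i, t, j]) st) = ?g j" if "j < m" for j
      using ev_weight_eq[OF lt, of "Var 5" "r @ [i, t, j]" x "Var 6" y "Var 9" j] that xy
      by (simp add: r star_vec_edge)
    have "int (\<Sum>j<m. st ''F'' (t * m + j) * ev (weight_expr (Var 5) (Var 6) (Var 9)) (r @ [i, t, j]) st) =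
        dot m (?F t) ?g"
      unfolding dot_def of_nat_sum of_nat_mult functionals_def using w st[of "''F''"] by (intro sum.cong) auto
    then have "(\<Sum>j<m. st ''F'' (t * m + j) * ev (weight_expr (Var 5) (Var 6) (Var 9)) (r @ [i, t, j]) st) mod p = h t"
      unfolding h_def by (rule nat_mod_int)
    then show "ev (SumE (At ''F'' (Var 8 *. nE +. Var 9) *.
         weight_expr (Var 5) (Var 6) (Var 9)) %. pE) ((r @ [i]) @ [t]) st = h t"
      using loadedD[OF lt] by (simp add: r)
  qed (simp_all add: r)
  then have s1: "s1 = s(''b'' := \<lambda>t. if t < m then h t else s ''b'' t)"
    using loadedD[OF l] mod_cap[OF l hp] by (simp cong: if_cong)
  have l1: "loaded s1" using l by (simp add: s1 loaded_def)
  have F1: "functionals s1 = ?F" by (simp add: s1 functionals_def fun_eq_iff)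
  show ?thesis
  proof (cases "h i = 0")
    case True
    then have "s' = s1" unfolding s'_def annihilate_pivot_def run.simps(2) s1_def[symmetric] using i by (simp add: r s1)
    moreover have "int p dvd dot m (?F i) ?g"
    proof -
      have "0 \<le> dot m (?F i) ?g mod int p" using p_pos by simp
      with True have "dot m (?F i) ?g mod int p = 0" by (simp add: h_def)
      then show ?thesis by presburger
    qed
    ultimately show ?thesis
      using l1 sm b before F1 by (auto simp: small_def less_Suc_eq)
  next
    case False
    \<comment> \<open>The pivot row is copied to \<open>''G''\<close> because the double loop works
      in place and turns that row into zeros.\<close>
    define s2 where "s2 = run ?PG (r @ [i]) s1"
    have "s2 = s1(''G'' := \<lambda>j. if j < s1 ''in'' 0 then ?F i j mod cap s1 else s1 ''G'' j)"
      unfolding s2_def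
    proof (rule run_For_Put)
      fix j st assume "\<And>a. a \<noteq> ''G'' \<Longrightarrow> st a = s1 a"
      then have "st ''F'' = s ''F''" "st ''in'' = s ''in''" by (simp_all add: s1)
      then show "ev (At ''F'' (Var 7 *. nE +. Var 8)) ((r @ [i]) @ [j]) st = ?F i j"
        using loadedD[OF l] by (simp add: r functionals_def)
    qed (simp_all add: r)
    then have s2: "s2 = s1(''G'' := \<lambda>j. if j < m then ?F i j else s1 ''G'' j)"
      using loadedD(1)[OF l1] mod_cap[OF l1] sm i by (simp add: small_def cong: if_cong)
    have l2: "loaded s2" using l1 by (simp add: s2 loaded_def)
    have "s1 ''b'' i \<noteq> 0" using False i by (simp add: s1)
    then have s': "s' = run ?PF (r @ [i]) s2"
      unfolding s'_def annihilate_pivot_def run.simps(2) s1_def[symmetric] s2_def by (simp add: r)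
    let ?E = "eliminate p m ?g i ?F"
    have E: "functionals s' t j = ?E t j" if tj: "t < m" "j < m" for t j
    proof -
      have "s' ''F'' (t * s2 ''in'' 0 + j) = ?E t j mod cap s2"
        unfolding s'
      proof (rule run_For_For_Put)
        fix t j st assume tj: "t < s2 ''in'' 0" "j < s2 ''in'' 0"
          and st: "\<And>b. b \<noteq> ''F'' \<Longrightarrow> st b = s2 b"
            "st ''F'' (t * s2 ''in'' 0 + j) = s2 ''F'' (t * s2 ''in'' 0 + j)"
        have "st ''in'' 0 = m" "st ''in'' 2 = p" "st ''b'' t = h t" "st ''b'' i = h i" "st ''G'' j = ?F i j"
          "st ''F'' (t * m + j) = ?F t j" "t < m" "j < m"
          using st(1)[of "''in''"] st(1)[of "''b''"] st(1)[of "''G''"] st(2) tj loadedD[OF l2] i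
          by (simp_all add: s2 s1 functionals_def)
        then show "ev ((At ''b'' (Var 7) *. At ''F'' (Var 8 *. nE +. Var 9) +.
              (pE -. Num 1) *. At ''b'' (Var 8) *. At ''G'' (Var 9)) %. pE) ((r @ [i]) @ [t, j]) st = ?E t j"
          by (simp add: r eliminate_def h_def)
      qed (use tj loadedD[OF l2] in \<open>simp_all add: r\<close>)
      moreover have "?E t j < p" using p_pos by (simp add: eliminate_def)
      ultimately show ?thesis using mod_cap[OF l2] loadedD[OF l2] by (simp add: functionals_def)
    qed
    have "loaded s'"
    proof -
      have "s' ''in'' = s2 ''in''" unfolding s' by (rule run_frame) simp
      then show ?thesis using l2 by (simp add: loaded_def)
    qed
    moreover have "small s'" using E p_pos by (simp add: small_def eliminate_def)
    moreover have "\<not> int p dvd dot m (?F i) ?g"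
      using False by (simp add: h_def dvd_eq_mod_eq_0)
    then have "between (int p) m G G' ?E" by (rule between_eliminate[OF prime_p b g i])
    then have "between (int p) m G G' (functionals s')"
      by (rule between_cong_less) (simp add: E)
    moreover have "killed (int p) m (functionals s') ?g"
      using eliminate_killed[OF p_pos, of m ?g i ?F] killed_cong_less[of m "functionals s'" ?E] E by blast
    then have "\<forall>t<Suc i. int p dvd dot m (functionals s' t) ?g" using i by (simp add: killed_def)
    ultimately show ?thesis by blast
  qed
qed

lemma annihilate_edge_correct:
  assumes l: "loaded s" and sm: "small s" and xy: "x < y" "y < m"
    and b: "between (int p) m G G' (functionals s)" and g: "wt {x, y} \<in> G'"
    and r: "r = [r0, r1, r2, r3, r4, x, y]"
  defines "s' \<equiv> run annihilate_edge r s"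
  shows "loaded s' \<and> small s' \<and> between (int p) m (insert (wt {x, y}) G) G' (functionals s')"
proof -
  let ?I = "\<lambda>i s. loaded s \<and> small s \<and> between (int p) m G G' (functionals s) \<and>
    (\<forall>t<i. int p dvd dot m (functionals s t) (wt {x, y}))"
  have "?I m s'"
    unfolding s'_def annihilate_edge_def run.simps(4) loadedD(1)[OF l]
  proof (rule fold_inv[where I = ?I])
    show "?I 0 s" using l sm b by simp
    fix i s assume "i < m" "?I i s"
    then show "?I (Suc i) (run annihilate_pivot (r @ [i]) s)"
      by (intro annihilate_edge_step[OF _ _ _ xy _ g _ r]) auto
  qed
  then show ?thesis using between_insert[of "int p" m G G' "functionals s'" "wt {x, y}"]
    by (simp add: killed_def)
qed


text \<open>The upper bound is the full set of generators from the start, while the lower bound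
  grows from the empty set edge by edge until the two coincide. At that point the rows cut out the
  span exactly.\<close>

lemma annihilate_correct:
  assumes l: "loaded s" and u: "s ''x'' 0 = u" and r: "r = [r0, r1, r2, r3, r4]"
  shows "between (int p) m (generators (alive s - {u})) (generators (alive s - {u}))
    (functionals (run annihilate r s))"
proof -
  let ?A = "alive s" and ?G = "generators (alive s - {u})"
  define C where "C x y \<longleftrightarrow> x \<in> ?A \<and> y \<in> ?A \<and> x < y \<and> x \<noteq> u \<and> y \<noteq> u" for x y
  \<comment> \<open>The weights of the relevant edges treated before the pair \<open>(i, j)\<close>
    in the lexicographic order of the two loops.\<close>
  define D where "D i j = {wt {x, y} |x y. C x y \<and> (x < i \<or> (x = i \<and> y < j))}" for i j
  have CD: "wt {x, y} \<in> ?G" if "C x y" for x y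
    using that unfolding C_def generators_def alive_def by (intro imageI) (auto simp: complete_edges_iff)
  define s1 where "s1 = run (For (For (Put ''F'' (Var 5 *. nE +. Var 6) (Var 5 =. Var 6)))) r s"
  have fr1: "s1 a = s a" if "a \<noteq> ''F''" for a unfolding s1_def by (rule run_frame) (simp add: that)
  have l1: "loaded s1" using l fr1 by (simp add: loaded_def)
  have F1: "functionals s1 t j = (if t = j then 1 else 0)" if tj: "t < m" "j < m" for t j
  proof -
    have "s1 ''F'' (t * s ''in'' 0 + j) = (if t = j then 1 else 0) mod cap s"
      unfolding s1_def
      by (rule run_For_For_Put) (use tj loadedD[OF l] in \<open>simp_all add: r\<close>)
    then show ?thesis using loadedD[OF l] mod_cap[OF l, of 1] p_pos by (simp add: functionals_def)
  qed
  define I where "I i j s' \<longleftrightarrow> loaded s' \<and> (\<forall>a. a \<notin> {''F'', ''b'', ''G''} \<longrightarrow> s' a = s a) \<and> small s' \<and>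
    between (int p) m (D i j) ?G (functionals s')" for i j s'
  have I0: "I 0 0 s1"
  proof -
    have "D 0 0 = {}" by (auto simp: D_def)
    moreover have "between (int p) m {} ?G (functionals s1)"
      by (rule between_cong_less[OF between_mono[OF between_identity]]) (auto simp: F1)
    moreover have "small s1" using F1 prime_gt_1_nat[OF prime_p] p_pos by (simp add: small_def)
    ultimately show ?thesis using l1 fr1 by (simp add: I_def)
  qed
  let ?c = "At ''alive'' (Var 5) *. At ''alive'' (Var 6) *. (Var 5 <. Var 6) *.
       !. (Var 5 =. selected) *. !. (Var 6 =. selected)"
  have inner: "I i (Suc j) (run (When ?c annihilate_edge) (r @ [i] @ [j]) s')"
    if ij: "i < m" "j < m" and I: "I i j s'" for i j s'
  proof -
    have same: "s' ''alive'' = s ''alive''" "s' ''x'' = s ''x''" using I by (simp_all add: I_def)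
    show ?thesis
    proof (cases "C i j")
      case True
      have "ev ?c (r @ [i] @ [j]) s' \<noteq> 0"
        using True same u unfolding C_def alive_def by (auto simp: r)
      then have run: "run (When ?c annihilate_edge) (r @ [i] @ [j]) s' = run annihilate_edge (r @ [i] @ [j]) s'"
        unfolding run.simps(3) by (rule if_P)
      have c1: "loaded (run annihilate_edge (r @ [i] @ [j]) s') \<and> small (run annihilate_edge (r @ [i] @ [j]) s') \<and>
        between (int p) m (insert (wt {i, j}) (D i j)) ?G (functionals (run annihilate_edge (r @ [i] @ [j]) s'))"
        using I ij True CD[OF True] by (intro annihilate_edge_correct) (auto simp: I_def r C_def)
      have c2: "insert (wt {i, j}) (D i j) = D i (Suc j)"
        using True by (auto simp: D_def less_Suc_eq)
      have c3: "\<forall>a. a \<notin> {''F'', ''b'', ''G''} \<longrightarrow> run annihilate_edge (r @ [i] @ [j]) s' a = s a"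
      proof (intro allI impI)
        fix a assume a: "a \<notin> {''F'', ''b'', ''G''}"
        have "run annihilate_edge (r @ [i] @ [j]) s' a = s' a"
          by (rule run_frame) (use a in \<open>simp add: annihilate_edge_def annihilate_pivot_def\<close>)
        also have "s' a = s a" using I a unfolding I_def by blast
        finally show "run annihilate_edge (r @ [i] @ [j]) s' a = s a" .
      qed
      from c1 have "loaded (run annihilate_edge (r @ [i] @ [j]) s')"
        "small (run annihilate_edge (r @ [i] @ [j]) s')"
        "between (int p) m (D i (Suc j)) ?G (functionals (run annihilate_edge (r @ [i] @ [j]) s'))"
        unfolding c2 by blast+
      with c3 have "I i (Suc j) (run annihilate_edge (r @ [i] @ [j]) s')"
        unfolding I_def by (intro conjI)
      then show ?thesis by (subst run)
    next
      case False
      have "ev ?c (r @ [i] @ [j]) s' = 0"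
        using False same u ij unfolding C_def alive_def by (auto simp: r)
      then have "run (When ?c annihilate_edge) (r @ [i] @ [j]) s' = s'" by simp
      moreover have D: "D i (Suc j) = D i j" using False by (auto simp: D_def less_Suc_eq)
      have "I i (Suc j) s'" using I unfolding I_def D .
      ultimately show ?thesis by (simp only:)
    qed
  qed
  have "I m 0 (run (For (For (When ?c annihilate_edge))) r s1)"
    unfolding run.simps(4)[of "For (When ?c annihilate_edge)"] loadedD(1)[OF l1]
  proof (rule fold_inv[where I = "\<lambda>i. I i 0"])
    fix i s' assume i: "i < m" "I i 0 s'"
    have "I i m (run (For (When ?c annihilate_edge)) (r @ [i]) s')"
      using i unfolding run.simps(4) loadedD(1)[OF conjunct1[OF i(2)[unfolded I_def]]]
      by (intro fold_inv[where I = "I i"]) (use inner in \<open>simp_all del: run.simps\<close>)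
    moreover have "D i m = D (Suc i) 0" by (auto simp: D_def C_def alive_def less_Suc_eq)
    ultimately show "I (Suc i) 0 (run (For (When ?c annihilate_edge)) (r @ [i]) s')" by (simp add: I_def)
  qed (rule I0)
  moreover have "run annihilate r s = run (For (For (When ?c annihilate_edge))) r s1"
    by (simp only: annihilate_def run.simps(2) s1_def)
  moreover have "D m 0 = ?G"
  proof
    show "D m 0 \<subseteq> ?G" using CD by (auto simp: D_def)
    show "?G \<subseteq> D m 0"
    proof
      fix g assume "g \<in> ?G"
      then obtain e where e: "g = wt e" "e \<in> complete_edges m" "e \<subseteq> ?A - {u}" by (auto simp: generators_def)
      then obtain x y where xy: "e = {x, y}" "x < y" "y < m" by (auto simp: complete_edges_def)
      with e(3) have "C x y \<and> (x < m \<or> (x = m \<and> y < 0))" by (auto simp: C_def)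
      with e(1) xy(1) show "g \<in> D m 0" unfolding D_def by blast
    qed
  qed
  ultimately show ?thesis by (simp add: I_def)
qed

section \<open>Testing and counting candidate pairs\<close>

definition matches :: "mem \<Rightarrow> nat \<Rightarrow> nat \<Rightarrow> nat \<Rightarrow> bool" where
  "matches s u x y \<longleftrightarrow> x \<in> alive s \<and> y \<in> alive s \<and> (x = y \<longrightarrow> x = u) \<and>
     killed (int p) m (functionals s) (candidate (\<lambda>t. int (s ''r'' t)) u x y)"

lemma ev_match:
  assumes l: "loaded s" and al: "\<forall>i<m. s ''alive'' i \<le> 1" and u: "s ''x'' 0 = u" "u < m"
    and xy: "x < m" "y < m" and r: "r = [r0, r1, r2, r3, r4, x, y]"
  shows "ev match_expr r s = (if matches s u x y then 1 else 0)"
proof -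
  let ?c = "candidate (\<lambda>t. int (s ''r'' t)) u x y"
  let ?row = "SumE (At ''F'' (Var 7 *. nE +. Var 8) *.
       (At ''r'' (Var 8) +. (pE -. Num 1) *. weight_expr selected (Var 5) (Var 8)
         +. weight_expr selected (Var 6) (Var 8))) %. pE"
  have row: "ev ?row (r @ [t]) s = 0 \<longleftrightarrow> int p dvd dot m (functionals s t) ?c" if t: "t < m" for t
  proof -
    let ?w = "\<lambda>e j. ev (weight_expr selected e (Var 8)) (r @ [t, j]) s"
    let ?S = "\<Sum>j<m. s ''F'' (t * m + j) * (s ''r'' j + (p - 1) * ?w (Var 5) j + ?w (Var 6) j)"
    have w: "int (?w (Var 5) j) = star_vec u x j" "int (?w (Var 6) j) = star_vec u y j" if "j < m" for j
      using ev_weight_eq[OF l, of selected "r @ [t, j]" u "Var 5" x "Var 8" j]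
        ev_weight_eq[OF l, of selected "r @ [t, j]" u "Var 6" y "Var 8" j] that xy u by (simp_all add: r)
    have "[int ?S = dot m (functionals s t) ?c] (mod int p)"
      unfolding dot_def of_nat_sum functionals_def of_nat_mult
    proof (intro cong_sum cong_mult cong_refl)
      fix j assume "j \<in> {..<m}"
      then have w: "int (?w (Var 5) j) = star_vec u x j" "int (?w (Var 6) j) = star_vec u y j" using w by auto
      have "[int (s ''r'' j) + (int p - 1) * star_vec u x j + star_vec u y j =
        int (s ''r'' j) + (0 - 1) * star_vec u x j + star_vec u y j] (mod int p)"
        by (intro cong_add cong_mult cong_diff) (auto simp: cong_0_iff)
      then show "[int (s ''r'' j + (p - 1) * ?w (Var 5) j + ?w (Var 6) j) = ?c j] (mod int p)"
        using p_pos by (simp add: w candidate_def of_nat_diff)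
    qed
    moreover have "ev ?row (r @ [t]) s = ?S mod p"
      using loadedD[OF l] by (simp add: r)
    moreover have "?S mod p = 0 \<longleftrightarrow> int p dvd int ?S"
      by (simp only: mod_eq_0_iff_dvd int_dvd_int_iff)
    ultimately show ?thesis by (simp only: cong_dvd_iff)
  qed
  have S: "ev (SumE (!. (!. ?row))) r s =
      (\<Sum>t<m. if int p dvd dot m (functionals s t) ?c then 0 else 1)"
    unfolding ev.simps(5) loadedD(1)[OF l]
  proof (rule sum.cong)
    fix t assume "t \<in> {..<m}"
    then have "ev ?row (r @ [t]) s = 0 \<longleftrightarrow> int p dvd dot m (functionals s t) ?c" by (intro row) simp
    then show "ev (!. (!. ?row)) (r @ [t]) s = (if int p dvd dot m (functionals s t) ?c then 0 else 1)"
      unfolding ev.simps(4)[of Equal] bin_val.simps ev.simps(1) by (simp only: split: if_split) simp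
  qed simp
  have "ev (SumE (!. (!. ?row))) r s = 0 \<longleftrightarrow> killed (int p) m (functionals s) ?c"
    unfolding S killed_def by auto
  moreover have "s ''alive'' x = (if x \<in> alive s then 1 else 0)" "s ''alive'' y = (if y \<in> alive s then 1 else 0)"
    using al xy le_antisym by (auto simp: alive_def le_Suc_eq)
  ultimately show ?thesis
    unfolding match_expr_def ev.simps(4)[of Equal "SumE (!. (!. ?row))"]
    using u by (simp add: r matches_def del: ev.simps(5))
qed

text \<open>The true pair always matches, so a count of one singles it out and peeling preserves
  \<open>decoded\<close>; with any other count the vertex stays. The last claim is the progress
  statement for vertices as provided by \<open>decodable_vertex\<close>.\<close>

lemma decode_vertex_correct:
  assumes d: "decoded s" and u: "u < m" and r: "r = [r0, r1, r2, r3, u]"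
  defines "s' \<equiv> run decode_vertex r s"
  shows "decoded s'" "alive s' \<subseteq> alive s"
    and "i \<in> {1..m} \<Longrightarrow> v i = u \<Longrightarrow> alive s \<subseteq> v ` {i..m} \<Longrightarrow>
      (\<And>j. v j \<in> alive s \<Longrightarrow> i < j \<Longrightarrow> j \<le> m \<Longrightarrow> 2 * What {v i, v j} i < int p) \<Longrightarrow> u \<notin> alive s'"
proof -
  have "decoded s' \<and> alive s' \<subseteq> alive s \<and> (i \<in> {1..m} \<longrightarrow> v i = u \<longrightarrow> alive s \<subseteq> v ` {i..m} \<longrightarrow>
      (\<forall>j. v j \<in> alive s \<longrightarrow> i < j \<longrightarrow> j \<le> m \<longrightarrow> 2 * What {v i, v j} i < int p) \<longrightarrow> u \<notin> alive s')"
  proof (cases "u \<in> alive s")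
    case False
    then have "s' = s" using u by (simp add: s'_def decode_vertex_def r alive_def)
    then show ?thesis using d False by simp
  next
    case True
    let ?A = "alive s" and ?G = "generators (alive s - {u})"
    let ?a = "restrict_partner ?A P True u" and ?b = "restrict_partner ?A P False u"
    have l: "loaded s" using d by (simp add: decoded_def)
    define s1 where "s1 = mem_update s ''x'' 0 u"
    define s2 where "s2 = run annihilate r s1"
    let ?cnt = "SumE (SumE match_expr) =. Num 1"
    let ?rest = "Put ''x'' (Num 1) (SumE (SumE (Var 5 *. match_expr))) ;;
         Put ''x'' (Num 2) (SumE (SumE (Var 6 *. match_expr))) ;; peel 5"
    have "u mod cap s = u" using u loadedD[OF l] by simp
    then have s1: "run (Put ''x'' (Num 0) (Var 4)) r s = s1" by (simp add: r s1_def)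
    have "ev (At ''alive'' (Var 4)) r s \<noteq> 0" using True by (simp add: r alive_def)
    then have s': "s' = run (When ?cnt ?rest) r s2"
      unfolding s'_def decode_vertex_def run.simps(3)[of "At ''alive'' (Var 4)"] run.simps(2) s1 s2_def
      by (simp only: not_False_eq_True if_True)
    have l1: "loaded s1" using l by (simp add: s1_def loaded_def)
    have fr2: "s2 a = s1 a" if "a \<notin> {''F'', ''b'', ''G''}" for a
      unfolding s2_def by (rule run_frames(3)[OF that])
    have l2: "loaded s2" using l1 fr2 by (simp add: loaded_def)
    have al: "alive s1 = ?A" "alive s2 = ?A" using fr2 by (simp_all add: alive_def s1_def)
    have d2: "decoded s2" using d fr2 l2 al by (simp add: decoded_def s1_def)
    have x2: "s2 ''x'' 0 = u" using fr2 by (simp add: s1_def)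
    have btw: "between (int p) m ?G ?G (functionals s2)"
      using annihilate_correct[OF l1 _ r, of u] unfolding s2_def al by (simp add: s1_def)
    have res: "[int (s2 ''r'' t) = res P ?A t] (mod int p)" if "t < m" for t
      using d2 al that p_pos by (simp add: decoded_def cong_def)
    have AB: "?a \<in> ?A" "?b \<in> ?A" using restrict_partner_mem[OF True] by blast+
    have Am: "?A \<subseteq> {..<m}" by (auto simp: alive_def)
    have ab: "?a < m" "?b < m" using AB Am by auto
    have true: "matches s2 u ?a ?b"
      unfolding matches_def al
      using AB restrict_partner_opposite[OF alt True] true_candidate_killed[OF alt True res btw] by blast
    have al1: "\<forall>i<m. s2 ''alive'' i \<le> 1" using d2 by (simp add: decoded_def)
    \<comment> \<open>Stated also for the memory in which cell 1 of \<open>''x''\<close> has been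
      overwritten, since the second partner is computed there.\<close>
    have match: "ev match_expr (r @ [x, y]) st = (if matches s2 u x y then 1 else 0)"
      if "x < m" "y < m" "st = s2 \<or> st = mem_update s2 ''x'' 1 z" for x y st z
    proof -
      have "loaded st" "\<forall>i<m. st ''alive'' i \<le> 1" "st ''x'' 0 = u"
        using that(3) l2 al1 x2 by (auto simp: loaded_def)
      moreover have "matches st u x y = matches s2 u x y"
        using that(3) by (auto simp: matches_def alive_def functionals_def[abs_def])
      ultimately show ?thesis using ev_match[of st u x y "r @ [x, y]"] that(1,2) u by (simp add: r)
    qed
    have cnt: "ev (SumE (SumE match_expr)) r s2 = (\<Sum>x<m. \<Sum>y<m. if matches s2 u x y then 1 else 0)"
      unfolding ev.simps(5) loadedD(1)[OF l2] by (intro sum.cong refl) (simp add: match)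
    show ?thesis
    proof (cases "ev (SumE (SumE match_expr)) r s2 = 1")
      case one: True
      have uniq: "matches s2 u x y \<longleftrightarrow> x = ?a \<and> y = ?b" if "x < m" "y < m" for x y
        using sum_indicator_eq_1[OF one[unfolded cnt] true ab _ that] true by blast
      define s3 where "s3 = mem_update s2 ''x'' 1 ?a"
      define s4 where "s4 = mem_update s3 ''x'' 2 ?b"
      have "ev (SumE (SumE (Var 5 *. match_expr))) r s2 = (\<Sum>x<m. \<Sum>y<m. x * (if matches s2 u x y then 1 else 0))"
        unfolding ev.simps(5) loadedD(1)[OF l2] by (intro sum.cong refl) (simp add: match, simp add: r)
      also have "\<dots> = ?a" by (rule sum_indicator_unique[OF ab uniq])
      finally have s3: "run (Put ''x'' (Num 1) (SumE (SumE (Var 5 *. match_expr)))) r s2 = s3"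
        using ab loadedD[OF l2] unfolding run.simps(1) by (simp add: s3_def del: ev.simps(5))
      have l3: "loaded s3" using l2 by (simp add: s3_def loaded_def)
      have "ev (SumE (SumE (Var 6 *. match_expr))) r s3 = (\<Sum>x<m. \<Sum>y<m. y * (if matches s2 u x y then 1 else 0))"
        unfolding ev.simps(5) loadedD(1)[OF l3]
      proof (intro sum.cong refl)
        fix x y assume "x \<in> {..<m}" "y \<in> {..<m}"
        then have "ev match_expr (r @ [x, y]) s3 = (if matches s2 u x y then 1 else 0)"
          by (intro match[of x y s3 ?a]) (auto simp: s3_def)
        then show "ev (Var 6 *. match_expr) ((r @ [x]) @ [y]) s3 = y * (if matches s2 u x y then 1 else 0)"
          by (simp add: r)
      qed
      also have "\<dots> = ?b" by (rule sum_indicator_unique[OF ab uniq])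
      finally have s4: "run (Put ''x'' (Num 2) (SumE (SumE (Var 6 *. match_expr)))) r s3 = s4"
        using ab loadedD[OF l3] unfolding run.simps(1) by (simp add: s4_def del: ev.simps(5))
      have "s' = run (peel 5) r s4"
        unfolding s' run.simps(3)[of ?cnt] using one by (simp only: run.simps(2) s3 s4 ev.simps(4) bin_val.simps) simp
      moreover have "decoded s4" "alive s4 = ?A"
        using d2 al by (simp_all add: decoded_def s4_def s3_def loaded_def alive_def)
      ultimately have "decoded s' \<and> alive s' = ?A - {u}"
        using peel_correct[of s4 u r 5] True x2 by (simp add: s4_def s3_def r)
      then show ?thesis by auto
    next
      case False
      then have "s' = s2" unfolding s' run.simps(3)[of ?cnt] by (simp only: ev.simps(4) bin_val.simps) simp
      \<comment> \<open>For a decodable vertex every matching pair equals the true one, so the count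
        would have been 1.\<close>
      moreover have "False" if i: "i \<in> {1..m}" "v i = u" "?A \<subseteq> v ` {i..m}"
        "\<And>j. v j \<in> ?A \<Longrightarrow> i < j \<Longrightarrow> j \<le> m \<Longrightarrow> 2 * What {v i, v j} i < int p"
      proof -
        have "matches s2 u x y \<longleftrightarrow> x = ?a \<and> y = ?b" for x y
        proof
          assume xy: "matches s2 u x y"
          show "x = ?a \<and> y = ?b"
            using xy true unfolding matches_def al i(2)[symmetric]
            by (intro killed_candidate_unique[OF i(1,3,4) btw[folded i(2)]]) (use True i(2) in auto)
        qed (use true in auto)
        then have "(\<Sum>x<m. \<Sum>y<m. 1 * (if matches s2 u x y then 1 else 0)) = (1::nat)"
          by (intro sum_indicator_unique[OF ab])
        with False cnt show False by simp
      qed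
      ultimately show ?thesis using d2 al by auto
    qed
  qed
  then show "decoded s'" "alive s' \<subseteq> alive s"
    and "i \<in> {1..m} \<Longrightarrow> v i = u \<Longrightarrow> alive s \<subseteq> v ` {i..m} \<Longrightarrow>
      (\<And>j. v j \<in> alive s \<Longrightarrow> i < j \<Longrightarrow> j \<le> m \<Longrightarrow> 2 * What {v i, v j} i < int p) \<Longrightarrow> u \<notin> alive s'"
    by blast+
qed

end

lemma run_For_inv:
  assumes "s ''in'' 0 = n" "J s" and "\<And>i s. i < n \<Longrightarrow> J s \<Longrightarrow> J (run c (r @ [i]) s)"
  shows "J (run (For c) r s)"
  unfolding run.simps(4) assms(1) by (rule fold_inv[where I = "\<lambda>_. J"]) (rule assms(2), rule assms(3))

text \<open>The pattern of a successful search: iteration \<open>h\<close> establishes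
  \<open>H\<close> from the invariant alone, and later iterations do not destroy it.\<close>

lemma run_For_hit:
  assumes n: "s ''in'' 0 = n" and J: "J s" "\<And>i s. i < n \<Longrightarrow> J s \<Longrightarrow> J (run c (r @ [i]) s)"
    and h: "h < n" "\<And>s. J s \<Longrightarrow> H (run c (r @ [h]) s)"
    and persist: "\<And>i s. i < n \<Longrightarrow> J s \<Longrightarrow> H s \<Longrightarrow> H (run c (r @ [i]) s)"
  shows "H (run (For c) r s)"
proof -
  have "J (run (For c) r s) \<and> (h < n \<longrightarrow> H (run (For c) r s))"
    unfolding run.simps(4) n
  proof (rule fold_inv[where I = "\<lambda>i s. J s \<and> (h < i \<longrightarrow> H s)"])
    fix i s assume "i < n" "J s \<and> (h < i \<longrightarrow> H s)"
    then show "J (run c (r @ [i]) s) \<and> (h < Suc i \<longrightarrow> H (run c (r @ [i]) s))"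
      using J(2)[of i s] h(2)[of s] persist[of i s] by (cases "i = h") auto
  qed (use J in simp)
  then show ?thesis using h(1) by blast
qed

context attacked_message begin

text \<open>The vertex of least index at the beginning of the round is removed by its own iteration
  at the latest. Removals earlier in the round do no harm, because the conditions on it are
  inherited by smaller sets of remaining vertices.\<close>

lemma decode_round:
  assumes d: "decoded s" and vm: "v m \<notin> alive s" and ne: "alive s \<noteq> {}" and r: "r = [r0, r1, r2, r3]"
  shows "decoded (run (For decode_vertex) r s) \<and> alive (run (For decode_vertex) r s) \<subset> alive s"
proof -
  have n: "s ''in'' 0 = m" using d by (simp add: decoded_def loadedD)
  have "alive s \<subseteq> {..<m}" by (auto simp: alive_def)
  from decodable_vertex[OF this ne vm] obtain i where i: "i \<in> {1..m}" "v i \<in> alive s" "alive s \<subseteq> v ` {i..m}"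
    "\<And>j. v j \<in> alive s \<Longrightarrow> i < j \<Longrightarrow> j \<le> m \<Longrightarrow> 2 * What {v i, v j} i < int p" by blast
  define J where "J st \<longleftrightarrow> decoded st \<and> alive st \<subseteq> alive s" for st
  have J: "J (run decode_vertex (r @ [u]) st)" if "u < m" "J st" for u st
    using decode_vertex_correct(1,2)[of st u "r @ [u]" r0 r1 r2 r3] that r unfolding J_def by auto
  have "J (run (For decode_vertex) r s)"
  proof (rule run_For_inv[where J = J and n = m])
    show "s ''in'' 0 = m" by (rule n)
    show "J s" by (simp add: J_def d)
  qed (rule J)
  moreover have "v i \<notin> alive (run (For decode_vertex) r s)"
  proof (rule run_For_hit[where J = J and h = "v i" and n = m])
    show "s ''in'' 0 = m" by (rule n)
    show "J s" by (simp add: J_def d)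
    show "v i < m" by (rule v_less[OF i(1)])
    show "v i \<notin> alive (run decode_vertex (r @ [v i]) st)" if "J st" for st
    proof (rule decode_vertex_correct(3)[where i = i])
      show "alive st \<subseteq> v ` {i..m}" using that i(3) by (auto simp: J_def)
      show "2 * What {v i, v j} i < int p" if "v j \<in> alive st" "i < j" "j \<le> m" for j
        using i(4) that \<open>J st\<close> by (auto simp: J_def)
    qed (use that i v_less[OF i(1)] in \<open>auto simp: J_def r\<close>)
    show "v i \<notin> alive (run decode_vertex (r @ [u]) st)" if "u < m" "J st" "v i \<notin> alive st" for u st
      using decode_vertex_correct(2)[of st u "r @ [u]" r0 r1 r2 r3] that r unfolding J_def by auto
  qed (rule J)
  ultimately show ?thesis using i(2) by (auto simp: J_def)
qed

text \<open>After \<open>k\<close> rounds at most \<open>m - k\<close> vertices remain; once none is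
  left, further rounds merely preserve the invariant.\<close>

lemma decode_correct:
  assumes d: "decoded s" and vm: "v m \<notin> alive s" and r: "r = [r0, r1, r2]"
  shows "decoded (run (For (For decode_vertex)) r s) \<and> alive (run (For (For decode_vertex)) r s) = {}"
proof -
  have n: "s ''in'' 0 = m" using d by (simp add: decoded_def loadedD)
  have fin: "finite (alive st)" for st by (simp add: alive_def)
  define I where "I k st \<longleftrightarrow> decoded st \<and> alive st \<subseteq> alive s \<and> card (alive st) \<le> m - k" for k st
  have "I m (run (For (For decode_vertex)) r s)"
    unfolding run.simps(4)[of "For decode_vertex"] n
  proof (rule fold_inv[where I = I])
    have "alive s \<subseteq> {..<m}" by (auto simp: alive_def)
    then have "card (alive s) \<le> m" using card_mono[of "{..<m}"] by fastforce
    then show "I 0 s" by (simp add: I_def d)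
    fix k st assume k: "k < m" and I: "I k st"
    show "I (Suc k) (run (For decode_vertex) (r @ [k]) st)"
    proof (cases "alive st = {}")
      case False
      with decode_round[of st "r @ [k]" r0 r1 r2 k] I vm r
      have *: "decoded (run (For decode_vertex) (r @ [k]) st)"
        "alive (run (For decode_vertex) (r @ [k]) st) \<subset> alive st" by (auto simp: I_def simp del: run.simps)
      with psubset_card_mono[OF fin *(2)] I show ?thesis
        unfolding I_def by (intro conjI) (assumption, blast, linarith)
    next
      case True
      define J where "J st \<longleftrightarrow> decoded st \<and> alive st = {}" for st
      have "J (run (For decode_vertex) (r @ [k]) st)"
      proof (rule run_For_inv[where J = J and n = m])
        show "st ''in'' 0 = m" using I by (simp add: I_def decoded_def loadedD)
        show "J st" using I True by (simp add: J_def I_def)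
        show "J (run decode_vertex ((r @ [k]) @ [u]) st)" if "u < m" "J st" for u st
          using decode_vertex_correct(1,2)[of st u "(r @ [k]) @ [u]" r0 r1 r2 k] that r unfolding J_def by auto
      qed
      then show ?thesis unfolding I_def J_def by simp
    qed
  qed
  then show ?thesis using fin by (simp add: I_def)
qed

lemma partner_lt: "x < m \<Longrightarrow> partner P b x < m"
  by (rule partner_less[OF alt])

lemma start_correct:
  assumes l: "loaded s" and z: "z < m" and r: "r = [z, partner P True z, partner P False z]"
  shows "decoded (run start r s) \<and> alive (run start r s) = {..<m} - {z}"
proof -
  have put: "run (For (Put a (Var 3) e)) r st = st(a := \<lambda>i. if i < m then h i else st a i)"
    if "loaded st" "a \<noteq> ''in''" "\<And>i. i < m \<Longrightarrow> h i \<le> p + m"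
      "\<And>i st'. i < m \<Longrightarrow> st' ''in'' = st ''in'' \<Longrightarrow> ev e (r @ [i]) st' = h i" for a e h st
  proof -
    have n: "st ''in'' 0 = m" "cap st = p + m + 1" using loadedD[OF that(1)] by simp_all
    have "run (For (Put a (Var 3) e)) r st = st(a := \<lambda>i. if i < st ''in'' 0 then h i mod cap st else st a i)"
      by (rule run_For_Put) (use that n in \<open>simp_all add: r\<close>)
    moreover have "h i mod cap st = h i" if "i < m" for i
      using that(1) \<open>\<And>i. i < m \<Longrightarrow> h i \<le> p + m\<close>[of i] n by simp
    ultimately show ?thesis using n(1) by (simp only: cong: if_cong)
  qed
  define s1 where "s1 = s(''r'' := \<lambda>i. if i < m then cipher i else s ''r'' i)"
  define s2 where "s2 = s1(''alive'' := \<lambda>i. if i < m then 1 else s1 ''alive'' i)"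
  define s3 where "s3 = s2(''plus'' := \<lambda>i. if i < m then i else s2 ''plus'' i)"
  define s4 where "s4 = s3(''minus'' := \<lambda>i. if i < m then i else s3 ''minus'' i)"
  define s5 where "s5 = mem_update (mem_update (mem_update s4 ''x'' 0 z) ''x'' 1 (partner P True z)) ''x'' 2 (partner P False z)"
  have ls: "loaded s1" "loaded s2" "loaded s3" "loaded s4"
    using l by (simp_all add: s1_def s2_def s3_def s4_def loaded_def)
  have r1: "run (For (Put ''r'' (Var 3) (cipher_expr (Var 3)))) r s = s1"
    unfolding s1_def
  proof (rule put[OF l])
    fix i assume i: "i < m"
    show "cipher i \<le> p + m" using cipher_less[of i] by simp
    fix st' assume "st' ''in'' = s ''in''"
    then have "loaded st'" using l by (simp add: loaded_def)
    from ev_cipher[OF this, of "Var 3" "r @ [i]"] i show "ev (cipher_expr (Var 3)) (r @ [i]) st' = cipher i"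
      by (simp add: r)
  qed simp
  have r2: "run (For (Put ''alive'' (Var 3) (Num 1))) r s1 = s2"
    unfolding s2_def using p_pos by (intro put[OF ls(1)]) auto
  have r3: "run (For (Put ''plus'' (Var 3) (Var 3))) r s2 = s3"
    unfolding s3_def by (intro put[OF ls(2)]) (auto simp: r)
  have r4: "run (For (Put ''minus'' (Var 3) (Var 3))) r s3 = s4"
    unfolding s4_def by (intro put[OF ls(3)]) (auto simp: r)
  have c: "cap s4 = p + m + 1" using loadedD[OF ls(4)] by simp
  have lt: "z < p + m + 1" "partner P True z < p + m + 1" "partner P False z < p + m + 1"
    using z partner_lt[OF z] by (auto intro: less_trans simp: trans_less_add2 less_Suc_eq)
  have r5: "run (Put ''x'' (Num 2) (Var 2)) r (run (Put ''x'' (Num 1) (Var 1)) r (run (Put ''x'' (Num 0) (Var 0)) r s4)) = s5"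
    using c lt by (simp add: r s5_def cap_def)
  have run: "run start r s = run (peel 3) r s5"
    unfolding start_def run.simps(2) r1 r2 r3 r4 r5 ..
  have al: "alive s5 = {..<m}" by (auto simp: alive_def s5_def s4_def s3_def s2_def)
  have lk: "linked {..<m} b x = x" if "x < m" for x b using that partner_lt by (simp add: linked_def)
  have rp: "restrict_partner {..<m} P b z = partner P b z" for b
    using partner_lt[OF z] by (simp add: restrict_partner_def)
  have "loaded s5" using ls(4) by (simp add: s5_def loaded_def)
  then have "decoded s5"
    unfolding decoded_def al using lk
    by (simp add: s5_def s4_def s3_def s2_def s1_def cipher_def)
  then show ?thesis
    unfolding run using peel_correct[of s5 z r 3] z by (simp add: al rp) (simp add: s5_def r)
qed

text \<open>Only the last vertex may repeat an earlier one, so \<open>q\<close> is injective on the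
  first \<open>l\<close> indices. Hence the lengths \<open>d + 1\<close> with \<open>d < m\<close>
  exhaust all messages.\<close>

lemma walk_length_le: "walk n q l \<Longrightarrow> l \<le> n"
proof -
  assume w: "walk n q l"
  have "inj_on q {..<l}"
  proof (rule inj_onI)
    fix i j assume "i \<in> {..<l}" "j \<in> {..<l}" "q i = q j"
    then show "i = j" using walkD(2)[OF w, of i j] walkD(2)[OF w, of j i] by (cases i j rule: linorder_cases) auto
  qed
  moreover have "q ` {..<l} \<subseteq> {..<n}" using w by (auto simp: walk_def)
  ultimately show ?thesis using card_inj_on_le[of q "{..<l}" "{..<n}"] by simp
qed

section \<open>Walking along the decoded partners\<close>

lemma trace_frame: "a \<noteq> ''w'' \<Longrightarrow> run trace r s a = s a"
  by (rule run_frame) (simp add: trace_def)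

abbreviation "trace_step \<equiv> Put ''w'' (Var 4 +. Num 1)
       (!. (Var 4 %. Num 2) *. At ''plus'' (At ''w'' (Var 4)) +. (Var 4 %. Num 2) *. At ''minus'' (At ''w'' (Var 4)))"

lemma trace_start:
  assumes l: "loaded s" and r: "r = [r0, r1, r2, i]" and i: "i < m"
  shows "run trace r s ''w'' 0 = i"
proof -
  define s1 where "s1 = run (Put ''w'' (Num 0) (Var 3)) r s"
  have s1: "s1 = mem_update s ''w'' 0 i" using i loadedD[OF l] by (simp add: s1_def r)
  have "run (For trace_step) r s1 ''w'' 0 = i"
    by (rule run_For_inv[where J = "\<lambda>s. s ''w'' 0 = i" and s = s1 and n = "s1 ''in'' 0"]) (simp_all add: s1 r)
  then show ?thesis by (simp add: trace_def s1_def)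
qed

lemma trace_correct:
  assumes l: "loaded s" and q: "walk m q (length P)" "P = walk_edges q (length P)"
    and s: "\<forall>x<m. s ''plus'' x = partner P True x \<and> s ''minus'' x = partner P False x"
    and r: "r = [r0, r1, r2, q 0]" and i: "i \<le> length P"
  shows "run trace r s ''w'' i = q i"
proof -
  have qm: "q j < m" if "j \<le> length P" for j using q(1) that by (simp add: walk_def)
  define s1 where "s1 = run (Put ''w'' (Num 0) (Var 3)) r s"
  have s1: "s1 = mem_update s ''w'' 0 (q 0)" using qm[of 0] loadedD[OF l] by (simp add: s1_def r)
  have l1: "loaded s1" using l by (simp add: s1 loaded_def)
  \<comment> \<open>Nothing is claimed about the cells beyond the end of the message.\<close>
  define I where "I j st \<longleftrightarrow> (\<forall>a. a \<noteq> ''w'' \<longrightarrow> st a = s a) \<and>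
    (\<forall>i. i \<le> j \<and> i \<le> length P \<longrightarrow> st ''w'' i = q i)" for j st
  have "I m (run (For trace_step) r s1)"
    unfolding run.simps(4) loadedD(1)[OF l1]
  proof (rule fold_inv[where I = I])
    show "I 0 s1" by (auto simp: I_def s1)
    fix j st assume j: "j < m" and I: "I j st"
    have st: "st ''in'' = s ''in''" "st ''plus'' = s ''plus''" "st ''minus'' = s ''minus''"
      using I by (simp_all add: I_def)
    then have lst: "loaded st" using l by (simp add: loaded_def)
    obtain x where x: "run trace_step (r @ [j]) st = mem_update st ''w'' (Suc j) x"
      "x = ((if j mod 2 = 0 then 1 else 0) * st ''plus'' (st ''w'' j) + j mod 2 * st ''minus'' (st ''w'' j)) mod cap st"
      by (simp add: r)
    have "x = q (Suc j)" if "j < length P"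
    proof -
      have "st ''w'' j = q j" using I that by (simp add: I_def)
      moreover have "joined P (even j) (q j) (q (Suc j))"
        unfolding joined_def using walk_nth_neq[OF q(1) that] that q(2) by (metis nth_walk_edges)
      then have "partner P (even j) (q j) = q (Suc j)" by (rule joined_partner[OF alt])
      ultimately show ?thesis
        using x(2) s qm[of j] qm[of "Suc j"] that loadedD[OF lst]
        by (cases "even j") (auto simp: st even_iff_mod_2_eq_zero odd_iff_mod_2_eq_one)
    qed
    then show "I (Suc j) (run trace_step (r @ [j]) st)"
      using I unfolding x(1) I_def by (auto simp: le_Suc_eq mem_update_def)
  qed
  moreover have "length P \<le> m" by (rule walk_length_le[OF q(1)])
  ultimately show ?thesis using i by (simp add: I_def trace_def s1_def)
qed

end

section \<open>Correctness of the search\<close>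

lemma walk_cong:
  assumes w: "walk m q l" and q: "\<And>i. i \<le> l \<Longrightarrow> q' i = q i"
  shows "walk m q' l"
  unfolding walk_def
proof (intro conjI allI impI)
  show "1 \<le> l" using w unfolding walk_def by (rule conjunct1)
  show "q' i < m" if "i \<le> l" for i using w q that by (simp add: walk_def)
  fix i j assume ij: "i < j \<and> j \<le> l"
  then show "q' i \<noteq> q' j \<or> i = 0 \<and> j = l \<and> even l \<and> 3 \<le> l"
    using walkD[OF w, of i j] q[of i] q[of j] by (cases "q i = q j") auto
qed

context attacked_message begin

lemma encrypt_eq_iff:
  assumes Q: "alternating m Q"
  shows "encrypt pk Q = encrypt pk P \<longleftrightarrow> (\<forall>t<m. nat (res Q {..<m} t mod int p) = cipher t)"
proof
  assume enc: "encrypt pk Q = encrypt pk P"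
  have "res Q {..<m} t mod int p = res P {..<m} t mod int p" if "t < m" for t
    using that fun_cong[OF enc, of "Suc t"] unfolding encrypt_eq[OF Q] encrypt_eq[OF alt] by simp
  then show "\<forall>t<m. nat (res Q {..<m} t mod int p) = cipher t" by (simp add: cipher_def)
next
  assume *: "\<forall>t<m. nat (res Q {..<m} t mod int p) = cipher t"
  have "res Q {..<m} (t - 1) mod int p = res P {..<m} (t - 1) mod int p" if "t \<in> {1..m}" for t
  proof -
    have "0 \<le> res R {..<m} (t - 1) mod int p" for R using p_pos by simp
    moreover have "t - 1 < m" using that by auto
    with * have "nat (res Q {..<m} (t - 1) mod int p) = nat (res P {..<m} (t - 1) mod int p)"
      by (simp add: cipher_def)
    ultimately show ?thesis by (simp only: eq_nat_nat_iff)
  qed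
  then show "encrypt pk Q = encrypt pk P"
    unfolding encrypt_eq[OF Q] encrypt_eq[OF alt] by (rule restrict_ext)
qed

lemma res_walk:
  assumes w: "walk m q l"
  shows "res (walk_edges q l) {..<m} t = (\<Sum>i<l. (-1) ^ i * star_vec (q i) (q (Suc i)) t)"
proof -
  have "res (walk_edges q l) {..<m} t = (\<Sum>i<l. (-1) ^ i * wt (walk_edges q l ! i) t)"
    unfolding res_def residual_all[OF walk_alternating[OF w]] by simp
  also have "\<dots> = (\<Sum>i<l. (-1) ^ i * star_vec (q i) (q (Suc i)) t)"
    by (intro sum.cong refl) (simp add: star_vec_edge walk_nth_neq[OF w])
  finally show ?thesis .
qed

lemma signed_sum_mod:
  assumes "\<And>i. i < l \<Longrightarrow> int (a i) = x i"
  shows "int (\<Sum>i<l. ((if even i then 1 else 0) + i mod 2 * (p - 1)) * a i) mod int p =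
    (\<Sum>i<l. (-1) ^ i * x i) mod int p"
proof -
  have "[(\<Sum>i<l. int (((if even i then 1 else 0) + i mod 2 * (p - 1)) * a i)) = (\<Sum>i<l. (-1) ^ i * x i)] (mod int p)"
  proof (rule cong_sum)
    fix i assume "i \<in> {..<l}"
    then have a: "int (a i) = x i" using assms by simp
    show "[int (((if even i then 1 else 0) + i mod 2 * (p - 1)) * a i) = (-1) ^ i * x i] (mod int p)"
    proof (cases "even i")
      case True
      then show ?thesis by (simp add: a)
    next
      case False
      have "[(int p - 1) * x i = (0 - 1) * x i] (mod int p)"
        by (intro cong_mult cong_diff) (auto simp: cong_0_iff)
      moreover have "i mod 2 = 1" using False by presburger
      ultimately show ?thesis using False p_pos by (simp add: a of_nat_diff)
    qed
  qed
  then show ?thesis by (simp add: cong_def)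
qed

text \<open>The program tests the range of the vertices from the second one on; the first is a loop
  variable and therefore below \<open>m\<close>, as the hypothesis on cell 0 records.\<close>

lemma valid_correct:
  assumes l: "loaded s" and w0: "s ''w'' 0 < m" and d: "d < m" and r: "r = [r0, r1, r2, r3, d]"
  defines "q \<equiv> s ''w''"
  shows "ev valid_expr r s \<noteq> 0 \<longleftrightarrow>
    walk m q (Suc d) \<and> encrypt pk (walk_edges q (Suc d)) = encrypt pk P"
proof -
  let ?e1 = "SumE ((Var 5 <. Var 4 +. Num 1) *. !. (At ''w'' (Var 5 +. Num 1) <. nE))"
  let ?e2 = "SumE (SumE ((Var 5 <. Var 6 +. Num 1) *. (Var 6 <. Var 4 +. Num 1) *.
       (At ''w'' (Var 5) =. At ''w'' (Var 6 +. Num 1)) *.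
       !. (!. (Var 5) *. (Var 6 =. Var 4) *. (Var 4 %. Num 2) *. (Num 1 <. Var 4))))"
  let ?lhs = "SumE ((Var 6 <. Var 4 +. Num 1) *. (!. (Var 6 %. Num 2) +. (Var 6 %. Num 2) *. (pE -. Num 1)) *.
       weight_expr (At ''w'' (Var 6)) (At ''w'' (Var 6 +. Num 1)) (Var 5)) %. pE"
  let ?e3 = "SumE (!. (?lhs =. cipher_expr (Var 5)))"
  have n: "s ''in'' 0 = m" "s ''in'' 2 = p" using loadedD[OF l] by simp_all
  have e1: "ev ?e1 r s = 0 \<longleftrightarrow> (\<forall>i\<le>d. q (Suc i) < m)"
  proof -
    have "ev ?e1 r s = 0 \<longleftrightarrow> (\<forall>i\<in>{..<m}. m \<le> q (Suc i) \<longrightarrow> Suc d \<le> i)"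
      by (simp add: n r q_def not_less)
    also have "\<dots> \<longleftrightarrow> (\<forall>i\<le>d. q (Suc i) < m)"
    proof (intro iffI allI ballI impI)
      fix i assume *: "\<forall>i\<in>{..<m}. m \<le> q (Suc i) \<longrightarrow> Suc d \<le> i" and i: "i \<le> d"
      from bspec[OF *, of i] i d show "q (Suc i) < m" by (cases "q (Suc i) < m") simp_all
    next
      fix i assume *: "\<forall>i\<le>d. q (Suc i) < m" and i: "m \<le> q (Suc i)"
      from spec[OF *, of i] i show "Suc d \<le> i" by (cases "i \<le> d") simp_all
    qed
    finally show ?thesis .
  qed
  \<comment> \<open>The later index is written as \<open>Suc j\<close> and the length as
    \<open>Suc d\<close>, so \<open>odd d\<close> and \<open>1 < d\<close> say that the length is
    even and at least 3.\<close>
  have e2: "ev ?e2 r s = 0 \<longleftrightarrow> (\<forall>i<m. \<forall>j<m. i \<le> j \<and> j \<le> d \<and> q i = q (Suc j) \<longrightarrow> i = 0 \<and> j = d \<and> odd d \<and> 1 < d)"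
  proof -
    let ?t = "(Var 5 <. Var 6 +. Num 1) *. (Var 6 <. Var 4 +. Num 1) *.
       (At ''w'' (Var 5) =. At ''w'' (Var 6 +. Num 1)) *.
       !. (!. (Var 5) *. (Var 6 =. Var 4) *. (Var 4 %. Num 2) *. (Num 1 <. Var 4))"
    define bad where "bad i j \<longleftrightarrow>
      i \<le> j \<and> j \<le> d \<and> q i = q (Suc j) \<and> \<not> (i = 0 \<and> j = d \<and> odd d \<and> 1 < d)" for i j
    have "d mod 2 = (if odd d then 1 else 0)" by presburger
    then have t: "ev ?t ((r @ [i]) @ [j]) s = (if bad i j then 1 else 0)" for i j
      by (cases "odd d") (simp_all add: r q_def bad_def less_Suc_eq_le)
    have E: "ev ?e2 r s = (\<Sum>i<m. \<Sum>j<m. if bad i j then 1 else 0)"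
      unfolding ev.simps(5) n by (intro sum.cong refl) (rule t)
    have "ev ?e2 r s = 0 \<longleftrightarrow> (\<forall>i<m. \<forall>j<m. \<not> bad i j)" unfolding E by auto
    then show ?thesis unfolding bad_def by blast
  qed
  have e12: "ev ?e1 r s = 0 \<and> ev ?e2 r s = 0 \<longleftrightarrow> walk m q (Suc d)"
    unfolding e1 e2
  proof (intro iffI conjI allI impI)
    assume *: "(\<forall>i\<le>d. q (Suc i) < m) \<and>
      (\<forall>i<m. \<forall>j<m. i \<le> j \<and> j \<le> d \<and> q i = q (Suc j) \<longrightarrow> i = 0 \<and> j = d \<and> odd d \<and> 1 < d)"
    show "walk m q (Suc d)"
      unfolding walk_def
    proof (intro conjI allI impI)
      show "q i < m" if "i \<le> Suc d" for i
        using * w0 that by (cases i) (auto simp: q_def)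
      fix i j assume ij: "i < j \<and> j \<le> Suc d"
      then obtain k where k: "j = Suc k" by (cases j) auto
      with ij d have km: "k < m" "i < m" "i \<le> k" "k \<le> d" by auto
      have "q i = q (Suc k) \<Longrightarrow> i = 0 \<and> k = d \<and> odd d \<and> 1 < d"
        using * km by blast
      then show "q i \<noteq> q j \<or> i = 0 \<and> j = Suc d \<and> even (Suc d) \<and> 3 \<le> Suc d"
        unfolding k by auto
    qed simp
  next
    fix i assume "walk m q (Suc d)" "i \<le> d"
    then show "q (Suc i) < m" by (simp add: walk_def)
  next
    fix i j assume w: "walk m q (Suc d)" and ij: "i \<le> j \<and> j \<le> d \<and> q i = q (Suc j)"
    then have "i < Suc j" "Suc j \<le> Suc d" "q i = q (Suc j)" by auto
    note walkD[OF w this]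
    then show "i = 0" "j = d" "odd d" "1 < d" by auto
  qed
  \<comment> \<open>Weights are read correctly only between genuine vertices, so the third test is
    interpreted after the first two have succeeded.\<close>
  have e3: "ev ?e3 r s = 0 \<longleftrightarrow> encrypt pk (walk_edges q (Suc d)) = encrypt pk P" if w: "walk m q (Suc d)"
  proof -
    have q: "q i < m" if "i \<le> Suc d" for i using w that by (simp add: walk_def)
    have lhs: "ev ?lhs (r @ [t]) s = nat (res (walk_edges q (Suc d)) {..<m} t mod int p)" if t: "t < m" for t
    proof -
      let ?a = "\<lambda>i. ev (weight_expr (At ''w'' (Var 6)) (At ''w'' (Var 6 +. Num 1)) (Var 5)) (r @ [t, i]) s"
      let ?sg = "\<lambda>i. (if even i then 1 else 0) + i mod 2 * (p - 1)"
      have a: "int (?a i) = star_vec (q i) (q (Suc i)) t" if "i < Suc d" for i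
        using q[of i] q[of "Suc i"] that t by (intro ev_weight_eq[OF l]) (simp_all add: r q_def)
      have "ev ?lhs (r @ [t]) s = (\<Sum>i<m. (if i < Suc d then 1 else 0) * ?sg i * ?a i) mod p"
        by (simp add: n r even_iff_mod_2_eq_zero)
      also have "(\<Sum>i<m. (if i < Suc d then 1 else 0) * ?sg i * ?a i) = (\<Sum>i<Suc d. ?sg i * ?a i)"
        using d by (intro sum.mono_neutral_cong_right) auto
      also have "\<dots> mod p = nat (int (\<Sum>i<Suc d. ?sg i * ?a i) mod int p)"
        by (rule nat_mod_int[OF refl])
      also have "\<dots> = nat (res (walk_edges q (Suc d)) {..<m} t mod int p)"
        unfolding res_walk[OF w] by (rule arg_cong[where f = nat], rule signed_sum_mod, rule a)
      finally show ?thesis .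
    qed
    have S: "ev ?e3 r s = (\<Sum>t<m. if nat (res (walk_edges q (Suc d)) {..<m} t mod int p) = cipher t then 0 else 1)"
      unfolding ev.simps(5)[of "!. (?lhs =. cipher_expr (Var 5))"] n
    proof (rule sum.cong)
      fix t assume "t \<in> {..<m}"
      then have t: "t < m" by simp
      have "ev (cipher_expr (Var 5)) (r @ [t]) s = cipher t"
        using ev_cipher[OF l, of "Var 5" "r @ [t]"] t by (simp add: r)
      with lhs[OF t] show "ev (!. (?lhs =. cipher_expr (Var 5))) (r @ [t]) s =
          (if nat (res (walk_edges q (Suc d)) {..<m} t mod int p) = cipher t then 0 else 1)"
        unfolding ev.simps(4)[of Equal] bin_val.simps ev.simps(1) by (simp only: split: if_split) simp
    qed simp
    show ?thesis unfolding S encrypt_eq_iff[OF walk_alternating[OF w]] by auto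
  qed
  have "ev valid_expr r s \<noteq> 0 \<longleftrightarrow> ev ?e1 r s = 0 \<and> ev ?e2 r s = 0 \<and> ev ?e3 r s = 0"
    unfolding valid_expr_def ev.simps(4)[of Mul] ev.simps(4)[of Equal ?e1] ev.simps(4)[of Equal ?e2]
      ev.simps(4)[of Equal ?e3] bin_val.simps ev.simps(1)[of 0]
    by (simp del: ev.simps)
  then show ?thesis using e12 e3 by blast
qed

definition success :: "mem \<Rightarrow> bool" where
  "success s \<longleftrightarrow> (\<exists>Q. message (complete_edges m) Q \<and> encrypt pk Q = encrypt pk P \<and> output_edges s = set Q)"

text \<open>The invariant that survives wrong guesses: whatever has been output was verified by
  encryption, regardless of how it was found.\<close>

definition sound :: "mem \<Rightarrow> bool" where
  "sound s \<longleftrightarrow> loaded s \<and> (s ''found'' 0 \<noteq> 0 \<longrightarrow> success s)"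

lemma sound_cong:
  "s' ''in'' = s ''in'' \<Longrightarrow> s' ''found'' = s ''found'' \<Longrightarrow> s' ''out'' = s ''out'' \<Longrightarrow> sound s' = sound s"
  by (simp add: sound_def success_def output_edges_def loaded_def)

lemma write_output_correct:
  assumes l: "loaded s" and w: "walk m (s ''w'') (Suc d)" and d: "d < m"
    and enc: "encrypt pk (walk_edges (s ''w'') (Suc d)) = encrypt pk P" and r: "r = [r0, r1, r2, r3, d]"
  shows "sound (run write_output r s) \<and> run write_output r s ''found'' 0 \<noteq> 0"
proof -
  let ?q = "s ''w''"
  have q: "?q i < m" if "i \<le> Suc d" for i using w that by (simp add: walk_def)
  define s1 where "s1 = mem_update (mem_update s ''found'' 0 1) ''out'' 0 (Suc d)"
  have cap: "cap s = p + m + 1" using loadedD[OF l] by simp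
  let ?body = "Put ''out'' (Num 2 *. Var 5 +. Num 1) (At ''w'' (Var 5)) ;;
          Put ''out'' (Num 2 *. Var 5 +. Num 2) (At ''w'' (Var 5 +. Num 1))"
  have "run (Put ''out'' (Num 0) (Var 4 +. Num 1)) r (run (Put ''found'' (Num 0) (Num 1)) r s) = s1"
    using d p_pos cap by (simp add: r s1_def cap_def)
  then have run: "run write_output r s = run (For ?body) r s1"
    unfolding write_output_def run.simps(2) by (simp only:)
  define I where "I i st \<longleftrightarrow> (\<forall>a. a \<noteq> ''out'' \<longrightarrow> st a = s1 a) \<and> st ''out'' 0 = Suc d \<and>
    (\<forall>j. j < i \<and> j \<le> d \<longrightarrow> st ''out'' (2 * j + 1) = ?q j \<and> st ''out'' (2 * j + 2) = ?q (Suc j))" for i st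
  have n1: "s1 ''in'' 0 = m" using loadedD[OF l] by (simp add: s1_def)
  have I: "I m (run (For ?body) r s1)"
    unfolding run.simps(4) n1
  proof (rule fold_inv[where I = I])
    show "I 0 s1" by (simp add: I_def s1_def)
    fix i st assume i: "i < m" and I: "I i st"
    have st: "st ''w'' = ?q" "st ''in'' = s ''in''" using I by (simp_all add: I_def s1_def)
    have c: "cap st = p + m + 1" using cap st by (simp add: cap_def)
    let ?x = "?q i mod (p + m + 1)" and ?y = "?q (Suc i) mod (p + m + 1)"
    have b: "run ?body (r @ [i]) st = mem_update (mem_update st ''out'' (2 * i + 1) ?x) ''out'' (2 * i + 2) ?y"
      using c st(2) by (simp add: r st(1) cap_def)
    have xy: "?x = ?q i \<and> ?y = ?q (Suc i)" if "i \<le> d" using q[of i] q[of "Suc i"] that by simp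
    then show "I (Suc i) (run ?body (r @ [i]) st)"
      unfolding b I_def
    proof (intro conjI allI impI)
      fix a assume "a \<noteq> ''out''"
      then show "mem_update (mem_update st ''out'' (2 * i + 1) ?x) ''out'' (2 * i + 2) ?y a = s1 a"
        using I unfolding I_def mem_update_def by simp
    next
      show "mem_update (mem_update st ''out'' (2 * i + 1) ?x) ''out'' (2 * i + 2) ?y ''out'' 0 = Suc d"
        using I unfolding I_def by simp
    next
      fix j assume j: "j < Suc i \<and> j \<le> d"
      have old: "st ''out'' (2 * j + 1) = ?q j" "st ''out'' (2 * j + 2) = ?q (Suc j)" if "j \<noteq> i"
        using I j that unfolding I_def by simp_all
      have ne: "2 * j + 1 \<noteq> 2 * i + (2::nat)" "2 * j + 2 \<noteq> 2 * i + (1::nat)" by presburger+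
      show "mem_update (mem_update st ''out'' (2 * i + 1) ?x) ''out'' (2 * i + 2) ?y ''out'' (2 * j + 1) = ?q j"
        "mem_update (mem_update st ''out'' (2 * i + 1) ?x) ''out'' (2 * i + 2) ?y ''out'' (2 * j + 2) = ?q (Suc j)"
        unfolding mem_update_simps(1) using old ne xy j by (cases "j = i"; simp)+
    qed
  qed
  let ?s = "run write_output r s"
  have "?s ''found'' = s1 ''found''" "?s ''in'' = s1 ''in''" "?s ''out'' 0 = Suc d"
    using I unfolding run by (simp_all add: I_def del: run.simps)
  moreover have "output_edges ?s = set (walk_edges ?q (Suc d))"
  proof -
    have "{?s ''out'' (2 * i + 1), ?s ''out'' (2 * i + 2)} = {?q i, ?q (Suc i)}" if "i < Suc d" for i
      using I that d unfolding run I_def by (simp del: run.simps)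
    then show ?thesis
      unfolding output_edges_def set_walk_edges \<open>?s ''out'' 0 = Suc d\<close> by (intro Collect_cong ex_cong1) auto
  qed
  moreover have "message (complete_edges m) (walk_edges ?q (Suc d))" by (rule walk_message[OF w])
  ultimately show ?thesis
    using l enc unfolding sound_def success_def by (auto simp: s1_def loaded_def)
qed

section \<open>The nested search loops\<close>

abbreviation "check \<equiv> When (!. (At ''found'' (Num 0)) *. valid_expr) write_output"

lemma check_correct:
  assumes s: "sound s" and w: "s ''w'' 0 < m" and d: "d < m" and r: "r = [r0, r1, r2, r3, d]"
  shows "sound (run check r s)" "run check r s ''w'' = s ''w''"
    "s ''found'' 0 \<noteq> 0 \<Longrightarrow> run check r s ''found'' 0 \<noteq> 0"
    "walk m (s ''w'') (Suc d) \<Longrightarrow> encrypt pk (walk_edges (s ''w'') (Suc d)) = encrypt pk P \<Longrightarrow>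
      run check r s ''found'' 0 \<noteq> 0"
proof -
  have l: "loaded s" using s by (simp add: sound_def)
  note valid = valid_correct[OF l w d r]
  have run: "run check r s = (if s ''found'' 0 = 0 \<and> ev valid_expr r s \<noteq> 0 then run write_output r s else s)"
    by simp
  show "run check r s ''w'' = s ''w''" by (rule run_frame) (simp add: write_output_def)
  show "sound (run check r s)" "s ''found'' 0 \<noteq> 0 \<Longrightarrow> run check r s ''found'' 0 \<noteq> 0"
    "walk m (s ''w'') (Suc d) \<Longrightarrow> encrypt pk (walk_edges (s ''w'') (Suc d)) = encrypt pk P \<Longrightarrow>
      run check r s ''found'' 0 \<noteq> 0"
    unfolding run using write_output_correct[OF l _ d _ r] valid s by auto
qed

abbreviation "attempt \<equiv> trace ;; For check"

lemma attempt_correct: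
  assumes s: "sound s" and i: "i < m" and r: "r = [r0, r1, r2, i]"
  shows "sound (run attempt r s)" "s ''found'' 0 \<noteq> 0 \<Longrightarrow> run attempt r s ''found'' 0 \<noteq> 0"
    "walk m q (length P) \<Longrightarrow> P = walk_edges q (length P) \<Longrightarrow> i = q 0 \<Longrightarrow>
      \<forall>x<m. s ''plus'' x = partner P True x \<and> s ''minus'' x = partner P False x \<Longrightarrow>
      run attempt r s ''found'' 0 \<noteq> 0"
proof -
  define s1 where "s1 = run trace r s"
  have l: "loaded s" using s by (simp add: sound_def)
  have so1: "sound s1" using s sound_cong[of s1 s] by (simp add: s1_def trace_frame)
  have w0: "s1 ''w'' 0 = i" unfolding s1_def by (rule trace_start[OF l r i])
  \<comment> \<open>Checking leaves \<open>''w''\<close> alone, so all lengths are tested on the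
    same trace.\<close>
  define J where "J st \<longleftrightarrow> sound st \<and> st ''w'' = s1 ''w''" for st
  have n1: "s1 ''in'' 0 = m" using so1 by (simp add: sound_def loadedD)
  have J1: "J s1" using so1 by (simp add: J_def)
  have Jw: "st ''w'' 0 < m" if "J st" for st using that w0 i by (simp add: J_def)
  have step: "J (run check (r @ [d]) st)" if "d < m" "J st" for d st
    using check_correct(1,2)[of st d "r @ [d]" r0 r1 r2 i] Jw that r by (simp add: J_def del: run.simps)
  have persist: "run check (r @ [d]) st ''found'' 0 \<noteq> 0" if "d < m" "J st" "st ''found'' 0 \<noteq> 0" for d st
    using check_correct(3)[of st d "r @ [d]" r0 r1 r2 i] Jw that r by (simp add: J_def del: run.simps)
  have run: "run attempt r s = run (For check) r s1" by (simp only: run.simps(2) s1_def)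
  show "sound (run attempt r s)"
    unfolding run
    using run_For_inv[where J = J and s = s1 and n = m and c = check and r = r, OF n1 J1 step]
    by (simp add: J_def del: run.simps)
  show "run attempt r s ''found'' 0 \<noteq> 0" if f: "s ''found'' 0 \<noteq> 0"
  proof -
    have "J (run (For check) r s1) \<and> run (For check) r s1 ''found'' 0 \<noteq> 0"
    proof (rule run_For_inv[where J = "\<lambda>st. J st \<and> st ''found'' 0 \<noteq> 0" and n = m])
      show "J s1 \<and> s1 ''found'' 0 \<noteq> 0" using J1 f by (simp add: s1_def trace_frame)
    qed (use n1 step persist in \<open>simp_all del: run.simps\<close>)
    then show ?thesis unfolding run by blast
  qed
  show "run attempt r s ''found'' 0 \<noteq> 0"
    if q: "walk m q (length P)" "P = walk_edges q (length P)" "i = q 0"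
      and pm: "\<forall>x<m. s ''plus'' x = partner P True x \<and> s ''minus'' x = partner P False x"
  proof -
    have "1 \<le> length P" using q(1) unfolding walk_def by (rule conjunct1)
    then obtain d where d: "length P = Suc d" by (cases "length P") auto
    have dm: "d < m" using walk_length_le[OF q(1)] d by simp
    have w: "s1 ''w'' i = q i" if "i \<le> Suc d" for i
      unfolding s1_def using trace_correct[OF l q(1,2) pm, of r r0 r1 r2 i] r q(3) that d by simp
    have wk: "walk m (s1 ''w'') (Suc d)" by (rule walk_cong[OF q(1)[unfolded d] w])
    have "walk_edges (s1 ''w'') (Suc d) = P"
      unfolding q(2)[unfolded d] walk_edges_def using w by (intro map_cong) auto
    then have enc: "encrypt pk (walk_edges (s1 ''w'') (Suc d)) = encrypt pk P" by simp
    show ?thesis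
      unfolding run
    proof (rule run_For_hit[where J = J and n = m and h = d and H = "\<lambda>st. st ''found'' 0 \<noteq> 0"])
      show "run check (r @ [d]) st ''found'' 0 \<noteq> 0" if J: "J st" for st
      proof (rule check_correct(4)[where s = st and d = d])
        show "st ''w'' 0 < m" "d < m" by (rule Jw[OF J], rule dm)
        show "sound st" using J by (simp add: J_def)
        show "r @ [d] = [r0, r1, r2, i, d]" by (simp add: r)
        show "walk m (st ''w'') (Suc d)" "encrypt pk (walk_edges (st ''w'') (Suc d)) = encrypt pk P"
          using J wk enc by (simp_all add: J_def)
      qed
    qed (fact n1 J1 step dm persist)+
  qed
qed

abbreviation "guess \<equiv> start ;; For (For decode_vertex) ;; For attempt"

text \<open>Soundness and persistence hold for every guess, because decoding writes none of
  \<open>''in''\<close>, \<open>''found''\<close> and \<open>''out''\<close>. The correctness of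
  decoding enters only in the third claim, for the right guess.\<close>

lemma guess_correct:
  assumes s: "sound s" and r: "r = [r0, r1, r2]"
  shows "sound (run guess r s)" "s ''found'' 0 \<noteq> 0 \<Longrightarrow> run guess r s ''found'' 0 \<noteq> 0"
    "r = [v m, partner P True (v m), partner P False (v m)] \<Longrightarrow> run guess r s ''found'' 0 \<noteq> 0"
proof -
  define s1 where "s1 = run (For (For decode_vertex)) r (run start r s)"
  have fr: "s1 a = s a" if "a \<in> {''in'', ''found'', ''out''}" for a
    unfolding s1_def using that
    by (auto simp del: run.simps intro!: trans[OF run_frame run_frame]
      simp: decode_vertex_def start_def peel_def link_def annihilate_def annihilate_edge_def annihilate_pivot_def)
  have run: "run guess r s = run (For attempt) r s1" by (simp only: run.simps(2) s1_def)
  have so1: "sound s1" using s sound_cong[of s1 s] fr by simp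
  have n1: "s1 ''in'' 0 = m" using so1 by (simp add: sound_def loadedD)
  define pm where "pm = (s1 ''plus'', s1 ''minus'')"
  \<comment> \<open>Attempts only read the partner arrays, so every starting vertex works with the
    same decoded partners.\<close>
  define J where "J st \<longleftrightarrow> sound st \<and> (st ''plus'', st ''minus'') = pm" for st
  have J1: "J s1" using so1 by (simp add: J_def pm_def)
  have att: "run attempt r' st ''plus'' = st ''plus''" "run attempt r' st ''minus'' = st ''minus''" for r' st
    by (rule run_frame, simp add: trace_def write_output_def)+
  have step: "J (run attempt (r @ [i]) st)" if "i < m" "J st" for i st
    using attempt_correct(1)[of st i "r @ [i]" r0 r1 r2] that r att by (simp add: J_def del: run.simps)
  have persist: "run attempt (r @ [i]) st ''found'' 0 \<noteq> 0" if "i < m" "J st" "st ''found'' 0 \<noteq> 0" for i st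
    using attempt_correct(2)[of st i "r @ [i]" r0 r1 r2] that r by (simp add: J_def del: run.simps)
  show "sound (run guess r s)"
    unfolding run
    using run_For_inv[where J = J and s = s1 and n = m and c = attempt and r = r, OF n1 J1 step]
    by (simp add: J_def del: run.simps)
  show "run guess r s ''found'' 0 \<noteq> 0" if f: "s ''found'' 0 \<noteq> 0"
  proof -
    have "J (run (For attempt) r s1) \<and> run (For attempt) r s1 ''found'' 0 \<noteq> 0"
    proof (rule run_For_inv[where J = "\<lambda>st. J st \<and> st ''found'' 0 \<noteq> 0" and n = m])
      show "J s1 \<and> s1 ''found'' 0 \<noteq> 0" using J1 f fr by simp
    qed (use n1 step persist in \<open>simp_all del: run.simps\<close>)
    then show ?thesis unfolding run by blast
  qed
  show "run guess r s ''found'' 0 \<noteq> 0" if right: "r = [v m, partner P True (v m), partner P False (v m)]"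
  proof -
    have l: "loaded s" using s by (simp add: sound_def)
    have vm: "v m < m" using v_less[of m] m_ge_2 by simp
    have st: "decoded (run start r s)" "v m \<notin> alive (run start r s)"
      using start_correct[OF l vm right] by auto
    have dec: "decoded s1" "alive s1 = {}" using decode_correct[OF st r] by (simp_all add: s1_def)
    have pm1: "\<forall>x<m. s1 ''plus'' x = partner P True x \<and> s1 ''minus'' x = partner P False x"
      using dec by (simp add: decoded_def linked_def)
    from msg obtain q where q: "walk m q (length P)" "P = walk_edges q (length P)" by (rule message_walk)
    have q0: "q 0 < m" using q(1) by (simp add: walk_def)
    show ?thesis
      unfolding run
    proof (rule run_For_hit[where J = J and n = m and h = "q 0" and H = "\<lambda>st. st ''found'' 0 \<noteq> 0"])
      show "run attempt (r @ [q 0]) st ''found'' 0 \<noteq> 0" if J: "J st" for st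
      proof (rule attempt_correct(3)[OF _ q0 _ q refl])
        show "sound st" using J by (simp add: J_def)
        show "r @ [q 0] = [r0, r1, r2, q 0]" by (simp add: r)
        show "\<forall>x<m. st ''plus'' x = partner P True x \<and> st ''minus'' x = partner P False x"
          using J pm1 by (simp add: J_def pm_def)
      qed
    qed (fact n1 J1 step q0 persist)+
  qed
qed

text \<open>Three nested searches hit the right guess, and \<open>''found''\<close> persists through
  all later ones. An earlier guess that happens to succeed is acceptable by
  \<open>sound\<close>.\<close>

lemma attack_prog_success: "success (run attack_prog [] (initial_mem input))"
proof -
  let ?s = "initial_mem input"
  let ?f = "\<lambda>s. s ''found'' 0 \<noteq> (0::nat)"
  have s: "sound ?s" using loaded_initial by (simp add: sound_def initial_mem_def)
  have n: "st ''in'' 0 = m" if "sound st" for st using that by (simp add: sound_def loadedD)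
  have vm: "v m < m" using v_less[of m] m_ge_2 by simp
  have g1: "sound (run guess [z, a, b] st)" if "sound st" for z a b st
    by (rule guess_correct(1)[OF that refl])
  have g2: "?f (run guess [z, a, b] st)" if "sound st" "?f st" for z a b st
    using guess_correct(2)[OF that(1) refl that(2)] .
  have f1: "sound (run (For guess) [z, a] st)" if "sound st" for z a st
    by (rule run_For_inv[where J = sound and n = m]) (use n[OF that] that g1 in \<open>simp_all del: run.simps\<close>)
  have f2: "?f (run (For guess) [z, a] st)" if "sound st" "?f st" for z a st
    using run_For_inv[where J = "\<lambda>st. sound st \<and> ?f st" and n = m and s = st and c = guess and r = "[z, a]"]
      n[OF that(1)] that g1 g2 by (simp del: run.simps)
  have ff1: "sound (run (For (For guess)) [z] st)" if "sound st" for z st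
    by (rule run_For_inv[where J = sound and n = m]) (use n[OF that] that f1 in \<open>simp_all del: run.simps\<close>)
  have ff2: "?f (run (For (For guess)) [z] st)" if "sound st" "?f st" for z st
    using run_For_inv[where J = "\<lambda>st. sound st \<and> ?f st" and n = m and s = st and c = "For guess" and r = "[z]"]
      n[OF that(1)] that f1 f2 by (simp del: run.simps)
  let ?z = "v m" and ?a = "partner P True (v m)" and ?b = "partner P False (v m)"
  have h1: "?f (run (For guess) [?z, ?a] st)" if "sound st" for st
    by (rule run_For_hit[where J = sound and n = m and h = ?b and H = ?f])
      (use n[OF that] that g1 g2 guess_correct(3)[OF _ refl refl] partner_lt[OF vm] in \<open>simp_all del: run.simps\<close>)
  have h2: "?f (run (For (For guess)) [?z] st)" if "sound st" for st
    by (rule run_For_hit[where J = sound and n = m and h = ?a and H = ?f])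
      (use n[OF that] that f1 f2 h1 partner_lt[OF vm] in \<open>simp_all del: run.simps\<close>)
  have "?f (run attack_prog [] ?s)"
    unfolding attack_prog_def
    by (rule run_For_hit[where J = sound and n = m and h = ?z and H = ?f])
      (use n[OF s] s ff1 ff2 h2 vm in \<open>simp_all del: run.simps\<close>)
  moreover have "sound (run attack_prog [] ?s)"
    unfolding attack_prog_def
    by (rule run_For_inv[where J = sound and n = m]) (use n[OF s] s ff1 in \<open>simp_all del: run.simps\<close>)
  ultimately show ?thesis by (simp add: sound_def)
qed

section \<open>Input size in terms of the key\<close>

lemma less_key_size:
  assumes "x \<in> set (encode_key pk)" shows "x < 2 ^ key_size pk"
proof -
  have "len x \<le> key_size pk"
    unfolding key_size_def using assms by (intro member_le_sum_list) auto
  then have "(2::nat) ^ (len x - 1) \<le> 2 ^ key_size pk" by (intro power_increasing) auto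
  with less_two_power_len[of x] show ?thesis by linarith
qed

text \<open>Every key word counts in \<open>key_size\<close> with its length, and ciphertext words
  are residues below \<open>p\<close>. Each word has length at least 1 and a key with
  \<open>m \<ge> 2\<close> has more than \<open>m\<close> words, so loop lengths are covered as
  well.\<close>

lemma bounded_initial: "bounded (key_size pk) [] (initial_mem input)"
proof -
  let ?s = "initial_mem input" and ?N = "key_size pk"
  have l: "loaded ?s" by (rule loaded_initial)
  have "?s a i \<le> 2 ^ ?N" for a i
  proof -
    have "x < 2 ^ ?N" if "x \<in> set input" for x
    proof (cases "x \<in> set (encode_key pk)")
      case False
      with that obtain t where t: "t \<in> {1..m}" "x = nat (encrypt pk P t)"
        by (auto simp: attack_input_def encode_vector_def dim less_Suc_eq_le simp del: upt_Suc)
      then have "x < p" using p_pos by (auto simp: encrypt_def dim nat_less_iff)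
      moreover have "p < 2 ^ ?N" by (rule less_key_size) (simp add: encode_key_def)
      ultimately show ?thesis by simp
    qed (rule less_key_size)
    then show ?thesis by (auto simp: initial_mem_def less_imp_le)
  qed
  moreover have "m \<le> ?N"
  proof -
    have "length xs \<le> sum_list (map len xs)" for xs by (induction xs) (auto simp: len_def)
    from this[of "encode_key pk"] have "length (encode_key pk) \<le> ?N" by (simp add: key_size_def)
    have "m \<le> (m + 2) * 1" by simp
    also have "\<dots> \<le> (m + 2) * (m * (m - 1) div 2)"
    proof (rule mult_le_mono2)
      have "2 * 1 \<le> m * (m - 1)" using m_ge_2 by (intro mult_le_mono) auto
      then show "1 \<le> m * (m - 1) div 2" by linarith
    qed
    also have "\<dots> \<le> length (encode_key pk)" unfolding length_encode_key by (rule le_add2)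
    also have "\<dots> \<le> ?N" by fact
    finally show ?thesis .
  qed
  moreover have "cap ?s \<le> 2 ^ ?N"
  proof -
    have le: "len m + len p \<le> ?N" by (simp add: key_size_def encode_key_def)
    have "m < 2 ^ (len m - 1)" "p < 2 ^ (len p - 1)" by (rule less_two_power_len)+
    \<comment> \<open>A product is compared instead of a sum because the lengths of \<open>m\<close>
      and \<open>p\<close> add up inside \<open>key_size\<close>.\<close>
    then have "(m + 1) * (p + 1) \<le> 2 ^ (len m - 1) * 2 ^ (len p - 1)" by (intro mult_le_mono) auto
    also have "\<dots> = 2 ^ (len m - 1 + (len p - 1))" by (simp add: power_add)
    also have "\<dots> \<le> 2 ^ ?N" using le by (intro power_increasing) auto
    finally have "(m + 1) * (p + 1) \<le> 2 ^ ?N" .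
    moreover have "p + m + 1 \<le> (m + 1) * (p + 1)" by simp
    ultimately show ?thesis using loadedD[OF l] by simp
  qed
  ultimately show ?thesis using loadedD[OF l] by (simp add: bounded_def)
qed

end

text \<open>Program and polynomial are chosen before the system. By
  \<open>ciphertext_ambiguous\<close> a ciphertext need not determine its message, so the output is
  in every case some message with the given ciphertext. It is the message sent whenever the
  ciphertext determines the edges, and \<open>message_unique\<close> guarantees this under
  \<open>no_wraparound\<close>.\<close>

theorem theorem1:
  shows "\<exists>(attack :: com) (q :: nat poly). \<forall>pk What M v P.
    in_family pk What M v \<and> zero_limited_noise (nverts pk) What v \<and> message (edges pk) P \<longrightarrow>
    (\<exists>n s. exec attack (initial_mem (attack_input pk (encrypt pk P))) n s \<and>
       n \<le> poly q (key_size pk) \<and>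
       (\<exists>Q. message (edges pk) Q \<and> encrypt pk Q = encrypt pk P \<and> output_edges s = set Q) \<and>
       ((\<forall>Q. message (edges pk) Q \<and> encrypt pk Q = encrypt pk P \<longrightarrow> set Q = set P) \<longrightarrow>
          output_edges s = set P) \<and>
       (no_wraparound pk What v \<longrightarrow> output_edges s = set P))"
proof -
  from compile_correct[OF wf_attack_prog] obtain q where
    q: "implements (compile 0 attack_prog) 0 attack_prog q" ..
  show ?thesis
  proof (intro exI[of _ "compile 0 attack_prog"] exI[of _ q] allI impI, elim conjE)
    fix pk What M v P
    assume *: "in_family pk What M v" "zero_limited_noise (nverts pk) What v" "message (edges pk) P"
    interpret zero_noise_key pk What M v using * by unfold_locales
    interpret attacked_message pk What M v P using *(3) edges by unfold_locales simp
    have "agrees [] (initial_mem input) (initial_mem input)" by (simp add: agrees_def)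
    from implementsE[OF q _ bounded_initial this] obtain n s where
      s: "exec (compile 0 attack_prog) (initial_mem input) n s" "n \<le> poly q (key_size pk)"
        "agrees [] (run attack_prog [] (initial_mem input)) s" by auto
    have "output_edges s = output_edges (run attack_prog [] (initial_mem input))"
      using s(3) by (simp add: agrees_def output_edges_def)
    with attack_prog_success obtain Q where Q: "message (edges pk) Q" "encrypt pk Q = encrypt pk P"
      "output_edges s = set Q" unfolding success_def edges by auto
    moreover have "set Q = set P" if "no_wraparound pk What v"
      using message_unique[OF that message_alternating alt Q(2)] Q(1) edges by simp
    ultimately show "\<exists>n s. exec (compile 0 attack_prog) (initial_mem input) n s \<and>
       n \<le> poly q (key_size pk) \<and>
       (\<exists>Q. message (edges pk) Q \<and> encrypt pk Q = encrypt pk P \<and> output_edges s = set Q) \<and>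
       ((\<forall>Q. message (edges pk) Q \<and> encrypt pk Q = encrypt pk P \<longrightarrow> set Q = set P) \<longrightarrow>
          output_edges s = set P) \<and>
       (no_wraparound pk What v \<longrightarrow> output_edges s = set P)"
      using s(1,2) by (intro exI[of _ n] exI[of _ s]) auto
  qed
qed

end
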